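(* Let $G$ be an arbitrary tile in $\mathbb{R}^d$, $n\ge0$, $\varphi=B_n^G$ the corresponding tile B-spline, and $\varphi_1$ its orthogonalization. Let $\Phi_k=(\varphi,\varphi(\cdot+k))$ for all $k\in\mathbb{Z}^d$ and $\Phi(\xi)=\sum_{k\in\mathbb{Z}^d}\Phi_ke^{-2\pi i(k,\xi)}$. Then $\varphi_1$ is a linear combination of integer shifts of $\varphi$: $$\varphi_1(x)=\sum_{k\in\mathbb{Z}^d}b_k\varphi(x-k),$$ where $b_k$ are the Fourier coefficients of the function $\frac1{\sqrt{\Phi(\xi)}}=\sum_{k\in\mathbb{Z}^d}b_ke^{-2\pi i(k,\xi)}$.
   Context: Let $M\in\mathbb{Z}^{d\times d}$ be expanding (all eigenvalues larger than $1$ in modulus) and $D\ni0$ a set of representatives of $\mathbb{Z}^d/M\mathbb{Z}^d$. $G=\{\sum_{k\ge1}M^{-k}\Delta_k:\Delta_k\in D\}$ is called a tile if its Lebesgue measure is $1$. $B_n^G$ is the convolution of $n+1$ copies of the indicator $\chi_G$. $(\cdot,\cdot)$ for functions is the $L_2(\mathbb{R}^d)$ inner product. Fourier transform: $\widehat f(\xi)=\int f(x)e^{-2\pi i(x,\xi)}dx$. The orthogonalization $\varphi_1\in L_2(\mathbb{R}^d)$ of $\varphi$ is defined by $\widehat\varphi_1(\xi)=\widehat\varphi(\xi)\big/\sqrt{\sum_{k\in\mathbb{Z}^d}|\widehat\varphi(\xi+k)|^2}$. The series converges in $L_2(\mathbb{R}^d)$. *)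

theory Defs
  imports "HOL-Analysis.Analysis"
begin

definition real_vec :: "int ^ 'd \<Rightarrow> real ^ 'd"
  where "real_vec k = (\<chi> i. real_of_int (k $ i))"

definition expanding :: "int ^ 'd ^ 'd \<Rightarrow> bool"
  where "expanding M \<longleftrightarrow>
    (\<forall>(\<mu> :: complex) (v :: complex ^ 'd).
        v \<noteq> 0 \<and> map_matrix of_int M *v v = \<mu> *s v \<longrightarrow> cmod \<mu> > 1)"

definition digit_set :: "int ^ 'd ^ 'd \<Rightarrow> (int ^ 'd) set \<Rightarrow> bool"
  where "digit_set M D \<longleftrightarrow>
    0 \<in> D \<and> (\<forall>x. \<exists>!\<delta>. \<delta> \<in> D \<and> (\<exists>z. x - \<delta> = M *v z))"

definition attractor :: "int ^ 'd ^ 'd \<Rightarrow> (int ^ 'd) set \<Rightarrow> (real ^ 'd) set"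
  where "attractor M D =
    {x. \<exists>\<Delta> :: nat \<Rightarrow> int ^ 'd. (\<forall>k\<ge>1. \<Delta> k \<in> D) \<and>
        (\<lambda>k. (((*v) (matrix_inv (map_matrix real_of_int M))) ^^ Suc k) (real_vec (\<Delta> (Suc k)))) sums x}"

definition is_tile :: "(real ^ 'd) set \<Rightarrow> bool"
  where "is_tile G \<longleftrightarrow>
    (\<exists>M D. expanding M \<and> digit_set M D \<and> G = attractor M D) \<and> emeasure lebesgue G = 1"

definition fun_conv :: "('a::euclidean_space \<Rightarrow> complex) \<Rightarrow> ('a \<Rightarrow> complex) \<Rightarrow> 'a \<Rightarrow> complex"
  where "fun_conv f g x = (LINT y|lebesgue. f y * g (x - y))"

primrec tile_bspline :: "(real ^ 'd) set \<Rightarrow> nat \<Rightarrow> real ^ 'd \<Rightarrow> complex"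
  where
    "tile_bspline G 0 = indicator G"
  | "tile_bspline G (Suc n) = fun_conv (tile_bspline G n) (indicator G)"

definition in_L2 :: "('a::euclidean_space \<Rightarrow> complex) \<Rightarrow> bool"
  where "in_L2 f \<longleftrightarrow> f \<in> borel_measurable lebesgue \<and> integrable lebesgue (\<lambda>x. (cmod (f x))\<^sup>2)"

definition L2_inner :: "('a::euclidean_space \<Rightarrow> complex) \<Rightarrow> ('a \<Rightarrow> complex) \<Rightarrow> complex"
  where "L2_inner f g = (LINT x|lebesgue. f x * cnj (g x))"

definition L2_norm :: "('a::euclidean_space \<Rightarrow> complex) \<Rightarrow> real"
  where "L2_norm f = sqrt (LINT x|lebesgue. (cmod (f x))\<^sup>2)"

text \<open>Membership in \<open>L\<^sub>2\<close> is required explicitly, as \<open>L2_norm\<close> is 0 on functions that are not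
  square integrable.\<close>

definition L2_tendsto ::
    "('i \<Rightarrow> 'a::euclidean_space \<Rightarrow> complex) \<Rightarrow> ('a \<Rightarrow> complex) \<Rightarrow> 'i filter \<Rightarrow> bool"
  where "L2_tendsto f g F \<longleftrightarrow>
    (\<forall>i. in_L2 (f i)) \<and> in_L2 g \<and> ((\<lambda>i. L2_norm (\<lambda>x. f i x - g x)) \<longlongrightarrow> 0) F"

definition fourier :: "('a::euclidean_space \<Rightarrow> complex) \<Rightarrow> 'a \<Rightarrow> complex"
  where "fourier f \<xi> = (LINT x|lebesgue. f x * cis (- 2 * pi * (x \<bullet> \<xi>)))"

text \<open>\<open>g\<close> represents the Fourier transform of \<open>f \<in> L\<^sub>2\<close>, i.e. the continuous extension to \<open>L\<^sub>2\<close> of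
  the integral transform on \<open>L\<^sub>1 \<inter> L\<^sub>2\<close>. As \<open>f\<close> and \<open>g\<close> are functions and not classes modulo null
  sets, this is a relation.\<close>

definition L2_fourier :: "('a::euclidean_space \<Rightarrow> complex) \<Rightarrow> ('a \<Rightarrow> complex) \<Rightarrow> bool"
  where "L2_fourier f g \<longleftrightarrow>
    (\<exists>u :: nat \<Rightarrow> 'a \<Rightarrow> complex. (\<forall>m. integrable lebesgue (u m)) \<and>
        L2_tendsto u f sequentially \<and> L2_tendsto (\<lambda>m. fourier (u m)) g sequentially)"

definition orthogonalization :: "(real ^ 'd \<Rightarrow> complex) \<Rightarrow> (real ^ 'd \<Rightarrow> complex) \<Rightarrow> bool"
  where "orthogonalization \<phi> \<phi>\<^sub>1 \<longleftrightarrow>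
    L2_fourier \<phi>\<^sub>1
      (\<lambda>\<xi>. fourier \<phi> \<xi> /
        complex_of_real (sqrt (\<Sum>\<^sub>\<infinity>k\<in>UNIV. (cmod (fourier \<phi> (\<xi> + real_vec k)))\<^sup>2)))"

text \<open>Coefficients with respect to the characters \<open>\<xi> \<mapsto> exp (- 2 \<pi> i (k, \<xi>))\<close>, hence the
  positive sign in the exponent.\<close>

definition fourier_coeff :: "(real ^ 'd \<Rightarrow> complex) \<Rightarrow> int ^ 'd \<Rightarrow> complex"
  where "fourier_coeff f k = (LINT \<xi>:cbox 0 One|lebesgue. f \<xi> * cis (2 * pi * (real_vec k \<bullet> \<xi>)))"

end

theory Submission
  imports Defs "HOL-Computational_Algebra.Fundamental_Theorem_Algebra" "HOL-Real_Asymp.Real_Asymp"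
begin

text \<open>
  Everything rests on the identity \<open>\<Phi>(\<xi>) = \<Sum>\<^sub>j |\<phi>^(\<xi> + j)|\<^sup>2\<close> for \<^emph>\<open>every\<close> \<open>\<xi>\<close>, which is Parseval's identity
  on the unit cube for the periodization of \<open>x \<mapsto> \<phi>(x) exp(-2\<pi>i(x, \<xi>))\<close>. For \<open>\<phi> = \<chi>\<^sub>G\<close> this
  periodization has modulus 1 almost everywhere, because the integer translates of \<open>G\<close> cover the space
  and \<open>G\<close> has measure 1; hence for each \<open>\<xi>\<close> some \<open>\<chi>\<^sub>G^(\<xi> + j)\<close> is nonzero, and since \<open>\<phi>^\<close> is a power
  of \<open>\<chi>\<^sub>G^\<close> the trigonometric polynomial \<open>\<Phi>\<close> is positive everywhere. A power series argument then
  shows that \<open>1/\<surd>\<Phi>\<close> has an absolutely convergent Fourier series, so the Fourier transforms of the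
  partial sums converge in \<open>L\<^sub>2\<close>, and Plancherel's theorem, obtained by integrating the first identity over
  the cube, transfers the convergence to the sums themselves.
\<close>

section \<open>Orbits of the inverse of an expanding matrix\<close>

text \<open>Two hypotheses are weaker than they look. \<open>expanding\<close> restricts
  eigenvalues, so the inverse matrix need not shrink the Euclidean norm; its orbits are shown to be
  summable through an annihilating polynomial of each vector, which avoids Jordan forms and adapted
  norms. And \<open>\<phi>\<^sub>1\<close> is given only by \<open>L2_fourier\<close>, that is, by
  some sequence of integrable and square integrable functions with no control of supports. To
  compare it with the partial sums it suffices to bound an L2 norm by a multiple of the L2 norm of
  the Fourier transform, for integrable functions; so beyond bounded support Plancherel is needed
  only as an inequality.

  It matters that the identity for \<open>\<Phi>\<close> holds at every point: a positive continuous
  function has a positive minimum on the closed cube, and this is what makes the power series for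
  \<open>1/\<surd>\<Phi>\<close> converge geometrically. An almost everywhere statement would give
  no such lower bound. That \<open>\<phi>\<close> has bounded support turns all periodizations and
  autocorrelation sums into finite sums.\<close>

definition poly_act :: "'a::field ^ 'd ^ 'd \<Rightarrow> 'a poly \<Rightarrow> 'a ^ 'd \<Rightarrow> 'a ^ 'd"
  where "poly_act B p v = fold_coeffs (\<lambda>c w. c *s v + B *v w) p 0"

lemma poly_act_0 [simp]: "poly_act B 0 v = 0"
  by (simp add: poly_act_def)

lemma poly_act_pCons [simp]: "poly_act B (pCons c p) v = c *s v + B *v poly_act B p v"
  by (cases "c = 0 \<and> p = 0") (auto simp: poly_act_def)

lemma poly_act_add: "poly_act B (p + q) v = poly_act B p v + poly_act B q v"
  by (induction p q rule: poly_induct2)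
    (auto simp: vector_sadd_rdistrib matrix_vector_right_distrib)

lemma poly_act_smult: "poly_act B (smult c p) v = c *s poly_act B p v"
  by (induction p) (auto simp: vector_ssub_ldistrib vec.scale_right_distrib vector_scalar_commute)

text \<open>\<open>poly_act\<close> is the vector p(B) v in Horner form, so no algebra of matrix
  polynomials is needed. If the product annihilates \<open>v\<close>, then p(B) v is either 0 or an
  eigenvector for \<open>l\<close>; this is how roots and eigenvalues get linked.\<close>

lemma poly_act_linear_factor:
  "poly_act B ([:- l, 1:] * p) v = B *v poly_act B p v - l *s poly_act B p v"
proof -
  have "[:- l, 1:] * p = pCons 0 p + smult (- l) p" by simp
  then show ?thesis by (simp only: poly_act_add poly_act_smult poly_act_pCons) simp
qed

lemma poly_act_diff_right: "poly_act B p (v - w) = poly_act B p v - poly_act B p w"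
  by (induction p)
    (auto simp: matrix_vector_right_distrib matrix_vector_mult_diff_distrib vec.scale_right_diff_distrib)

lemma poly_act_scale_right: "poly_act B p (c *s v) = c *s poly_act B p v"
  by (induction p) (auto simp: vec.scale_right_distrib vector_scalar_commute ac_simps)

lemma poly_act_mult_right: "poly_act B p (B *v v) = B *v poly_act B p v"
  by (induction p) (auto simp: matrix_vector_right_distrib vector_scalar_commute)

lemma poly_act_sum: "poly_act B (\<Sum>i\<in>I. f i) v = (\<Sum>i\<in>I. poly_act B (f i) v)"
  by (induction I rule: infinite_finite_induct) (auto simp: poly_act_add)

lemma poly_act_monom: "poly_act B (monom c n) v = c *s ((*v) B ^^ n) v"
  by (induction n) (auto simp: monom_0 monom_Suc vector_scalar_commute)

text \<open>Summing the recursion bounds each partial sum S by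
  \<open>norm (x 0) + r * S + suminf w\<close>; since \<open>r < 1\<close>, this can be solved for
  S.\<close>

lemma summable_norm_affine_recursion:
  fixes x :: "nat \<Rightarrow> 'a::real_normed_vector"
  assumes step: "\<And>n. norm (x (Suc n)) \<le> r * norm (x n) + w n"
    and r: "0 \<le> r" "r < 1" and w: "summable w" "\<And>n. 0 \<le> w n"
  shows "summable (\<lambda>n. norm (x n))"
proof (rule summableI_nonneg_bounded)
  fix N
  have "(\<Sum>n<N. norm (x n)) \<le> (\<Sum>n<Suc N. norm (x n))"
    by simp
  also have "\<dots> = norm (x 0) + (\<Sum>n<N. norm (x (Suc n)))"
    by (rule sum.lessThan_Suc_shift)
  also have "\<dots> \<le> norm (x 0) + (\<Sum>n<N. r * norm (x n) + w n)"
    by (intro add_left_mono sum_mono step)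
  also have "\<dots> = norm (x 0) + r * (\<Sum>n<N. norm (x n)) + (\<Sum>n<N. w n)"
    by (simp add: sum.distrib sum_distrib_left)
  also have "(\<Sum>n<N. w n) \<le> suminf w"
    using w by (intro sum_le_suminf) auto
  finally show "(\<Sum>n<N. norm (x n)) \<le> (norm (x 0) + suminf w) / (1 - r)"
    using r by (simp add: field_simps)
qed auto

lemma norm_scalar_mult_vec: "norm (c *s v) = norm c * norm v" for v :: "complex ^ 'd"
  by (simp add: norm_vec_def L2_set_def norm_mult power_mult_distrib
      flip: sum_distrib_left) (simp add: real_sqrt_mult)

text \<open>Induction on the degree of an annihilating polynomial: a linear factor whose root is not an
  eigenvalue can be dropped; the other roots have modulus below 1 and give a convergent recursion.\<close>

lemma summable_orbit_of_annihilated: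
  fixes B :: "complex ^ 'd ^ 'd"
  assumes ev: "\<And>l v. v \<noteq> 0 \<Longrightarrow> B *v v = l *s v \<Longrightarrow> cmod l < 1"
    and "p \<noteq> 0" "poly_act B p v = 0"
  shows "summable (\<lambda>n. norm (((*v) B ^^ n) v))"
  using assms(2,3)
proof (induction "degree p" arbitrary: p v)
  case 0
  then obtain c where c: "p = [:c:]" "c \<noteq> 0"
    by (metis degree_eq_zeroE pCons_0_0)
  with 0 have "v = 0" by simp
  moreover have "((*v) B ^^ n) 0 = 0" for n by (induction n) auto
  ultimately show ?case by simp
next
  case (Suc m)
  from Suc have "\<not> constant (poly p)" by (simp add: constant_degree)
  from fundamental_theorem_of_algebra[OF this] obtain l where "poly p l = 0" by blast
  then obtain q where pq: "p = [:- l, 1:] * q" by (metis dvdE poly_eq_0_iff_dvd)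
  have q0: "q \<noteq> 0" using pq Suc.prems by auto
  have deg: "degree q = m"
    using Suc.hyps(2) q0 unfolding pq by (subst (asm) degree_mult_eq) auto
  have eq: "B *v poly_act B q v - l *s poly_act B q v = 0"
    using Suc.prems unfolding pq poly_act_linear_factor by simp
  show ?case
  proof (cases "cmod l < 1")
    case True
    \<comment> \<open>The vector (B - l) v is annihilated by the cofactor \<open>q\<close>, so the
      induction hypothesis covers its orbit, which is the inhomogeneous term in the recursion for
      the orbit of \<open>v\<close>.\<close>
    define w where "w = B *v v - l *s v"
    have "poly_act B q w = 0"
      unfolding w_def poly_act_diff_right poly_act_mult_right poly_act_scale_right by (rule eq)
    then have sw: "summable (\<lambda>n. norm (((*v) B ^^ n) w))"
      using Suc.hyps(1)[of q w] deg q0 by simp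
    have rec: "((*v) B ^^ Suc n) v = l *s ((*v) B ^^ n) v + ((*v) B ^^ n) w" for n
    proof (induction n)
      case (Suc n)
      have "((*v) B ^^ Suc (Suc n)) v = B *v ((*v) B ^^ Suc n) v" by simp
      also have "\<dots> = B *v (l *s ((*v) B ^^ n) v + ((*v) B ^^ n) w)" unfolding Suc ..
      finally show ?case
        by (simp add: matrix_vector_right_distrib vector_scalar_commute)
    qed (simp add: w_def)
    show ?thesis
    proof (rule summable_norm_affine_recursion[OF _ _ True sw])
      fix n
      show "norm (((*v) B ^^ Suc n) v) \<le> cmod l * norm (((*v) B ^^ n) v) + norm (((*v) B ^^ n) w)"
        unfolding rec norm_scalar_mult_vec[symmetric] by (rule norm_triangle_ineq)
    qed auto
  next
    case False
    with ev[of "poly_act B q v" l] eq have "poly_act B q v = 0" by auto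
    then show ?thesis using Suc.hyps(1)[of q v] deg q0 by simp
  qed
qed

text \<open>One more orbit vector than the real dimension gives a real linear relation, and its
  coefficients form the polynomial. A repetition in the orbit is treated apart, because
  \<open>dependent\<close> speaks of sets and would not notice it.\<close>

lemma ex_annihilating_poly:
  fixes B :: "complex ^ 'd ^ 'd"
  shows "\<exists>p. p \<noteq> 0 \<and> poly_act B p v = 0"
proof -
  define f where "f n = ((*v) B ^^ n) v" for n
  define N where "N = DIM(complex ^ 'd)"
  show ?thesis
  proof (cases "inj_on f {..N}")
    case False
    then obtain i j where ij: "f i = f j" "i \<noteq> j" by (auto simp: inj_on_def)
    have "monom (1::complex) i + monom (- 1) j \<noteq> 0"
    proof
      assume "monom (1::complex) i + monom (- 1) j = 0"
      then have "coeff (monom (1::complex) i + monom (- 1) j) i = 0" by simp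
      with ij show False by simp
    qed
    moreover have "poly_act B (monom 1 i + monom (- 1) j) v = 0"
      using ij by (simp add: poly_act_add poly_act_monom f_def)
    ultimately show ?thesis by blast
  next
    case True
    have "dependent (f ` {..N})"
      by (rule dependent_biggerset) (simp only: card_image[OF True], simp add: N_def)
    then obtain u w where u: "(\<Sum>y\<in>f ` {..N}. u y *\<^sub>R y) = 0" and w: "w \<in> f ` {..N}" "u w \<noteq> 0"
      by (auto simp: dependent_finite)
    define p where "p = (\<Sum>i\<le>N. monom (complex_of_real (u (f i))) i)"
    obtain i where i: "i \<le> N" "w = f i" using w by auto
    have "coeff p i = complex_of_real (u (f i))"
      unfolding p_def coeff_sum using i by (simp add: if_distrib cong: if_cong)
    with w i have "p \<noteq> 0" by auto
    moreover have "poly_act B p v = (\<Sum>i\<le>N. u (f i) *\<^sub>R f i)"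
      unfolding p_def poly_act_sum poly_act_monom f_def
      by (intro sum.cong refl) (simp only: vec_eq_iff vector_smult_component vector_scaleR_component, simp add: scaleR_conv_of_real)
    moreover have "\<dots> = 0" using u by (simp add: sum.reindex[OF True])
    ultimately show ?thesis by metis
  qed
qed

definition cvec :: "real ^ 'd \<Rightarrow> complex ^ 'd"
  where "cvec v = (\<chi> i. complex_of_real (v $ i))"

lemma cvec_matrix_vector_mult: "map_matrix complex_of_real B *v cvec v = cvec (B *v v)"
  by (simp add: vec_eq_iff cvec_def matrix_vector_mult_def map_matrix_def)

lemma norm_cvec: "norm (cvec v) = norm v"
  by (simp add: cvec_def norm_vec_def)

abbreviation rmat :: "int ^ 'd ^ 'd \<Rightarrow> real ^ 'd ^ 'd"
  where "rmat M \<equiv> map_matrix real_of_int M"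

text \<open>A kernel vector, complexified, would be an eigenvector for the eigenvalue 0, whose
  modulus is not larger than 1.\<close>

lemma expanding_invertible:
  fixes M :: "int ^ 'd ^ 'd"
  assumes "expanding M"
  shows "invertible (rmat M)"
proof (rule ccontr)
  assume "\<not> ?thesis"
  then obtain x where x: "rmat M *v x = 0" "x \<noteq> 0"
    unfolding invertible_left_inverse matrix_left_invertible_ker by auto
  have "map_matrix of_int M = map_matrix complex_of_real (rmat M)"
    by (simp add: vec_eq_iff map_matrix_def)
  then have "map_matrix of_int M *v cvec x = 0 *s cvec x"
    using x by (simp add: cvec_matrix_vector_mult) (simp add: cvec_def vec_eq_iff)
  moreover have "cvec x \<noteq> 0" using x norm_cvec[of x] by auto
  ultimately have "cmod 0 > 1" using assms unfolding expanding_def by blast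
  then show False by simp
qed

lemma matrix_inv_works:
  assumes "invertible A"
  shows "A ** matrix_inv A = mat 1" "matrix_inv A ** A = mat 1"
  using assms unfolding invertible_def matrix_inv_def
  by (metis (mono_tags, lifting) someI_ex)+

text \<open>Eigenvalues of the inverse are reciprocals of eigenvalues of \<open>M\<close>.
  Summability along each orbit is all the contraction needed later: it dominates digit expansions
  and sends the powers to 0 on every basis vector.\<close>

lemma expanding_summable_orbit:
  fixes M :: "int ^ 'd ^ 'd"
  assumes "expanding M"
  shows "summable (\<lambda>n. norm (((*v) (matrix_inv (rmat M)) ^^ n) v))"
proof -
  define A where "A = matrix_inv (rmat M)"
  define B where "B = map_matrix complex_of_real A"
  define C where "C = map_matrix complex_of_real (rmat M)"
  have C: "map_matrix of_int M = C"
    by (simp add: C_def vec_eq_iff map_matrix_def)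
  have "rmat M ** A = mat 1"
    using matrix_inv_works[OF expanding_invertible[OF assms]] by (simp add: A_def)
  moreover have "(C ** B) $ i $ j = complex_of_real ((rmat M ** A) $ i $ j)" for i j
    by (simp add: C_def B_def matrix_matrix_mult_def map_matrix_def)
  ultimately have CB: "C ** B = mat 1"
    by (simp add: vec_eq_iff mat_def)
  have ev: "cmod l < 1" if v: "v \<noteq> 0" "B *v v = l *s v" for l v
  proof -
    have "v = C *v (B *v v)" by (simp add: matrix_vector_mul_assoc CB)
    then have e: "v = l *s (C *v v)" unfolding v(2) by (simp add: vector_scalar_commute)
    then have l: "l \<noteq> 0" using v by auto
    have "C *v v = inverse l *s v"
      by (subst (2) e) (use l in \<open>simp add: vector_smult_assoc\<close>)
    then have "cmod (inverse l) > 1"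
      using assms v unfolding expanding_def C by blast
    then show ?thesis using l by (simp add: norm_inverse one_less_inverse_iff)
  qed
  obtain p where p: "p \<noteq> 0" "poly_act B p (cvec v) = 0" using ex_annihilating_poly by blast
  have "((*v) B ^^ n) (cvec v) = cvec (((*v) A ^^ n) v)" for n
    by (induction n) (auto simp: B_def cvec_matrix_vector_mult)
  with summable_orbit_of_annihilated[OF ev p] show ?thesis by (simp add: norm_cvec A_def)
qed

section \<open>Compactness and covering property of the attractor\<close>

definition freq_box :: "nat \<Rightarrow> (int ^ 'd) set"
  where "freq_box N = {k. \<forall>i. \<bar>k $ i\<bar> \<le> int N}"

lemma bij_betw_freq_box: "bij_betw vec_nth (freq_box N :: (int ^ 'd) set) (PiE UNIV (\<lambda>_. {- int N..int N}))"
  by (rule bij_betwI[where g = vec_lambda])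
    (auto simp: freq_box_def abs_le_iff PiE_iff minus_le_iff)

lemma finite_freq_box [simp]: "finite (freq_box N :: (int ^ 'd) set)"
  by (rule bij_betw_finite[THEN iffD2, OF bij_betw_freq_box]) (auto intro: finite_PiE)

text \<open>The polynomial growth of this count in \<open>N\<close> is later weighed against a
  geometric decay of Fourier coefficients.\<close>

lemma card_freq_box: "card (freq_box N :: (int ^ 'd) set) = (2 * N + 1) ^ CARD('d)"
  unfolding bij_betw_same_card[OF bij_betw_freq_box] by (simp add: card_PiE nat_add_distrib nat_mult_distrib)

lemma real_vec_nth [simp]: "real_vec k $ i = real_of_int (k $ i)"
  by (simp add: real_vec_def)

lemma real_vec_add: "real_vec (k + l) = real_vec k + real_vec l"
  and real_vec_diff: "real_vec (k - l) = real_vec k - real_vec l"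
  and real_vec_minus: "real_vec (- k) = - real_vec k"
  and real_vec_0 [simp]: "real_vec 0 = 0"
  by (simp_all add: vec_eq_iff)

lemma real_vec_matrix_mult: "real_vec (M *v k) = map_matrix real_of_int M *v real_vec k"
  by (simp add: vec_eq_iff matrix_vector_mult_def map_matrix_def)

lemma bounded_real_vec_subset_freq_box:
  assumes "bounded (real_vec ` S)"
  obtains N where "S \<subseteq> freq_box N"
proof -
  obtain b where b: "\<And>k. k \<in> S \<Longrightarrow> norm (real_vec k) \<le> b"
    using assms by (auto simp: bounded_iff)
  have "S \<subseteq> freq_box (nat \<lceil>b\<rceil>)"
    unfolding freq_box_def
  proof safe
    fix k i assume "k \<in> S"
    then have "\<bar>real_of_int (k $ i)\<bar> \<le> b"
      using component_le_norm_cart[of "real_vec k" i] b[of k] by simp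
    then show "\<bar>k $ i\<bar> \<le> int (nat \<lceil>b\<rceil>)" by linarith
  qed
  then show ?thesis by (rule that)
qed

lemma finite_bounded_real_vec: "bounded (real_vec ` S) \<Longrightarrow> finite S"
  by (metis bounded_real_vec_subset_freq_box finite_freq_box finite_subset)

definition floor_vec :: "real ^ 'd \<Rightarrow> int ^ 'd"
  where "floor_vec x = (\<chi> i. \<lfloor>x $ i\<rfloor>)"

text \<open>Half-open, so that the integer translates partition the space exactly, with no
  exceptional null set.\<close>

definition unit_cube :: "(real ^ 'd) set"
  where "unit_cube = {x. \<forall>i. 0 \<le> x $ i \<and> x $ i < 1}"

lemma diff_real_vec_in_unit_cube_iff: "x - real_vec k \<in> unit_cube \<longleftrightarrow> k = floor_vec x"
proof -
  have "k = floor_vec x \<longleftrightarrow> (\<forall>i. \<lfloor>x $ i\<rfloor> = k $ i)"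
    by (auto simp: floor_vec_def vec_eq_iff)
  then show ?thesis
    by (simp add: unit_cube_def floor_eq_iff algebra_simps)
qed

lemma diff_floor_vec_in_unit_cube [simp]: "x - real_vec (floor_vec x) \<in> unit_cube"
  by (simp add: diff_real_vec_in_unit_cube_iff)

lemma cbox_One_cart: "cbox 0 One = {x :: real ^ 'd. \<forall>i. 0 \<le> x $ i \<and> x $ i \<le> 1}"
  and box_One_cart: "box 0 One = {x :: real ^ 'd. \<forall>i. 0 < x $ i \<and> x $ i < 1}"
  using cart_eq_inner_axis[of "One :: real ^ 'd"]
  by (auto simp: mem_box_cart axis_in_Basis_iff)

lemma bounded_unit_cube: "bounded unit_cube"
  by (rule bounded_subset[OF bounded_cbox[of 0 One]]) (auto simp: cbox_One_cart unit_cube_def less_imp_le)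

text \<open>\<open>h\<close> reduces a digit modulo \<open>M\<close> to a lattice point in the
  bounded image of the unit cube. Distinct digits are incongruent, so \<open>h\<close> is injective,
  and a bounded set contains only finitely many lattice points.\<close>

lemma digit_set_finite:
  assumes M: "expanding M" and D: "digit_set M D"
  shows "finite D"
proof -
  define A where "A = matrix_inv (rmat M)"
  define h where "h k = k - M *v floor_vec (A *v real_vec k)" for k
  have MA: "rmat M *v (A *v x) = x" for x
    using matrix_inv_works[OF expanding_invertible[OF M]]
    by (simp add: A_def matrix_vector_mul_assoc)
  have "inj_on h D"
  proof
    fix k l assume kl: "k \<in> D" "l \<in> D" "h k = h l"
    define z where "z = floor_vec (A *v real_vec k) - floor_vec (A *v real_vec l)"
    have "M *v floor_vec (A *v real_vec k) = M *v z + M *v floor_vec (A *v real_vec l)"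
      unfolding matrix_vector_right_distrib[symmetric] by (simp add: z_def)
    then have "k - l = M *v z" using kl by (simp add: h_def algebra_simps)
    moreover have "k - k = M *v 0" by simp
    ultimately show "k = l" using D kl unfolding digit_set_def by metis
  qed
  moreover have "finite (h ` D)"
  proof (rule finite_bounded_real_vec, rule bounded_subset)
    show "bounded ((*v) (rmat M) ` unit_cube)"
      by (intro bounded_linear_image bounded_unit_cube matrix_vector_mul_bounded_linear)
    show "real_vec ` h ` D \<subseteq> (*v) (rmat M) ` unit_cube"
    proof safe
      fix k
      have "real_vec (h k) = rmat M *v (A *v real_vec k - real_vec (floor_vec (A *v real_vec k)))"
        by (simp add: h_def real_vec_diff real_vec_matrix_mult matrix_vector_mult_diff_distrib MA)
      then show "real_vec (h k) \<in> (*v) (rmat M) ` unit_cube" by simp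
    qed
  qed
  ultimately show ?thesis by (metis finite_imageD)
qed

section \<open>The attractor of a digit system\<close>

locale digit_system =
  fixes M :: "int ^ 'd ^ 'd" and D :: "(int ^ 'd) set"
  assumes expanding: "expanding M" and digits: "digit_set M D"
begin

abbreviation contr :: "real ^ 'd \<Rightarrow> real ^ 'd"
  where "contr \<equiv> (*v) (matrix_inv (rmat M))"

lemma contr_pow_linear: "bounded_linear (contr ^^ n)"
proof (induction n)
  case (Suc n)
  have "bounded_linear (\<lambda>x. contr ((contr ^^ n) x))"
    by (rule bounded_linear_compose[OF matrix_vector_mul_bounded_linear Suc])
  then show ?case by (simp add: o_def)
qed (simp add: id_def bounded_linear_ident)

lemma contr_matrix: "contr (real_vec (M *v z)) = real_vec z"
  using matrix_inv_works[OF expanding_invertible[OF expanding]]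
  by (simp add: real_vec_matrix_mult matrix_vector_mul_assoc)

text \<open>Digits are numbered from 0 here, hence the power \<open>Suc k\<close>. They are taken as
  real vectors so that digit sequences live in a product of Euclidean spaces.\<close>

definition digit_sum :: "(nat \<Rightarrow> real ^ 'd) \<Rightarrow> real ^ 'd"
  where "digit_sum \<Delta> = (\<Sum>k. (contr ^^ Suc k) (\<Delta> k))"

text \<open>A majorant of the term at index \<open>k\<close> that is uniform over all digit
  sequences, as the Weierstrass test requires.\<close>

definition digit_bound :: "nat \<Rightarrow> real"
  where "digit_bound k = (\<Sum>\<delta>\<in>D. norm ((contr ^^ Suc k) (real_vec \<delta>)))"

lemma summable_digit_bound: "summable digit_bound"
  unfolding digit_bound_def
  using expanding_summable_orbit[OF expanding]
  by (intro summable_sum) (subst summable_Suc_iff)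

lemma norm_le_digit_bound: "x \<in> real_vec ` D \<Longrightarrow> norm ((contr ^^ Suc k) x) \<le> digit_bound k"
  unfolding digit_bound_def
  using member_le_sum[of _ D "\<lambda>\<delta>. norm ((contr ^^ Suc k) (real_vec \<delta>))"]
    digit_set_finite[OF expanding digits] by auto

lemma digit_sums:
  assumes "\<And>k. \<Delta> k \<in> real_vec ` D"
  shows "(\<lambda>k. (contr ^^ Suc k) (\<Delta> k)) sums digit_sum \<Delta>"
proof -
  have "summable (\<lambda>k. (contr ^^ Suc k) (\<Delta> k))"
    by (rule summable_comparison_test'[OF summable_digit_bound]) (rule norm_le_digit_bound[OF assms])
  then show ?thesis unfolding digit_sum_def by (rule summable_sums)
qed

lemma attractor_eq: "attractor M D = digit_sum ` (PiE UNIV (\<lambda>_. real_vec ` D))"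
proof (intro set_eqI iffI)
  fix x assume "x \<in> attractor M D"
  then obtain \<Delta> where \<Delta>: "\<And>k. k \<ge> 1 \<Longrightarrow> \<Delta> k \<in> D"
    and x: "(\<lambda>k. (contr ^^ Suc k) (real_vec (\<Delta> (Suc k)))) sums x"
    unfolding attractor_def by blast
  have "x = digit_sum (\<lambda>k. real_vec (\<Delta> (Suc k)))"
    unfolding digit_sum_def using x by (rule sums_unique)
  moreover have "(\<lambda>k. real_vec (\<Delta> (Suc k))) \<in> PiE UNIV (\<lambda>_. real_vec ` D)"
    using \<Delta> by auto
  ultimately show "x \<in> digit_sum ` (PiE UNIV (\<lambda>_. real_vec ` D))" by blast
next
  fix x assume "x \<in> digit_sum ` (PiE UNIV (\<lambda>_. real_vec ` D))"
  then obtain g where g: "\<forall>k. g k \<in> real_vec ` D" "x = digit_sum g" by (force simp: PiE_UNIV_domain Pi_iff)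
  from g(1) have "\<forall>k. \<exists>e. e \<in> D \<and> g k = real_vec e" by blast
  from choice[OF this] obtain d where d: "\<And>k. d k \<in> D" "\<And>k. g k = real_vec (d k)" by blast
  show "x \<in> attractor M D"
    unfolding attractor_def mem_Collect_eq
    by (rule exI[of _ "\<lambda>k. d (k - 1)"]) (use d g digit_sums[of g] in auto)
qed

text \<open>By Tychonoff the digit sequences form a compact product of finite sets. The expansion is
  a uniform limit of functions of finitely many digits, hence continuous on it.\<close>

lemma compact_attractor: "compact (attractor M D)"
proof -
  let ?P = "PiE UNIV (\<lambda>_. real_vec ` D) :: (nat \<Rightarrow> real ^ 'd) set"
  have "compactin (product_topology (\<lambda>_. euclidean) UNIV) ?P"
    unfolding compactin_PiE using digit_set_finite[OF expanding digits]
    by (auto simp: finite_imp_compact)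
  then have "compact ?P"
    by (simp add: euclidean_product_topology)
  moreover have "continuous_on ?P digit_sum"
    unfolding digit_sum_def
  proof (rule uniform_limit_theorem)
    show "uniform_limit ?P (\<lambda>n \<Delta>. \<Sum>k<n. (contr ^^ Suc k) (\<Delta> k))
        (\<lambda>\<Delta>. \<Sum>k. (contr ^^ Suc k) (\<Delta> k)) sequentially"
      by (rule Weierstrass_m_test[OF _ summable_digit_bound])
        (intro norm_le_digit_bound, auto)
    show "\<forall>\<^sub>F n in sequentially. continuous_on ?P (\<lambda>\<Delta>. \<Sum>k<n. (contr ^^ Suc k) (\<Delta> k))"
      by (intro always_eventually allI continuous_on_sum
          bounded_linear.continuous_on[OF contr_pow_linear])
        (rule continuous_on_subset[OF continuous_on_product_coordinates], simp)
  qed simp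
  ultimately show ?thesis unfolding attractor_eq by (rule compact_continuous_image[rotated])
qed

lemma zero_in_attractor: "0 \<in> attractor M D"
  unfolding attractor_def mem_Collect_eq
  using digits linear_0[OF bounded_linear.linear[OF contr_pow_linear]]
  by (intro exI[of _ "\<lambda>_. 0"]) (auto simp: digit_set_def simp del: funpow.simps)

text \<open>Prepending the digit \<open>\<delta>\<close> to an expansion of \<open>x\<close> delays
  every other digit by one power of \<open>contr\<close>.\<close>

lemma contr_add_digit_in_attractor:
  assumes "x \<in> attractor M D" "\<delta> \<in> D"
  shows "contr (x + real_vec \<delta>) \<in> attractor M D"
proof -
  obtain g where g: "\<forall>k. g k \<in> real_vec ` D" "x = digit_sum g"
    using assms unfolding attractor_eq by (force simp: PiE_UNIV_domain Pi_iff)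
  define h where "h k = (case k of 0 \<Rightarrow> real_vec \<delta> | Suc j \<Rightarrow> g j)" for k
  have h: "h k \<in> real_vec ` D" for k using g assms by (auto simp: h_def split: nat.split)
  have "(\<lambda>k. contr ((contr ^^ Suc k) (g k))) sums contr x"
    using bounded_linear.sums[OF matrix_vector_mul_bounded_linear digit_sums[of g]] g by simp
  then have "(\<lambda>k. (contr ^^ Suc (Suc k)) (h (Suc k))) sums contr x"
    by (simp add: h_def)
  then have "(\<lambda>k. (contr ^^ Suc k) (h k)) sums (contr x + contr (real_vec \<delta>))"
    by (subst (asm) sums_Suc_iff) (simp add: h_def)
  then have "digit_sum h = contr x + contr (real_vec \<delta>)"
    unfolding digit_sum_def by (rule sums_unique[symmetric])
  then have "contr (x + real_vec \<delta>) = digit_sum h"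
    by (simp add: matrix_vector_right_distrib)
  then show ?thesis unfolding attractor_eq using h by auto
qed

text \<open>The union \<open>H\<close> of the integer translates is closed, contains the lattice and
  is mapped into itself by \<open>contr\<close>. So it contains the image of the lattice under every
  power of \<open>contr\<close>, and these ever finer lattices approach each point.\<close>

lemma attractor_translates_cover: "\<exists>k. x - real_vec k \<in> attractor M D"
proof -
  let ?G = "attractor M D"
  define H where "H = (\<Union>g\<in>?G. \<Union>z\<in>range real_vec. {g + z})"
  have "range real_vec = {x :: real ^ 'd. \<forall>i. x $ i \<in> \<int>}"
  proof safe
    fix x :: "real ^ 'd" assume "\<forall>i. x $ i \<in> \<int>"
    then have "x = real_vec (floor_vec x)" by (auto simp: vec_eq_iff floor_vec_def elim!: Ints_cases)
    then show "x \<in> range real_vec" by blast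
  qed auto
  then have "closed (range real_vec :: (real ^ 'd) set)"
    using closed_vimage[OF closed_Ints[where 'a = real], OF continuous_on_component[OF continuous_on_id]]
    by (auto simp: vimage_def intro!: closed_Collect_all)
  then have clH: "closed H" unfolding H_def by (rule compact_closed_sums[OF compact_attractor])
  \<comment> \<open>Split the lattice part of \<open>y\<close> into a digit plus a multiple of
    \<open>M\<close>: \<open>contr\<close> keeps the point with the digit inside the attractor and
    returns the multiple of \<open>M\<close> to the lattice.\<close>
  have inv: "contr y \<in> H" if y: "y \<in> H" for y
  proof -
    obtain g k where gk: "y = g + real_vec k" "g \<in> ?G" using y unfolding H_def by auto
    obtain \<delta> z where dz: "\<delta> \<in> D" "k - \<delta> = M *v z" using digits unfolding digit_set_def by blast
    have "y = (g + real_vec \<delta>) + real_vec (M *v z)"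
      unfolding gk dz(2)[symmetric] by (simp add: real_vec_diff)
    then have "contr y = contr (g + real_vec \<delta>) + real_vec z"
      by (simp add: matrix_vector_right_distrib contr_matrix)
    then show ?thesis using contr_add_digit_in_attractor[OF gk(2) dz(1)] unfolding H_def by blast
  qed
  have ZH: "(contr ^^ n) (real_vec k) \<in> H" for n k
  proof (induction n)
    case 0
    show ?case using zero_in_attractor unfolding H_def by (auto intro!: bexI[of _ 0])
  qed (use inv in auto)
  have surj: "\<exists>y. x = (contr ^^ n) y" for n
  proof (induction n)
    case (Suc n)
    then obtain y where "x = (contr ^^ n) y" by blast
    moreover have "y = contr (rmat M *v y)"
      using matrix_inv_works[OF expanding_invertible[OF expanding]]
      by (simp add: matrix_vector_mul_assoc)
    ultimately show ?case by (metis funpow_swap1 funpow.simps(2) comp_apply)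
  qed simp
  then obtain y where y: "\<And>n. x = (contr ^^ n) (y n)" by metis
  \<comment> \<open>\<open>z n\<close> rounds \<open>x\<close> to a point of the refined lattice;
    the error is \<open>contr ^^ n\<close> of a point in the unit cube, whose coordinates are at
    most 1.\<close>
  define z where "z n = (contr ^^ n) (real_vec (floor_vec (y n)))" for n
  have bnd: "norm (x - z n) \<le> (\<Sum>i\<in>Basis. norm ((contr ^^ n) i))" for n
  proof -
    define t where "t = y n - real_vec (floor_vec (y n))"
    have t: "t \<in> unit_cube" by (simp add: t_def)
    have "x - z n = (contr ^^ n) t"
      unfolding z_def t_def y[of n] linear_diff[OF bounded_linear.linear[OF contr_pow_linear]] using y by simp
    also have "t = (\<Sum>i\<in>Basis. (t \<bullet> i) *\<^sub>R i)" by (simp add: euclidean_representation)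
    also have "(contr ^^ n) \<dots> = (\<Sum>i\<in>Basis. (t \<bullet> i) *\<^sub>R (contr ^^ n) i)"
      by (simp add: linear_sum[OF bounded_linear.linear[OF contr_pow_linear]]
          linear_scale[OF bounded_linear.linear[OF contr_pow_linear]])
    also have "norm \<dots> \<le> (\<Sum>i\<in>Basis. norm ((contr ^^ n) i))"
    proof (rule sum_norm_le)
      fix i :: "real ^ 'd" assume "i \<in> Basis"
      then obtain j where "t \<bullet> i = t $ j"
        by (auto simp: Basis_vec_def simp flip: cart_eq_inner_axis)
      then have "\<bar>t \<bullet> i\<bar> \<le> 1"
        using t by (simp add: unit_cube_def less_imp_le)
      then show "norm ((t \<bullet> i) *\<^sub>R (contr ^^ n) i) \<le> norm ((contr ^^ n) i)"
        by (simp add: mult_left_le_one_le)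
    qed
    finally show ?thesis .
  qed
  have "(\<lambda>n. \<Sum>i\<in>Basis. norm ((contr ^^ n) i)) \<longlonglongrightarrow> (\<Sum>i\<in>(Basis :: (real ^ 'd) set). 0)"
    by (intro tendsto_sum summable_LIMSEQ_zero expanding_summable_orbit[OF expanding])
  then have "(\<lambda>n. \<Sum>i\<in>Basis. norm ((contr ^^ n) i)) \<longlonglongrightarrow> 0" by simp
  then have "(\<lambda>n. x - z n) \<longlonglongrightarrow> 0"
    by (rule Lim_null_comparison[OF always_eventually, rotated]) (use bnd in blast)
  then have "z \<longlonglongrightarrow> x" 
    using tendsto_diff[OF tendsto_const[of x], of "\<lambda>n. x - z n" 0] by simp
  moreover have "z n \<in> H" for n unfolding z_def by (rule ZH)
  ultimately have "x \<in> H" by (metis clH closed_sequentially)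
  then obtain g k where "x = g + real_vec k" "g \<in> ?G" unfolding H_def by auto
  then have "x - real_vec k \<in> ?G" by simp
  then show ?thesis ..
qed

end

section \<open>Characters on the unit cube\<close>

definition chr :: "int ^ 'd \<Rightarrow> real ^ 'd \<Rightarrow> complex"
  where "chr k x = cis (2 * pi * (real_vec k \<bullet> x))"

lemma chr_0 [simp]: "chr 0 x = 1"
  by (simp add: chr_def)

lemma chr_zero_right [simp]: "chr k 0 = 1"
  by (simp add: chr_def)

lemma chr_add_left: "chr (k + l) x = chr k x * chr l x"
  by (simp add: chr_def cis_mult real_vec_add inner_add_left distrib_left)

lemma chr_add_right: "chr k (x + y) = chr k x * chr k y"
  by (simp add: chr_def cis_mult inner_add_right distrib_left)

lemma cnj_chr: "cnj (chr k x) = chr (- k) x"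
  by (simp add: chr_def cis_cnj real_vec_minus)

lemma cis_minus_eq_chr: "cis (- 2 * pi * (real_vec k \<bullet> x)) = chr (- k) x"
  by (simp add: chr_def real_vec_minus)

lemma norm_chr [simp]: "norm (chr k x) = 1"
  by (simp add: chr_def)

lemma chr_real_vec [simp]: "chr k (real_vec l) = 1"
proof -
  have "real_vec k \<bullet> real_vec l = real_of_int (\<Sum>i\<in>UNIV. k $ i * l $ i)"
    by (simp add: inner_vec_def)
  then show ?thesis unfolding chr_def by (metis Ints_of_int cis_multiple_2pi)
qed

lemma continuous_on_chr [continuous_intros]: "continuous_on S (chr k)"
  unfolding chr_def by (intro continuous_intros)

lemma borel_measurable_chr [measurable]: "chr k \<in> borel_measurable borel"
  by (intro borel_measurable_continuous_onI continuous_on_chr)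

section \<open>The half-open unit cube as a probability space\<close>

lemma unit_cube_borel [measurable]: "(unit_cube :: (real ^ 'd) set) \<in> sets borel"
proof -
  have "unit_cube = (\<Inter>i\<in>UNIV. {x :: real ^ 'd. x $ i \<ge> 0} \<inter> {x. x $ i < 1})"
    by (auto simp: unit_cube_def)
  moreover have "\<dots> \<in> sets borel"
    by (intro sets.finite_INT sets.Int borel_closed borel_open closed_halfspace_component_ge_cart
        open_halfspace_component_lt_cart) auto
  ultimately show ?thesis by simp
qed

abbreviation cube_measure :: "(real ^ 'd) measure"
  where "cube_measure \<equiv> restrict_space lborel unit_cube"

lemma space_cube_measure: "space cube_measure = unit_cube"
  by (simp add: space_restrict_space)

lemma borel_measurable_cube_measure: "f \<in> borel_measurable borel \<Longrightarrow> f \<in> borel_measurable cube_measure"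
  by (intro measurable_restrict_space1) simp

lemma null_sets_cbox_minus_box: "cbox a b - box a b \<in> null_sets (lborel :: 'a::euclidean_space measure)"
  by (rule null_setsI)
    (auto simp: emeasure_Diff box_subset_cbox emeasure_lborel_box_eq emeasure_lborel_cbox_eq)

text \<open>Mediates between the closed cube, on which \<open>fourier_coeff\<close> and compactness
  arguments live, and the half-open cube used for tiling.\<close>

lemma unit_cube_Un_null:
  obtains N where "N \<in> null_sets lborel" "cbox 0 One = unit_cube \<union> N" "unit_cube \<inter> N = {}"
proof
  let ?N = "cbox 0 One - unit_cube :: (real ^ 'd) set"
  have "box 0 One \<subseteq> (unit_cube :: (real ^ 'd) set)" "unit_cube \<subseteq> (cbox 0 One :: (real ^ 'd) set)"
    by (auto simp: unit_cube_def cbox_One_cart box_One_cart less_imp_le)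
  then show "cbox 0 One = unit_cube \<union> ?N" "unit_cube \<inter> ?N = {}" by auto
  show "?N \<in> null_sets lborel"
    by (rule null_sets_subset[OF null_sets_cbox_minus_box[of 0 One]]) (use \<open>box 0 One \<subseteq> unit_cube\<close> in auto)
qed

lemma emeasure_unit_cube: "emeasure lborel (unit_cube :: (real ^ 'd) set) = 1"
proof -
  obtain N :: "(real ^ 'd) set" where N: "N \<in> null_sets lborel" "cbox 0 One = unit_cube \<union> N" "unit_cube \<inter> N = {}"
    by (rule unit_cube_Un_null)
  have "emeasure lborel (unit_cube \<union> N) = emeasure lborel (unit_cube :: (real ^ 'd) set)"
    using N by (intro emeasure_Un_null_set) auto
  moreover have "emeasure lborel (cbox 0 One :: (real ^ 'd) set) = 1"
    by (simp add: emeasure_lborel_cbox_eq)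
  ultimately show ?thesis using N by simp
qed

interpretation cube: finite_measure "cube_measure :: (real ^ 'd) measure"
  by (rule finite_measureI) (simp add: emeasure_restrict_space space_restrict_space emeasure_unit_cube)


lemma integrable_cube_measure:
  fixes f :: "real ^ 'd \<Rightarrow> 'b::{banach, second_countable_topology}"
  assumes "f \<in> borel_measurable borel" "\<And>x. norm (f x) \<le> B"
  shows "integrable cube_measure f"
  using assms by (intro cube.integrable_const_bound[of _ B] borel_measurable_cube_measure) auto

section \<open>Translation invariance and unfolding of integrals over the cube\<close>

lemma nn_integral_lborel_translate:
  fixes c :: "'a::euclidean_space"
  assumes [measurable]: "f \<in> borel_measurable borel"
  shows "(\<integral>\<^sup>+x. f (x + c) \<partial>lborel) = (\<integral>\<^sup>+x. f x \<partial>lborel)"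
  by (subst (2) lborel_distr_plus[of c, symmetric], subst nn_integral_distr) (auto simp: add.commute)

lemma integral_lborel_translate:
  fixes c :: "'a::euclidean_space" and f :: "'a \<Rightarrow> 'b::{banach, second_countable_topology}"
  assumes [measurable]: "f \<in> borel_measurable borel"
  shows "(LINT x|lborel. f (x + c)) = (LINT x|lborel. f x)"
  by (subst (2) lborel_distr_plus[of c, symmetric], subst integral_distr) (auto simp: add.commute)

lemma integrable_lborel_translate:
  fixes c :: "'a::euclidean_space" and f :: "'a \<Rightarrow> 'b::{banach, second_countable_topology}"
  assumes f: "integrable lborel f"
  shows "integrable lborel (\<lambda>x. f (x + c))"
proof -
  have [measurable]: "f \<in> borel_measurable borel" using f by auto
  have "integrable (distr lborel borel ((+) c)) f" using f by (simp add: lborel_distr_plus)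
  then show ?thesis by (subst (asm) integrable_distr_eq) (auto simp: add.commute)
qed

lemma finite_shifts_meeting_cube:
  fixes S :: "(real ^ 'd) set"
  assumes "bounded S"
  shows "finite {k. \<exists>x\<in>unit_cube. x + real_vec k \<in> S}"
proof (rule finite_bounded_real_vec)
  obtain b c where b: "\<And>x. x \<in> S \<Longrightarrow> norm x \<le> b" and c: "\<And>x :: real ^ 'd. x \<in> unit_cube \<Longrightarrow> norm x \<le> c"
    using assms bounded_unit_cube unfolding bounded_iff by metis
  have "norm (real_vec k) \<le> b + c" if "x \<in> unit_cube" "x + real_vec k \<in> S" for x k
    using norm_triangle_ineq4[of "x + real_vec k" x] b[OF that(2)] c[OF that(1)] by simp
  then show "bounded (real_vec ` {k. \<exists>x\<in>unit_cube. x + real_vec k \<in> S})"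
    unfolding bounded_iff by blast
qed

text \<open>The indicators of the cube translates form a partition of unity. A finite
  \<open>K\<close> containing all translates that meet the support lets sum and integral be
  exchanged without any limit argument.\<close>

lemma integral_unfold_cube:
  fixes f :: "real ^ 'd \<Rightarrow> 'b::{banach, second_countable_topology}"
  assumes f: "integrable lborel f" and K: "finite K"
    and supp: "\<And>x k. x \<in> unit_cube \<Longrightarrow> k \<notin> K \<Longrightarrow> f (x + real_vec k) = 0"
  shows "(LINT x|lborel. f x) = (LINT x|cube_measure. (\<Sum>k\<in>K. f (x + real_vec k)))"
proof -
  have [measurable]: "f \<in> borel_measurable borel" using f by auto
  have split: "f x = (\<Sum>k\<in>K. indicator unit_cube (x - real_vec k) *\<^sub>R f x)" for x
  proof (cases "floor_vec x \<in> K")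
    case True
    then have "(\<Sum>k\<in>K. indicator unit_cube (x - real_vec k) *\<^sub>R f x)
        = (\<Sum>k\<in>K. if k = floor_vec x then f x else 0)"
      by (intro sum.cong) (auto simp: diff_real_vec_in_unit_cube_iff indicator_def)
    with True K show ?thesis by simp
  next
    case False
    then have "f (x - real_vec (floor_vec x) + real_vec (floor_vec x)) = 0"
      by (intro supp) simp_all
    then show ?thesis by simp
  qed
  have int: "integrable lborel (\<lambda>x. indicator unit_cube (x - real_vec k) *\<^sub>R f x)" for k
    by (rule Bochner_Integration.integrable_bound[OF f]) (auto simp: indicator_def)
  have intc: "integrable cube_measure (\<lambda>x. f (x + real_vec k))" for k
    unfolding integrable_restrict_space[of unit_cube lborel, simplified]
    by (rule Bochner_Integration.integrable_bound[OF integrable_lborel_translate[OF f, of "real_vec k"]])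
      (auto simp: indicator_def)
  have "(LINT x|lborel. f x) = (LINT x|lborel. (\<Sum>k\<in>K. indicator unit_cube (x - real_vec k) *\<^sub>R f x))"
    using split by simp
  also have "\<dots> = (\<Sum>k\<in>K. LINT x|lborel. indicator unit_cube (x - real_vec k) *\<^sub>R f x)"
    by (intro Bochner_Integration.integral_sum int)
  also have "\<dots> = (\<Sum>k\<in>K. LINT x|lborel. indicator unit_cube x *\<^sub>R f (x + real_vec k))"
  proof (rule sum.cong[OF refl])
    fix k
    show "(LINT x|lborel. indicator unit_cube (x - real_vec k) *\<^sub>R f x)
        = (LINT x|lborel. indicator unit_cube x *\<^sub>R f (x + real_vec k))"
      by (subst integral_lborel_translate[of _ "real_vec k", symmetric]) auto
  qed
  also have "\<dots> = (\<Sum>k\<in>K. LINT x|cube_measure. f (x + real_vec k))"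
    by (simp add: integral_restrict_space)
  also have "\<dots> = (LINT x|cube_measure. (\<Sum>k\<in>K. f (x + real_vec k)))"
    by (intro Bochner_Integration.integral_sum[symmetric] intc)
  finally show ?thesis .
qed

text \<open>Instead of iterated integration, the cube is translated by a vector \<open>t\<close>
  with \<open>chr k t = - 1\<close>. Translation invariance makes the integral over the moved cube
  the negative of the original, periodicity makes it equal, so it is 0.\<close>

lemma integral_cube_chr: "(LINT x|cube_measure. chr k x) = (if k = 0 then 1 else 0)"
proof (cases "k = 0")
  case True
  then show ?thesis
    by (simp add: measure_def emeasure_restrict_space emeasure_unit_cube space_restrict_space)
next
  case False
  then obtain i where i: "k $ i \<noteq> 0" by (auto simp: vec_eq_iff)
  \<comment> \<open>Half a period along a coordinate in which \<open>k\<close> does not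
    vanish.\<close>
  define t where "t = (axis i (1 / (2 * real_of_int (k $ i))) :: real ^ 'a)"
  have "real_vec k \<bullet> t = 1 / 2"
    using i by (simp add: t_def inner_axis)
  then have chr_t: "chr k t = - 1" unfolding chr_def by (simp only:) simp
  define f where "f x = indicator unit_cube (x - t) *\<^sub>R chr k x" for x
  define K where "K = {l. \<exists>x\<in>unit_cube. x + real_vec l \<in> (\<lambda>y. y + t) ` unit_cube}"
  have K: "finite K"
    unfolding K_def using bounded_translation[OF bounded_unit_cube, of t]
    by (intro finite_shifts_meeting_cube) (simp add: add.commute)
  have [measurable]: "f \<in> borel_measurable borel" unfolding f_def by measurable
  have tr: "f (x + t) = indicator unit_cube x *\<^sub>R chr k x * chr k t" for x
    by (simp add: f_def chr_add_right)
  have intc: "integrable lborel (\<lambda>x. indicator unit_cube x *\<^sub>R chr k x)"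
    using integrable_cube_measure[OF borel_measurable_chr, of k 1] by (simp add: integrable_restrict_space)
  have "integrable lborel (\<lambda>x. f (x + t))"
    unfolding tr by (intro integrable_mult_left intc)
  from integrable_lborel_translate[OF this, of "- t"] have intf: "integrable lborel f" by simp
  have "(LINT x|lborel. f x) = (LINT x|lborel. f (x + t))"
    by (rule integral_lborel_translate[symmetric]) measurable
  also have "\<dots> = - (LINT x|cube_measure. chr k x)"
    unfolding tr chr_t by (simp add: integral_restrict_space)
  finally have 1: "(LINT x|lborel. f x) = - (LINT x|cube_measure. chr k x)" .
  have "(LINT x|lborel. f x) = (LINT x|cube_measure. (\<Sum>l\<in>K. f (x + real_vec l)))"
  proof (rule integral_unfold_cube[OF intf K])
    fix x :: "real ^ 'a" and l assume *: "x \<in> unit_cube" "l \<notin> K"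
    have "x + real_vec l - t \<notin> unit_cube"
    proof
      assume "x + real_vec l - t \<in> unit_cube"
      then have "x + real_vec l \<in> (\<lambda>y. y + t) ` unit_cube" by (rule rev_image_eqI) simp
      with * show False by (auto simp: K_def)
    qed
    then show "f (x + real_vec l) = 0" by (simp add: f_def)
  qed
  also have "\<dots> = (LINT x|cube_measure. chr k x)"
  proof (rule Bochner_Integration.integral_cong[OF refl])
    fix x :: "real ^ 'a" assume "x \<in> space cube_measure"
    then have x: "x \<in> unit_cube" by (simp add: space_cube_measure)
    \<comment> \<open>The unique integer translate of \<open>x\<close> lying in the moved cube, so
      that the folded sum has a single nonzero term.\<close>
    define m where "m = - floor_vec (x - t)"
    have iff: "x + real_vec l - t \<in> unit_cube \<longleftrightarrow> l = m" for l
      using diff_real_vec_in_unit_cube_iff[of "x - t" "- l"]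
      by (simp add: m_def real_vec_minus minus_equation_iff[of l] eq_commute[of l] algebra_simps)
    have "m \<in> K"
      unfolding K_def mem_Collect_eq
      by (rule bexI[OF _ x], rule rev_image_eqI[of "x + real_vec m - t"]) (simp_all add: iff)
    moreover have "(\<Sum>l\<in>K. f (x + real_vec l)) = (\<Sum>l\<in>K. if l = m then chr k x else 0)"
      by (intro sum.cong) (auto simp: f_def iff indicator_def chr_add_right)
    ultimately show "(\<Sum>l\<in>K. f (x + real_vec l)) = chr k x" using K by simp
  qed
  finally show ?thesis using 1 False by simp
qed

section \<open>Trigonometric polynomials with a bound on their frequencies\<close>

definition trigpoly :: "nat \<Rightarrow> (real ^ 'd \<Rightarrow> complex) \<Rightarrow> bool"
  where "trigpoly N f \<longleftrightarrow> (\<exists>a. \<forall>x. f x = (\<Sum>k\<in>freq_box N. a k * chr k x))"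

lemma freq_box_mono: "N \<le> N' \<Longrightarrow> freq_box N \<subseteq> freq_box N'"
  by (auto simp: freq_box_def intro: order_trans)

lemma trigpoly_mono:
  assumes "trigpoly N f" "N \<le> N'"
  shows "trigpoly N' f"
proof -
  obtain a where a: "\<And>x. f x = (\<Sum>k\<in>freq_box N. a k * chr k x)" using assms by (auto simp: trigpoly_def)
  have "f x = (\<Sum>k\<in>freq_box N'. (if k \<in> freq_box N then a k else 0) * chr k x)" for x
    unfolding a using freq_box_mono[OF assms(2)]
    by (intro sum.mono_neutral_cong_left) auto
  then show ?thesis unfolding trigpoly_def by (intro exI[of _ "\<lambda>k. if k \<in> freq_box N then a k else 0"]) blast
qed

lemma trigpoly_chr: "k \<in> freq_box N \<Longrightarrow> trigpoly N (\<lambda>x. c * chr k x)"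
  unfolding trigpoly_def
  by (rule exI[of _ "\<lambda>l. if l = k then c else 0"]) (simp add: if_distrib[of "\<lambda>z. z * _"] cong: if_cong)

lemma trigpoly_const: "trigpoly N (\<lambda>x. c)"
  using trigpoly_chr[of 0 N c] by (simp add: freq_box_def)

lemma trigpoly_add:
  assumes "trigpoly N f" "trigpoly N g"
  shows "trigpoly N (\<lambda>x. f x + g x)"
proof -
  obtain a b where "\<And>x. f x = (\<Sum>k\<in>freq_box N. a k * chr k x)" "\<And>x. g x = (\<Sum>k\<in>freq_box N. b k * chr k x)"
    using assms by (auto simp: trigpoly_def)
  then have "f x + g x = (\<Sum>k\<in>freq_box N. (a k + b k) * chr k x)" for x
    by (simp add: sum.distrib distrib_right)
  then show ?thesis unfolding trigpoly_def by (intro exI[of _ "\<lambda>k. a k + b k"]) blast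
qed

lemma trigpoly_mult:
  assumes "trigpoly N f" "trigpoly N' g"
  shows "trigpoly (N + N') (\<lambda>x. f x * g x)"
proof -
  obtain a b where a: "\<And>x. f x = (\<Sum>k\<in>freq_box N. a k * chr k x)" and b: "\<And>x. g x = (\<Sum>k\<in>freq_box N'. b k * chr k x)"
    using assms by (auto simp: trigpoly_def)
  define S where "S = (freq_box N \<times> freq_box N' :: ((int ^ 'a) \<times> (int ^ 'a)) set)"
  define c where "c m = (\<Sum>p\<in>{p \<in> S. fst p + snd p = m}. a (fst p) * b (snd p))" for m
  have sub: "(\<lambda>p. fst p + snd p) ` S \<subseteq> freq_box (N + N')"
    unfolding S_def freq_box_def by (auto intro!: order_trans[OF abs_triangle_ineq] add_mono)
  have "f x * g x = (\<Sum>m\<in>freq_box (N + N'). c m * chr m x)" for x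
  proof -
    have "f x * g x = (\<Sum>p\<in>S. a (fst p) * b (snd p) * chr (fst p + snd p) x)"
      unfolding a b sum_product S_def sum.cartesian_product
      by (intro sum.cong) (auto simp: chr_add_left)
    also have "\<dots> = (\<Sum>m\<in>freq_box (N + N'). \<Sum>p\<in>{p \<in> S. fst p + snd p = m}. a (fst p) * b (snd p) * chr (fst p + snd p) x)"
      by (rule sum.group[symmetric, OF _ _ sub]) (auto simp: S_def)
    also have "\<dots> = (\<Sum>m\<in>freq_box (N + N'). c m * chr m x)"
      unfolding c_def sum_distrib_right by (intro sum.cong) auto
    finally show ?thesis .
  qed
  then show ?thesis unfolding trigpoly_def by (intro exI[of _ c]) blast
qed

lemma trigpoly_pow: "trigpoly N f \<Longrightarrow> trigpoly (n * N) (\<lambda>x. f x ^ n)"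
  by (induction n) (auto intro: trigpoly_const dest: trigpoly_mult)

lemma integral_cube_chr_sum:
  assumes F: "finite F"
  shows "(LINT x|cube_measure. (\<Sum>k\<in>F. a k * chr k x) * chr (- l) x) = (if l \<in> F then a l else 0)"
proof -
  have "(LINT x|cube_measure. (\<Sum>k\<in>F. a k * chr k x) * chr (- l) x)
      = (LINT x|cube_measure. (\<Sum>k\<in>F. a k * chr (k - l) x))"
    by (simp add: sum_distrib_right mult.assoc flip: chr_add_left)
  also have "\<dots> = (\<Sum>k\<in>F. a k * (LINT x|cube_measure. chr (k - l) x))"
    by (subst Bochner_Integration.integral_sum)
      (auto intro!: integrable_mult_right integrable_cube_measure[where B = 1])
  also have "\<dots> = (if l \<in> F then a l else 0)"
    using F by (simp add: integral_cube_chr if_distrib cong: if_cong)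
  finally show ?thesis .
qed

section \<open>Parseval's identity on the unit cube\<close>

lemma borel_measurable_cnj [measurable (raw)]:
  "f \<in> borel_measurable M \<Longrightarrow> (\<lambda>x. cnj (f x)) \<in> borel_measurable M"
  by (rule measurable_compose[OF _ borel_measurable_continuous_onI[OF continuous_on_cnj[OF continuous_on_id]]])

lemma norm_power2_norm_le: "norm (z :: 'a::real_normed_vector) \<le> B \<Longrightarrow> norm ((norm z)\<^sup>2) \<le> B\<^sup>2"
  by (simp add: power_mono)

lemma AE_cube_interior: "AE x in cube_measure. x \<in> box 0 One"
proof -
  from AE_not_in[OF null_sets_cbox_minus_box[of 0 One]] have "AE x :: real ^ 'd in lborel. x \<in> unit_cube \<longrightarrow> x \<in> box 0 One"
    by eventually_elim (auto simp: unit_cube_def cbox_One_cart less_imp_le)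
  then show ?thesis by (subst AE_restrict_space_iff) auto
qed

text \<open>Vanishing outside the open cube is what lets the approximant pass to a continuous
  function on the torus; the common bound \<open>B\<close> permits dominated convergence.\<close>

lemma ex_continuous_L2_approx:
  fixes p :: "real ^ 'd \<Rightarrow> complex"
  assumes p [measurable]: "p \<in> borel_measurable borel" and B: "\<And>x. norm (p x) \<le> B" and e: "0 < e"
  obtains g where "continuous_on UNIV g" "\<And>x. x \<notin> box 0 One \<Longrightarrow> g x = 0"
    "\<And>x. norm (g x) \<le> B" "(LINT x|cube_measure. (norm (p x - g x))\<^sup>2) < e"
proof -
  have B0: "0 \<le> B" using B[of 0] norm_ge_zero order_trans by blast
  have "p measurable_on UNIV"
    by (intro lebesgue_measurable_imp_measurable_on measurable_completion) auto
  then obtain N g where N: "negligible N" and g: "\<And>n. continuous_on UNIV (g n)"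
    and lim: "\<And>x. x \<notin> N \<Longrightarrow> (\<lambda>n. g n x) \<longlonglongrightarrow> p x"
    unfolding measurable_on_def by auto
  define d where "d x = infdist x (- box 0 (One :: real ^ 'd))" for x
  \<comment> \<open>The projection onto the ball enforces the bound and the factor with
    \<open>d\<close> enforces the boundary condition. Inside the open cube \<open>d x\<close> is
    positive, so the factor is eventually 1 and the limit is unchanged.\<close>
  define h where "h n x = min 1 (real n * d x) *\<^sub>R closest_point (cball 0 B) (g n x)" for n x
  have conth: "continuous_on UNIV (h n)" for n
    unfolding h_def d_def
    by (intro continuous_intros continuous_on_compose2[OF continuous_on_closest_point g])
      (use B0 in auto)
  then have [measurable]: "h n \<in> borel_measurable borel" for n
    by (rule borel_measurable_continuous_onI)
  have d0: "0 \<le> d x" for x by (simp add: d_def infdist_nonneg)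
  have cB: "norm (closest_point (cball 0 B) z) \<le> B" for z :: complex
    using closest_point_in_set[of "cball 0 B" z] B0 by auto
  have hB: "norm (h n x) \<le> B" for n x
    unfolding h_def using cB[of "g n x"] d0[of x]
    by (simp add: mult_le_one mult_left_le_one_le order_trans[OF mult_left_le_one_le])
  have "(\<lambda>n. LINT x|cube_measure. (norm (p x - h n x))\<^sup>2) \<longlonglongrightarrow> (LINT x|(cube_measure :: (real ^ 'd) measure). 0)"
  proof (rule integral_dominated_convergence[where w = "\<lambda>_. (2 * B)\<^sup>2"])
    have "AE x :: real ^ 'd in lborel. x \<notin> N"
      using AE_not_in[of N lebesgue] N by (simp add: AE_completion_iff negligible_iff_null_sets)
    then have "AE x in cube_measure. x \<notin> N"
      by (subst AE_restrict_space_iff) auto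
    with AE_cube_interior show "AE x in cube_measure. (\<lambda>n. (norm (p x - h n x))\<^sup>2) \<longlonglongrightarrow> 0"
    proof eventually_elim
      case (elim x)
      have "(\<lambda>n. closest_point (cball 0 B) (g n x)) \<longlonglongrightarrow> closest_point (cball 0 B) (p x)"
        using continuous_on_closest_point[of "cball 0 B" UNIV] B0 lim[OF elim(2)]
        by (intro isCont_tendsto_compose[where g = "closest_point (cball 0 B)"])
          (auto simp: continuous_on_eq_continuous_at)
      moreover have "closest_point (cball 0 B) (p x) = p x"
        using B by (intro closest_point_self) auto
      moreover have dpos: "d x > 0"
      proof -
        have "closed (- box 0 One :: (real ^ 'd) set)" by (simp add: closed_Compl open_box)
        moreover have "- box 0 One \<noteq> ({} :: (real ^ 'd) set)"
          using bounded_box[of 0 "One :: real ^ 'd"] not_bounded_UNIV by (metis double_compl Compl_empty_eq)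
        ultimately have "infdist x (- box 0 One) \<noteq> 0"
          using elim(1) in_closed_iff_infdist_zero by blast
        then show ?thesis using d0[of x] by (simp add: d_def)
      qed
      have "eventually (\<lambda>n. min 1 (real n * d x) = 1) sequentially"
        using eventually_ge_at_top[of "nat \<lceil>1 / d x\<rceil>"]
      proof eventually_elim
        case (elim n)
        then have "1 / d x \<le> real n" by linarith
        then show ?case using dpos by (simp add: field_simps min_def)
      qed
      then have "(\<lambda>n. min 1 (real n * d x)) \<longlonglongrightarrow> 1" by (rule tendsto_eventually)
      ultimately have "(\<lambda>n. h n x) \<longlonglongrightarrow> 1 *\<^sub>R p x"
        unfolding h_def by (metis tendsto_scaleR)
      then have "(\<lambda>n. (norm (p x - h n x))\<^sup>2) \<longlonglongrightarrow> (norm (p x - p x))\<^sup>2"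
        by (intro tendsto_intros) simp
      then show ?case by simp
    qed
    fix n
    have "norm (p x - h n x) \<le> 2 * B" for x
      using norm_triangle_ineq4[of "p x" "h n x"] B[of x] hB[of n x] by simp
    then show "AE x in cube_measure. norm ((norm (p x - h n x))\<^sup>2) \<le> (2 * B)\<^sup>2"
      by (intro AE_I2 norm_power2_norm_le)
  qed (auto intro!: borel_measurable_cube_measure)
  then have "eventually (\<lambda>n. (LINT x|cube_measure. (norm (p x - h n x))\<^sup>2) < e) sequentially"
    using e by (intro order_tendstoD(2)) auto
  then obtain n where "(LINT x|cube_measure. (norm (p x - h n x))\<^sup>2) < e"
    by (auto simp: eventually_sequentially)
  moreover have "h n x = 0" if "x \<notin> box 0 One" for x
    using that by (simp add: h_def d_def infdist_zero)
  ultimately show ?thesis using that conth hB by blast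
qed

section \<open>Uniform approximation by trigonometric polynomials through the torus\<close>

definition torus_map :: "real ^ 'd \<Rightarrow> complex ^ 'd"
  where "torus_map x = (\<chi> i. cis (2 * pi * x $ i))"

lemma chr_axis: "chr (axis i 1) x = cis (2 * pi * x $ i)" "chr (- axis i 1) x = cis (- (2 * pi * x $ i))"
proof -
  have *: "real_vec (axis i 1) = axis i 1" by (simp add: vec_eq_iff axis_def)
  then show "chr (axis i 1) x = cis (2 * pi * x $ i)"
    by (simp add: chr_def inner_axis')
  show "chr (- axis i 1) x = cis (- (2 * pi * x $ i))"
    by (simp add: chr_def real_vec_minus * inner_axis')
qed

text \<open>Forgets the frequency bound of \<open>trigpoly\<close>, which matters only where the
  coefficients of powers are counted.\<close>

definition is_trigpoly :: "(real ^ 'd \<Rightarrow> complex) \<Rightarrow> bool"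
  where "is_trigpoly f \<longleftrightarrow> (\<exists>N. trigpoly N f)"

lemma is_trigpoly_const: "is_trigpoly (\<lambda>x. c)"
  unfolding is_trigpoly_def using trigpoly_const by blast

lemma is_trigpoly_chr: "is_trigpoly (chr k)"
proof -
  have "bounded (real_vec ` {k})" by simp
  then obtain N where "{k} \<subseteq> freq_box N" by (rule bounded_real_vec_subset_freq_box)
  then have "trigpoly N (\<lambda>x. 1 * chr k x)" by (intro trigpoly_chr) auto
  then show ?thesis by (auto simp: is_trigpoly_def)
qed

lemma is_trigpoly_add: "is_trigpoly f \<Longrightarrow> is_trigpoly g \<Longrightarrow> is_trigpoly (\<lambda>x. f x + g x)"
  unfolding is_trigpoly_def
  by (metis trigpoly_add trigpoly_mono max.cobounded1 max.cobounded2)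

lemma is_trigpoly_mult: "is_trigpoly f \<Longrightarrow> is_trigpoly g \<Longrightarrow> is_trigpoly (\<lambda>x. f x * g x)"
  unfolding is_trigpoly_def by (metis trigpoly_mult)

lemma is_trigpoly_sum: "(\<And>i. i \<in> I \<Longrightarrow> is_trigpoly (f i)) \<Longrightarrow> is_trigpoly (\<lambda>x. \<Sum>i\<in>I. f i x)"
  by (induction I rule: infinite_finite_induct) (auto intro: is_trigpoly_add is_trigpoly_const)

text \<open>Only the linear case has content: a real linear functional on the torus is a real
  combination of cosines and sines of the coordinates, each a combination of a character and its
  inverse.\<close>

lemma is_trigpoly_real_polynomial_function:
  assumes "real_polynomial_function r"
  shows "is_trigpoly (\<lambda>x. complex_of_real (r (torus_map x)))"
  using assms
proof (induction rule: real_polynomial_function.induct)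
  case (linear f)
  have decomp: "z = (\<Sum>i\<in>UNIV. Re (z $ i) *\<^sub>R axis i 1 + Im (z $ i) *\<^sub>R axis i \<i>)" for z :: "complex ^ 'd"
    by (simp add: vec_eq_iff axis_def if_distrib complex_eq_iff cong: if_cong)
  have lf: "linear f" using linear by (rule bounded_linear.linear)
  have "complex_of_real (f (torus_map x)) =
      (\<Sum>i\<in>UNIV. (f (axis i 1) / 2) * (chr (axis i 1) x + chr (- axis i 1) x)
        + (f (axis i \<i>) / (2 * \<i>)) * (chr (axis i 1) x + (- 1) * chr (- axis i 1) x))" for x
  proof -
    have "f (torus_map x) = (\<Sum>i\<in>UNIV. cos (2 * pi * x $ i) * f (axis i 1) + sin (2 * pi * x $ i) * f (axis i \<i>))"
      by (subst decomp) (simp add: linear_sum[OF lf] linear_add[OF lf] linear_scale[OF lf] torus_map_def)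
    then show ?thesis
      by (simp only: of_real_sum) (intro sum.cong refl, simp add: chr_axis complex_eq_iff)
  qed
  then show ?case
    by (simp only:) (intro is_trigpoly_sum is_trigpoly_add is_trigpoly_mult is_trigpoly_const is_trigpoly_chr)
qed (auto intro: is_trigpoly_add is_trigpoly_mult is_trigpoly_const)

text \<open>On the closed cube \<open>torus_map\<close> identifies boundary points only, so a
  function that vanishes off the open cube factors through it.\<close>

lemma torus_map_eq_imp:
  assumes "torus_map x = torus_map y" "x \<in> cbox 0 One" "y \<in> cbox 0 One"
  shows "x = y \<or> (x \<notin> box 0 One \<and> y \<notin> box 0 One)"
proof (cases "x = y")
  case False
  then obtain i where i: "x $ i \<noteq> y $ i" by (auto simp: vec_eq_iff)
  have "cis (2 * pi * x $ i) = cis (2 * pi * y $ i)"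
    using assms(1) by (simp add: torus_map_def vec_eq_iff)
  then have "exp (\<i> * complex_of_real (2 * pi * x $ i)) = exp (\<i> * complex_of_real (2 * pi * y $ i))"
    by (simp add: cis_conv_exp)
  then obtain n :: int where "\<i> * complex_of_real (2 * pi * x $ i) = \<i> * complex_of_real (2 * pi * y $ i) + (of_int (2 * n) * pi) * \<i>"
    by (auto simp: exp_eq)
  then have "2 * pi * x $ i = 2 * pi * y $ i + 2 * n * pi"
    by (auto simp: complex_eq_iff)
  then have "2 * pi * x $ i = 2 * pi * (y $ i + n)" by (simp add: algebra_simps)
  then have n: "x $ i = y $ i + n" by simp
  have r: "0 \<le> x $ i" "x $ i \<le> 1" "0 \<le> y $ i" "y $ i \<le> 1" using assms by (auto simp: cbox_One_cart)
  have "n \<noteq> 0" using i n by auto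
  then have "x $ i = 0 \<and> y $ i = 1 \<or> x $ i = 1 \<and> y $ i = 0"
  proof (cases "n > 0")
    case True
    then have "real_of_int n \<ge> 1" by simp
    then show ?thesis using n r by linarith
  next
    case False
    with \<open>n \<noteq> 0\<close> have "real_of_int n \<le> - 1" by linarith
    then show ?thesis using n r by linarith
  qed
  then show ?thesis by (auto simp: box_One_cart intro!: exI[of _ i])
qed simp

text \<open>Stone-Weierstrass is applied on the compact torus \<open>S\<close> to the function
  \<open>h\<close> induced by \<open>g\<close>, and its polynomials are pulled back by
  \<open>torus_map\<close>.\<close>

lemma ex_trigpoly_uniform_approx:
  fixes g :: "real ^ 'd \<Rightarrow> complex"
  assumes g: "continuous_on UNIV g" "\<And>x. x \<notin> box 0 One \<Longrightarrow> g x = 0" and e: "0 < e"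
  obtains T where "is_trigpoly T" "\<And>x. x \<in> cbox 0 One \<Longrightarrow> norm (g x - T x) < e"
proof -
  define S where "S = torus_map ` cbox 0 (One :: real ^ 'd)"
  define h where "h z = g (SOME x. x \<in> cbox 0 One \<and> torus_map x = z)" for z
  have cont: "continuous_on A (torus_map :: real ^ 'd \<Rightarrow> _)" for A
    unfolding torus_map_def by (intro continuous_intros)
  have S: "compact S" unfolding S_def by (rule compact_continuous_image[OF cont compact_cbox])
  have h: "h (torus_map x) = g x" if x: "x \<in> cbox 0 One" for x
  proof -
    define y where "y = (SOME y. y \<in> cbox 0 One \<and> torus_map y = torus_map x)"
    have "y \<in> cbox 0 One \<and> torus_map y = torus_map x"
      unfolding y_def by (rule someI[of _ x]) (use x in simp)
    with torus_map_eq_imp[of x y] x have "g y = g x" using g(2) by metis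
    then show ?thesis by (simp add: h_def y_def)
  qed
  \<comment> \<open>A continuous map on a compact cube is closed, hence a quotient map onto its
    image: preimages under \<open>h\<close> are images of the closed preimages under
    \<open>g\<close>.\<close>
  have "continuous_on S h"
    unfolding continuous_on_closed_vimage[OF compact_imp_closed[OF S]]
  proof (intro allI impI)
    fix C :: "complex set" assume C: "closed C"
    have "h -` C \<inter> S = torus_map ` (cbox 0 One \<inter> g -` C)"
      unfolding S_def using h by auto
    moreover have "compact (cbox 0 One \<inter> g -` C)"
      by (intro compact_Int_closed compact_cbox closed_vimage C g)
    ultimately show "closed (h -` C \<inter> S)"
      by (simp add: compact_imp_closed compact_continuous_image[OF cont])
  qed
  from Stone_Weierstrass_polynomial_function[OF S this e] obtain q
    where q: "polynomial_function q" "\<And>z. z \<in> S \<Longrightarrow> norm (h z - q z) < e" by blast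
  define T where "T x = q (torus_map x)" for x
  have "real_polynomial_function (Re \<circ> q)" "real_polynomial_function (Im \<circ> q)"
    using q(1) bounded_linear_Re bounded_linear_Im by (auto simp: polynomial_function_def)
  from this[THEN is_trigpoly_real_polynomial_function]
  have "is_trigpoly (\<lambda>x. complex_of_real (Re (T x)) + \<i> * complex_of_real (Im (T x)))"
    unfolding T_def by (intro is_trigpoly_add is_trigpoly_mult is_trigpoly_const) auto
  then have "is_trigpoly T" by (simp flip: complex_eq)
  moreover have "norm (g x - T x) < e" if "x \<in> cbox 0 One" for x
    using q(2)[of "torus_map x"] h[OF that] that by (auto simp: T_def S_def)
  ultimately show ?thesis by (rule that)
qed


lemma borel_measurable_chr_sum: "(\<lambda>x. \<Sum>k\<in>F. a k * chr k x) \<in> borel_measurable borel"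
  by measurable

lemma norm_chr_sum_le: "norm (\<Sum>k\<in>F. a k * chr k x) \<le> (\<Sum>k\<in>F. norm (a k))"
  by (rule sum_norm_le) (simp add: norm_mult)

text \<open>Completing the square in the coefficients. With \<open>a = c\<close> the last sum
  disappears and Bessel's inequality results; for other \<open>a\<close> it shows that any
  trigonometric approximant bounds the defect in Parseval's identity.\<close>

lemma cube_L2_dist_trig_sum:
  fixes p :: "real ^ 'd \<Rightarrow> complex"
  assumes p [measurable]: "p \<in> borel_measurable borel" and B: "\<And>x. norm (p x) \<le> B" and F: "finite F"
    and c: "\<And>k. c k = (LINT x|cube_measure. p x * chr (- k) x)"
  shows "(LINT x|cube_measure. (norm (p x - (\<Sum>k\<in>F. a k * chr k x)))\<^sup>2) =
    (LINT x|cube_measure. (norm (p x))\<^sup>2) - (\<Sum>k\<in>F. (norm (c k))\<^sup>2) + (\<Sum>k\<in>F. (norm (c k - a k))\<^sup>2)"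
proof -
  define T where "T x = (\<Sum>k\<in>F. a k * chr k x)" for x
  define A where "A = (\<Sum>k\<in>F. norm (a k))"
  have [measurable]: "T \<in> borel_measurable borel" unfolding T_def by (rule borel_measurable_chr_sum)
  have TA: "norm (T x) \<le> A" for x unfolding T_def A_def by (rule norm_chr_sum_le)
  have B0: "0 \<le> B" using B[of 0] norm_ge_zero order_trans by blast
  have A0: "0 \<le> A" unfolding A_def by (rule sum_nonneg) simp
  have i1: "integrable cube_measure (\<lambda>x. p x * cnj (p x))"
    by (rule integrable_cube_measure[where B = "B * B"])
      (use B B0 in \<open>auto simp: norm_mult intro!: mult_mono\<close>)
  have i2: "integrable cube_measure (\<lambda>x. p x * cnj (T x))"
    by (rule integrable_cube_measure[where B = "B * A"])
      (use B B0 TA A0 in \<open>auto simp: norm_mult intro!: mult_mono\<close>)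
  have i3: "integrable cube_measure (\<lambda>x. T x * cnj (T x))"
    by (rule integrable_cube_measure[where B = "A * A"])
      (use TA A0 in \<open>auto simp: norm_mult intro!: mult_mono\<close>)
  have pT: "(LINT x|cube_measure. p x * cnj (T x)) = (\<Sum>k\<in>F. cnj (a k) * c k)"
  proof -
    have "(LINT x|cube_measure. p x * cnj (T x)) = (LINT x|cube_measure. (\<Sum>k\<in>F. cnj (a k) * (p x * chr (- k) x)))"
      by (simp add: T_def sum_distrib_left cnj_chr mult_ac)
    also have "\<dots> = (\<Sum>k\<in>F. LINT x|cube_measure. cnj (a k) * (p x * chr (- k) x))"
      by (intro Bochner_Integration.integral_sum integrable_mult_right integrable_cube_measure[where B = B])
        (use B in \<open>auto simp: norm_mult\<close>)
    also have "\<dots> = (\<Sum>k\<in>F. cnj (a k) * c k)" by (simp add: c)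
    finally show ?thesis .
  qed
  have TT: "(LINT x|cube_measure. T x * cnj (T x)) = (\<Sum>k\<in>F. cnj (a k) * a k)"
  proof -
    have "(LINT x|cube_measure. T x * cnj (T x)) = (LINT x|cube_measure. (\<Sum>k\<in>F. cnj (a k) * (T x * chr (- k) x)))"
      by (subst (2) T_def) (simp add: sum_distrib_left cnj_chr mult_ac)
    also have "\<dots> = (\<Sum>k\<in>F. LINT x|cube_measure. cnj (a k) * (T x * chr (- k) x))"
      by (intro Bochner_Integration.integral_sum integrable_mult_right integrable_cube_measure[where B = A])
        (use TA in \<open>auto simp: norm_mult\<close>)
    also have "\<dots> = (\<Sum>k\<in>F. cnj (a k) * a k)"
      unfolding T_def by (simp add: integral_cube_chr_sum[OF F])
    finally show ?thesis .
  qed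
  have "complex_of_real (LINT x|cube_measure. (norm (p x - T x))\<^sup>2)
      = (LINT x|cube_measure. complex_of_real ((norm (p x - T x))\<^sup>2))"
    by (rule integral_complex_of_real[symmetric])
  also have "\<dots> = (LINT x|cube_measure. p x * cnj (p x) - p x * cnj (T x) - cnj (p x * cnj (T x)) + T x * cnj (T x))"
    by (intro Bochner_Integration.integral_cong) (simp_all only: complex_norm_square, simp_all add: algebra_simps)
  also have "\<dots> = (LINT x|cube_measure. p x * cnj (p x)) - (\<Sum>k\<in>F. cnj (a k) * c k)
      - cnj (\<Sum>k\<in>F. cnj (a k) * c k) + (\<Sum>k\<in>F. cnj (a k) * a k)"
    unfolding pT[symmetric] TT[symmetric] Bochner_Integration.integral_cnj[of _ "\<lambda>x. p x * cnj (T x)", symmetric]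
    using i1 i2 i3 by (simp only: Bochner_Integration.integral_add Bochner_Integration.integral_diff
        Bochner_Integration.integrable_diff integrable_cnj)
  also have "(LINT x|cube_measure. p x * cnj (p x)) = complex_of_real (LINT x|cube_measure. (norm (p x))\<^sup>2)"
    by (simp only: complex_norm_square[symmetric] integral_complex_of_real)
  also have "\<dots> - (\<Sum>k\<in>F. cnj (a k) * c k) - cnj (\<Sum>k\<in>F. cnj (a k) * c k) + (\<Sum>k\<in>F. cnj (a k) * a k)
     = complex_of_real ((LINT x|cube_measure. (norm (p x))\<^sup>2) - (\<Sum>k\<in>F. (norm (c k))\<^sup>2) + (\<Sum>k\<in>F. (norm (c k - a k))\<^sup>2))"
    by (simp only: of_real_add of_real_diff of_real_sum complex_norm_square)
      (simp add: algebra_simps sum.distrib sum_subtractf)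
  finally show ?thesis unfolding T_def of_real_eq_iff .
qed

lemma has_sum_nonneg_of_bounds:
  fixes f :: "'a \<Rightarrow> real"
  assumes nn: "\<And>k. 0 \<le> f k" and ub: "\<And>F. finite F \<Longrightarrow> sum f F \<le> S"
    and lb: "\<And>e. 0 < e \<Longrightarrow> \<exists>F. finite F \<and> S - e \<le> sum f F"
  shows "(f has_sum S) UNIV"
  unfolding has_sum_def tendsto_iff eventually_finite_subsets_at_top
proof (intro allI impI)
  fix e :: real assume e: "0 < e"
  obtain F where F: "finite F" "S - e / 2 \<le> sum f F" using lb[of "e / 2"] e by auto
  have "dist (sum f Y) S < e" if "finite Y" "F \<subseteq> Y" for Y
    using sum_mono2[OF that(1,2), of f] nn F ub[OF that(1)] e by (simp add: dist_real_def abs_if)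
  then show "\<exists>X. finite X \<and> X \<subseteq> UNIV \<and> (\<forall>Y. finite Y \<and> X \<subseteq> Y \<and> Y \<subseteq> UNIV \<longrightarrow> dist (sum f Y) S < e)"
    using F by blast
qed

text \<open>Bessel's inequality bounds the finite sums from above; approximation by a continuous
  function and then by a trigonometric polynomial bounds one of them from below.\<close>

lemma parseval_cube:
  fixes p :: "real ^ 'd \<Rightarrow> complex"
  assumes p [measurable]: "p \<in> borel_measurable borel" and B: "\<And>x. norm (p x) \<le> B"
  shows "((\<lambda>k. (norm (LINT x|cube_measure. p x * chr (- k) x))\<^sup>2) has_sum
    (LINT x|cube_measure. (norm (p x))\<^sup>2)) UNIV"
proof -
  define c where "c k = (LINT x|cube_measure. p x * chr (- k) x)" for k
  note dist = cube_L2_dist_trig_sum[OF p B _ c_def]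
  have "((\<lambda>k. (norm (c k))\<^sup>2) has_sum (LINT x|cube_measure. (norm (p x))\<^sup>2)) UNIV"
  proof (rule has_sum_nonneg_of_bounds)
    fix F :: "(int ^ 'd) set" assume F: "finite F"
    have "0 \<le> (LINT x|cube_measure. (norm (p x - (\<Sum>k\<in>F. c k * chr k x)))\<^sup>2)" by simp
    then show "(\<Sum>k\<in>F. (norm (c k))\<^sup>2) \<le> (LINT x|cube_measure. (norm (p x))\<^sup>2)"
      unfolding dist[OF F] by simp
  next
    fix e :: real assume e: "0 < e"
    \<comment> \<open>The estimate of a squared sum by twice the sum of squares doubles each of the
      two errors \<open>e / 4\<close>; on a cube of measure 1 they add up to
      \<open>e\<close>.\<close>
    have e4: "0 < e / 4" "0 < sqrt (e / 4)" using e by auto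
    obtain g where g: "continuous_on UNIV g" "\<And>x. x \<notin> box 0 One \<Longrightarrow> g x = 0" "\<And>x. norm (g x) \<le> B"
      and gp: "(LINT x|cube_measure. (norm (p x - g x))\<^sup>2) < e / 4"
      using ex_continuous_L2_approx[OF p B e4(1)] by blast
    obtain T where "is_trigpoly T" and T: "\<And>x. x \<in> cbox 0 One \<Longrightarrow> norm (g x - T x) < sqrt (e / 4)"
      using ex_trigpoly_uniform_approx[OF g(1,2) e4(2)] by blast
    then obtain N a where TN: "\<And>x. T x = (\<Sum>k\<in>freq_box N. a k * chr k x)"
      by (auto simp: is_trigpoly_def trigpoly_def)
    have [measurable]: "g \<in> borel_measurable borel" "T \<in> borel_measurable borel"
      using g(1) unfolding TN by (auto intro: borel_measurable_continuous_onI)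
    define A where "A = (\<Sum>k\<in>freq_box N. norm (a k))"
    have TA: "norm (T x) \<le> A" for x unfolding TN A_def by (rule norm_chr_sum_le)
    have ip: "integrable cube_measure (\<lambda>x. (norm (p x - T x))\<^sup>2)"
    proof (rule integrable_cube_measure[where B = "(B + A)\<^sup>2"])
      show "norm ((norm (p x - T x))\<^sup>2) \<le> (B + A)\<^sup>2" for x
        using norm_triangle_ineq4[of "p x" "T x"] B[of x] TA[of x] by (auto intro!: power_mono)
    qed measurable
    have ig: "integrable cube_measure (\<lambda>x. (norm (p x - g x))\<^sup>2)"
    proof (rule integrable_cube_measure[where B = "(B + B)\<^sup>2"])
      show "norm ((norm (p x - g x))\<^sup>2) \<le> (B + B)\<^sup>2" for x
        using norm_triangle_ineq4[of "p x" "g x"] B[of x] g(3)[of x]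
        by (intro norm_power2_norm_le) simp
    qed measurable
    have pt: "(norm (p x - T x))\<^sup>2 \<le> 2 * (norm (p x - g x))\<^sup>2 + e / 2" if "x \<in> unit_cube" for x
    proof -
      have "x \<in> cbox 0 One" using that by (auto simp: unit_cube_def cbox_One_cart less_imp_le)
      from T[OF this] have "(norm (g x - T x))\<^sup>2 \<le> (sqrt (e / 4))\<^sup>2" by (intro power_mono) auto
      then have 1: "(norm (g x - T x))\<^sup>2 \<le> e / 4" using e by simp
      have "norm (p x - T x) \<le> norm (p x - g x) + norm (g x - T x)"
        using norm_triangle_ineq[of "p x - g x" "g x - T x"] by simp
      then have "(norm (p x - T x))\<^sup>2 \<le> (norm (p x - g x) + norm (g x - T x))\<^sup>2" by (intro power_mono) auto
      also have "\<dots> \<le> 2 * (norm (p x - g x))\<^sup>2 + 2 * (norm (g x - T x))\<^sup>2"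
        using sum_squares_bound[of "norm (p x - g x)" "norm (g x - T x)"] by (simp add: power2_sum)
      finally show ?thesis using 1 by simp
    qed
    have "(LINT x|cube_measure. (norm (p x - T x))\<^sup>2) \<le> (LINT x|cube_measure. 2 * (norm (p x - g x))\<^sup>2 + e / 2)"
      using pt by (intro integral_mono ip Bochner_Integration.integrable_add integrable_mult_right ig)
        (auto simp: space_cube_measure)
    also have "\<dots> = 2 * (LINT x|cube_measure. (norm (p x - g x))\<^sup>2) + e / 2"
      using ig by (subst Bochner_Integration.integral_add)
        (auto simp: measure_def emeasure_restrict_space emeasure_unit_cube space_restrict_space)
    also have "\<dots> \<le> e" using gp by simp
    finally have "(LINT x|cube_measure. (norm (p x))\<^sup>2) - (\<Sum>k\<in>freq_box N. (norm (c k))\<^sup>2)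
        + (\<Sum>k\<in>freq_box N. (norm (c k - a k))\<^sup>2) \<le> e"
      unfolding TN dist[OF finite_freq_box] .
    moreover have "0 \<le> (\<Sum>k\<in>freq_box N. (norm (c k - a k))\<^sup>2)" by (rule sum_nonneg) simp
    ultimately have "(LINT x|cube_measure. (norm (p x))\<^sup>2) - e \<le> (\<Sum>k\<in>freq_box N. (norm (c k))\<^sup>2)"
      by linarith
    then show "\<exists>F. finite F \<and> (LINT x|cube_measure. (norm (p x))\<^sup>2) - e \<le> (\<Sum>k\<in>F. (norm (c k))\<^sup>2)"
      using finite_freq_box by blast
  qed auto
  then show ?thesis unfolding c_def .
qed

section \<open>Periodization and the Fourier transform\<close>

text \<open>A class containing indicators of compact sets and closed under modulation, translation,
  sums and convolution, on which periodization over the cube is a finite sum. Borel measurability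
  keeps compositions measurable.\<close>

definition bounded_bsupp :: "('a::euclidean_space \<Rightarrow> complex) \<Rightarrow> bool"
  where "bounded_bsupp f \<longleftrightarrow> f \<in> borel_measurable borel \<and> bounded (range f) \<and> bounded {x. f x \<noteq> 0}"

lemma bounded_bsupp_measurable: "bounded_bsupp f \<Longrightarrow> f \<in> borel_measurable borel"
  by (simp add: bounded_bsupp_def)

lemma bounded_bsupp_bound: "bounded_bsupp f \<Longrightarrow> \<exists>B\<ge>0. \<forall>x. norm (f x) \<le> B"
  unfolding bounded_bsupp_def bounded_iff by (metis norm_ge_zero order_trans rangeI)

lemma bounded_bsupp_integrable_mult:
  fixes f g :: "'a::euclidean_space \<Rightarrow> complex"
  assumes f: "bounded_bsupp f" and [measurable]: "g \<in> borel_measurable borel" and g: "bounded (range g)"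
  shows "integrable lborel (\<lambda>x. f x * g x)"
proof -
  have [measurable]: "f \<in> borel_measurable borel" using f by (rule bounded_bsupp_measurable)
  obtain B where B: "0 \<le> B" "\<And>x. norm (f x) \<le> B" using bounded_bsupp_bound[OF f] by blast
  obtain C where C: "\<And>x. norm (g x) \<le> C" using g by (auto simp: bounded_iff)
  then have C0: "0 \<le> C" using norm_ge_zero order_trans by blast
  obtain a where "{x. f x \<noteq> 0} \<subseteq> cbox (- a) a"
    using f bounded_subset_cbox_symmetric unfolding bounded_bsupp_def by blast
  then have a: "f x = 0" if "x \<notin> cbox (- a) a" for x using that by blast
  have "integrable lborel (\<lambda>x. indicator (cbox (- a) a) x *\<^sub>R (B * C))"
    by (intro integrable_scaleR_left integrable_real_indicator) (auto simp: emeasure_bounded_finite[of "cbox (- a) a", simplified])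
  then show ?thesis
  proof (rule Bochner_Integration.integrable_bound)
    show "AE x in lborel. norm (f x * g x) \<le> norm (indicat_real (cbox (- a) a) x *\<^sub>R (B * C))"
    proof (rule AE_I2)
      fix x
      show "norm (f x * g x) \<le> norm (indicat_real (cbox (- a) a) x *\<^sub>R (B * C))"
        using a[of x] B C[of x] C0 by (cases "x \<in> cbox (- a) a") (auto simp: norm_mult intro!: mult_mono)
    qed
  qed measurable
qed

lemma bounded_bsupp_integrable: "bounded_bsupp f \<Longrightarrow> integrable lborel f"
  using bounded_bsupp_integrable_mult[of f "\<lambda>_. 1"] by (simp add: image_constant_conv)

lemma bounded_bsupp_mult:
  assumes "bounded_bsupp f" "g \<in> borel_measurable borel" "bounded (range g)"
  shows "bounded_bsupp (\<lambda>x. f x * g x)"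
  unfolding bounded_bsupp_def
proof (intro conjI)
  have [measurable]: "f \<in> borel_measurable borel" "g \<in> borel_measurable borel"
    using assms by (auto simp: bounded_bsupp_def)
  show "(\<lambda>x. f x * g x) \<in> borel_measurable borel" by measurable
  obtain B where B: "0 \<le> B" "\<And>x. norm (f x) \<le> B" using bounded_bsupp_bound[OF assms(1)] by blast
  obtain C where C: "\<And>x. norm (g x) \<le> C" using assms(3) by (auto simp: bounded_iff)
  have "norm (f x * g x) \<le> B * C" for x
    unfolding norm_mult using B C[of x] by (intro mult_mono) auto
  then show "bounded (range (\<lambda>x. f x * g x))" by (auto simp: bounded_iff)
  show "bounded {x. f x * g x \<noteq> 0}"
    using assms(1) unfolding bounded_bsupp_def by (auto elim: bounded_subset)
qed

lemma bounded_bsupp_diff: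
  assumes "bounded_bsupp f" "bounded_bsupp g"
  shows "bounded_bsupp (\<lambda>x. f x - g x)"
  unfolding bounded_bsupp_def
proof (intro conjI)
  have [measurable]: "f \<in> borel_measurable borel" "g \<in> borel_measurable borel"
    using assms by (auto simp: bounded_bsupp_def)
  show "(\<lambda>x. f x - g x) \<in> borel_measurable borel" by measurable
  show "bounded (range (\<lambda>x. f x - g x))"
    using assms unfolding bounded_bsupp_def by (intro bounded_minus_comp) auto
  have "bounded ({x. f x \<noteq> 0} \<union> {x. g x \<noteq> 0})" using assms by (simp add: bounded_bsupp_def)
  then show "bounded {x. f x - g x \<noteq> 0}" by (rule bounded_subset) auto
qed

lemma bounded_bsupp_translate:
  assumes "bounded_bsupp f"
  shows "bounded_bsupp (\<lambda>x. f (x + c))"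
  unfolding bounded_bsupp_def
proof (intro conjI)
  have [measurable]: "f \<in> borel_measurable borel" using assms by (rule bounded_bsupp_measurable)
  show "(\<lambda>x. f (x + c)) \<in> borel_measurable borel" by measurable
  show "bounded (range (\<lambda>x. f (x + c)))"
    using assms unfolding bounded_bsupp_def by (auto elim: bounded_subset)
  have "bounded ((+) (- c) ` {x. f x \<noteq> 0})"
    using assms unfolding bounded_bsupp_def by (intro bounded_translation) auto
  then show "bounded {x. f (x + c) \<noteq> 0}"
    by (rule bounded_subset) (auto intro!: image_eqI[where x = "_ + c"])
qed

section \<open>Periodization and autocorrelation\<close>

definition supp_shifts :: "(real ^ 'd \<Rightarrow> complex) \<Rightarrow> (int ^ 'd) set"
  where "supp_shifts f = {k. \<exists>x\<in>unit_cube. x + real_vec k \<in> {x. f x \<noteq> 0}}"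

definition corr_shifts :: "(real ^ 'd \<Rightarrow> complex) \<Rightarrow> (int ^ 'd) set"
  where "corr_shifts f = (\<lambda>(k, l). l - k) ` (supp_shifts f \<times> supp_shifts f)"

text \<open>Equals the sum over all integer translates on \<open>unit_cube\<close>, though not
  necessarily elsewhere; it is integrated over that cube only.\<close>

definition periodize :: "(real ^ 'd \<Rightarrow> complex) \<Rightarrow> real ^ 'd \<Rightarrow> complex"
  where "periodize f x = (\<Sum>k\<in>supp_shifts f. f (x + real_vec k))"

definition autocorr :: "(real ^ 'd \<Rightarrow> complex) \<Rightarrow> int ^ 'd \<Rightarrow> complex"
  where "autocorr f m = (LINT x|lborel. f x * cnj (f (x + real_vec m)))"

lemma finite_supp_shifts: "bounded_bsupp f \<Longrightarrow> finite (supp_shifts f)"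
  unfolding supp_shifts_def bounded_bsupp_def by (intro finite_shifts_meeting_cube) auto

lemma finite_corr_shifts: "bounded_bsupp f \<Longrightarrow> finite (corr_shifts f)"
  unfolding corr_shifts_def using finite_supp_shifts by auto

lemma not_in_supp_shifts: "x \<in> unit_cube \<Longrightarrow> k \<notin> supp_shifts f \<Longrightarrow> f (x + real_vec k) = 0"
  by (auto simp: supp_shifts_def)

lemma autocorr_eq_0:
  assumes "m \<notin> corr_shifts f"
  shows "autocorr f m = 0"
proof -
  have "f x * cnj (f (x + real_vec m)) = 0" for x
  proof (rule ccontr)
    assume "f x * cnj (f (x + real_vec m)) \<noteq> 0"
    then have nz: "f x \<noteq> 0" "f (x + real_vec m) \<noteq> 0" by auto
    define y where "y = x - real_vec (floor_vec x)"
    have y: "y \<in> unit_cube" by (simp add: y_def)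
    have "floor_vec x \<in> supp_shifts f" "floor_vec x + m \<in> supp_shifts f"
      unfolding supp_shifts_def using nz
      by (auto intro!: bexI[OF _ y] simp: y_def real_vec_add add_ac)
    then have "m \<in> corr_shifts f"
      unfolding corr_shifts_def by (intro image_eqI[where x = "(floor_vec x, floor_vec x + m)"]) auto
    with assms show False by simp
  qed
  then show ?thesis unfolding autocorr_def by (simp only: integral_zero)
qed

lemma borel_measurable_periodize:
  assumes "bounded_bsupp f"
  shows "periodize f \<in> borel_measurable borel"
proof -
  have [measurable]: "f \<in> borel_measurable borel" using assms by (rule bounded_bsupp_measurable)
  show ?thesis unfolding periodize_def by measurable
qed

lemma periodize_bounded:
  assumes "bounded_bsupp f"
  shows "\<exists>B. \<forall>x. norm (periodize f x) \<le> B"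
proof -
  obtain B where "0 \<le> B" "\<And>x. norm (f x) \<le> B" using bounded_bsupp_bound[OF assms] by blast
  then have "norm (periodize f x) \<le> (\<Sum>k\<in>supp_shifts f. B)" for x
    unfolding periodize_def by (intro sum_norm_le) auto
  then show ?thesis by blast
qed

text \<open>Characters are 1 at integer vectors, so they pass through the periodization, and
  unfolding the cube integral gives an integral over the whole space.\<close>

lemma periodize_coeff:
  assumes f: "bounded_bsupp f"
  shows "(LINT x|cube_measure. periodize f x * chr (- j) x) = (LINT x|lborel. f x * chr (- j) x)"
proof -
  have "(LINT x|lborel. f x * chr (- j) x) =
      (LINT x|cube_measure. (\<Sum>k\<in>supp_shifts f. f (x + real_vec k) * chr (- j) (x + real_vec k)))"
  proof (rule integral_unfold_cube[OF _ finite_supp_shifts[OF f]])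
    show "integrable lborel (\<lambda>x. f x * chr (- j) x)"
      by (rule bounded_bsupp_integrable_mult[OF f]) (auto simp: bounded_iff)
  qed (simp add: not_in_supp_shifts)
  then show ?thesis by (simp add: periodize_def chr_add_right sum_distrib_right)
qed

text \<open>The squared modulus is a double sum over pairs of translates. Grouped by the difference
  of the two indices, it unfolds to autocorrelations.\<close>

lemma periodize_L2:
  assumes f: "bounded_bsupp f"
  shows "complex_of_real (LINT x|cube_measure. (norm (periodize f x))\<^sup>2) = (\<Sum>m\<in>corr_shifts f. autocorr f m)"
proof -
  let ?K = "supp_shifts f" and ?D = "corr_shifts f"
  have K: "finite ?K" and D: "finite ?D" using f by (auto intro: finite_supp_shifts finite_corr_shifts)
  have [measurable]: "f \<in> borel_measurable borel" using f by (rule bounded_bsupp_measurable)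
  have int: "integrable lborel (\<lambda>x. f x * cnj (f (x + real_vec m)))" for m
  proof (rule bounded_bsupp_integrable_mult[OF f])
    show "bounded (range (\<lambda>x. cnj (f (x + real_vec m))))"
      using bounded_bsupp_bound[OF f] by (auto simp: bounded_iff)
  qed measurable
  \<comment> \<open>For fixed \<open>k\<close> in \<open>?K\<close> the indices \<open>k + m\<close>
    with \<open>m\<close> in \<open>?D\<close> exhaust \<open>?K\<close>; any further ones
    contribute 0. Hence the inner sum does not depend on \<open>k\<close>.\<close>
  have shift: "(\<Sum>m\<in>?D. f (x + real_vec k + real_vec m)) = periodize f x" if x: "x \<in> unit_cube" and k: "k \<in> ?K" for x k
  proof -
    have "(\<Sum>m\<in>?D. f (x + real_vec k + real_vec m)) = (\<Sum>m\<in>(\<lambda>l. l - k) ` ?K. f (x + real_vec k + real_vec m))"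
    proof (rule sum.mono_neutral_right[OF D])
      show "(\<lambda>l. l - k) ` ?K \<subseteq> ?D" using k by (auto simp: corr_shifts_def)
      show "\<forall>m\<in>?D - (\<lambda>l. l - k) ` ?K. f (x + real_vec k + real_vec m) = 0"
      proof
        fix m assume "m \<in> ?D - (\<lambda>l. l - k) ` ?K"
        then have "k + m \<notin> ?K" by (auto intro!: image_eqI[where x = "k + m"])
        from not_in_supp_shifts[OF x this] show "f (x + real_vec k + real_vec m) = 0"
          by (simp add: real_vec_add add_ac)
      qed
    qed
    also have "\<dots> = periodize f x"
      unfolding periodize_def by (subst sum.reindex) (auto simp: inj_on_def real_vec_diff)
    finally show ?thesis .
  qed
  have "(\<Sum>m\<in>?D. autocorr f m) = (LINT x|lborel. (\<Sum>m\<in>?D. f x * cnj (f (x + real_vec m))))"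
    unfolding autocorr_def by (rule Bochner_Integration.integral_sum[symmetric]) (rule int)
  also have "\<dots> = (LINT x|cube_measure. (\<Sum>k\<in>?K. (\<Sum>m\<in>?D. f (x + real_vec k) * cnj (f (x + real_vec k + real_vec m)))))"
    by (rule integral_unfold_cube[OF _ K]) (auto intro: int simp: not_in_supp_shifts)
  also have "\<dots> = (LINT x|cube_measure. complex_of_real ((norm (periodize f x))\<^sup>2))"
  proof (rule Bochner_Integration.integral_cong[OF refl])
    fix x :: "real ^ 'a" assume "x \<in> space cube_measure"
    then have x: "x \<in> unit_cube" by (simp add: space_cube_measure)
    have "(\<Sum>k\<in>?K. (\<Sum>m\<in>?D. f (x + real_vec k) * cnj (f (x + real_vec k + real_vec m))))
      = (\<Sum>k\<in>?K. f (x + real_vec k) * cnj (\<Sum>m\<in>?D. f (x + real_vec k + real_vec m)))"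
      by (simp add: sum_distrib_left)
    also have "\<dots> = (\<Sum>k\<in>?K. f (x + real_vec k) * cnj (periodize f x))"
      by (intro sum.cong refl) (simp only: shift[OF x])
    also have "\<dots> = periodize f x * cnj (periodize f x)"
      by (simp add: periodize_def sum_distrib_right)
    finally show "(\<Sum>k\<in>?K. (\<Sum>m\<in>?D. f (x + real_vec k) * cnj (f (x + real_vec k + real_vec m))))
      = complex_of_real ((norm (periodize f x))\<^sup>2)" by (simp only: complex_norm_square)
  qed
  also have "\<dots> = complex_of_real (LINT x|cube_measure. (norm (periodize f x))\<^sup>2)"
    by (rule integral_complex_of_real)
  finally show ?thesis by simp
qed

definition modulate :: "'a::euclidean_space \<Rightarrow> ('a \<Rightarrow> complex) \<Rightarrow> 'a \<Rightarrow> complex"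
  where "modulate \<xi> f x = f x * cis (- 2 * pi * (x \<bullet> \<xi>))"

lemma borel_measurable_cis [measurable (raw)]:
  "f \<in> borel_measurable M \<Longrightarrow> (\<lambda>x. cis (f x)) \<in> borel_measurable M"
  by (rule measurable_compose[OF _ borel_measurable_continuous_onI[OF continuous_on_cis[OF continuous_on_id]]])

lemma fourier_lborel:
  assumes [measurable]: "f \<in> borel_measurable borel"
  shows "fourier f \<xi> = (LINT x|lborel. modulate \<xi> f x)"
  unfolding fourier_def modulate_def by (rule integral_completion) measurable

lemma bounded_bsupp_modulate: "bounded_bsupp f \<Longrightarrow> bounded_bsupp (modulate \<xi> f)"
  unfolding modulate_def by (rule bounded_bsupp_mult) (auto simp: bounded_iff)

lemma supp_shifts_modulate [simp]: "supp_shifts (modulate \<xi> f) = supp_shifts f"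
  by (simp add: supp_shifts_def modulate_def)

lemma corr_shifts_modulate [simp]: "corr_shifts (modulate \<xi> f) = corr_shifts f"
  by (simp add: corr_shifts_def)

lemma fourier_shift:
  assumes "bounded_bsupp f"
  shows "fourier f (\<xi> + real_vec j) = (LINT x|lborel. modulate \<xi> f x * chr (- j) x)"
  unfolding fourier_lborel[OF bounded_bsupp_measurable[OF assms]]
  by (intro Bochner_Integration.integral_cong refl)
    (simp add: modulate_def chr_def real_vec_minus inner_add_right mult.assoc cis_mult inner_commute algebra_simps)

text \<open>The phases at \<open>x\<close> cancel and only the phase of the displacement
  \<open>m\<close> remains; this is where the dependence on \<open>\<xi>\<close> becomes a
  trigonometric polynomial.\<close>

lemma autocorr_modulate: "autocorr (modulate \<xi> f) m = autocorr f m * chr m \<xi>"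
proof -
  have "modulate \<xi> f x * cnj (modulate \<xi> f (x + real_vec m)) = f x * cnj (f (x + real_vec m)) * chr m \<xi>" for x
  proof -
    have "cis (- 2 * pi * (x \<bullet> \<xi>)) * cnj (cis (- 2 * pi * ((x + real_vec m) \<bullet> \<xi>))) = chr m \<xi>"
      by (simp add: cis_cnj cis_mult chr_def inner_add_left algebra_simps)
    then show ?thesis unfolding modulate_def by (simp add: mult_ac)
  qed
  then show ?thesis by (simp add: autocorr_def)
qed

lemma has_sum_fourier_shifts:
  assumes f: "bounded_bsupp f"
  shows "((\<lambda>j. (norm (fourier f (\<xi> + real_vec j)))\<^sup>2) has_sum
    (LINT x|cube_measure. (norm (periodize (modulate \<xi> f) x))\<^sup>2)) UNIV"
proof -
  have m: "bounded_bsupp (modulate \<xi> f)" using f by (rule bounded_bsupp_modulate)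
  obtain B where "\<And>x. norm (periodize (modulate \<xi> f) x) \<le> B" using periodize_bounded[OF m] by blast
  from parseval_cube[OF borel_measurable_periodize[OF m] this]
  show ?thesis unfolding periodize_coeff[OF m] fourier_shift[OF f] .
qed

lemma periodize_modulate_L2:
  assumes "bounded_bsupp f"
  shows "complex_of_real (LINT x|cube_measure. (norm (periodize (modulate \<xi> f) x))\<^sup>2) =
    (\<Sum>m\<in>corr_shifts f. autocorr f m * chr m \<xi>)"
  unfolding periodize_L2[OF bounded_bsupp_modulate[OF assms]] autocorr_modulate by simp


text \<open>Serves for the squared modulus of a Fourier transform, which need not have bounded
  support. Nonnegativity allows Tonelli with counting measure in place of a finite index
  set.\<close>

lemma nn_integral_unfold_cube:
  fixes f :: "real ^ 'd \<Rightarrow> ennreal"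
  assumes [measurable]: "f \<in> borel_measurable borel"
  shows "(\<integral>\<^sup>+x. f x \<partial>lborel) = (\<integral>\<^sup>+x. (\<integral>\<^sup>+k. f (x + real_vec k) \<partial>count_space UNIV) \<partial>cube_measure)"
proof -
  interpret P: pair_sigma_finite "count_space (UNIV :: (int ^ 'd) set)" "lborel :: (real ^ 'd) measure"
    by (intro pair_sigma_finite.intro sigma_finite_measure_count_space_countable)
      (auto simp: lborel.sigma_finite_measure_axioms)
  have "(\<integral>\<^sup>+x. (\<integral>\<^sup>+k. f (x + real_vec k) \<partial>count_space UNIV) \<partial>cube_measure)
      = (\<integral>\<^sup>+x. (\<integral>\<^sup>+k. f (x + real_vec k) \<partial>count_space UNIV) * indicator unit_cube x \<partial>lborel)"
    by (simp add: nn_integral_restrict_space)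
  also have "\<dots> = (\<integral>\<^sup>+x. (\<integral>\<^sup>+k. f (x + real_vec k) * indicator unit_cube x \<partial>count_space UNIV) \<partial>lborel)"
    by (simp add: nn_integral_multc)
  also have "\<dots> = (\<integral>\<^sup>+k. (\<integral>\<^sup>+x. f (x + real_vec k) * indicator unit_cube x \<partial>lborel) \<partial>count_space UNIV)"
    using P.Fubini'[of "\<lambda>k x. f (x + real_vec k) * indicator unit_cube x"]
    by (auto intro!: measurable_pair_measure_countable1)
  also have "\<dots> = (\<integral>\<^sup>+k. (\<integral>\<^sup>+x. f x * indicator unit_cube (x - real_vec k) \<partial>lborel) \<partial>count_space UNIV)"
  proof (rule nn_integral_cong)
    fix k :: "int ^ 'd"
    show "(\<integral>\<^sup>+x. f (x + real_vec k) * indicator unit_cube x \<partial>lborel)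
        = (\<integral>\<^sup>+x. f x * indicator unit_cube (x - real_vec k) \<partial>lborel)"
      by (subst nn_integral_lborel_translate[of "\<lambda>x. f x * indicator unit_cube (x - real_vec k)" "real_vec k", symmetric])
        auto
  qed
  also have "\<dots> = (\<integral>\<^sup>+x. (\<integral>\<^sup>+k. f x * indicator unit_cube (x - real_vec k) \<partial>count_space UNIV) \<partial>lborel)"
    using P.Fubini'[of "\<lambda>k x. f x * indicator unit_cube (x - real_vec k)"]
    by (auto intro!: measurable_pair_measure_countable1)
  also have "\<dots> = (\<integral>\<^sup>+x. f x \<partial>lborel)"
  proof (rule nn_integral_cong)
    fix x :: "real ^ 'd"
    have "(\<integral>\<^sup>+k. f x * indicator unit_cube (x - real_vec k) \<partial>count_space UNIV)
        = (\<integral>\<^sup>+k. f x * indicator {floor_vec x} k \<partial>count_space UNIV)"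
      by (intro nn_integral_cong) (auto simp: indicator_def diff_real_vec_in_unit_cube_iff)
    also have "\<dots> = f x" by (subst nn_integral_cmult_indicator) auto
    finally show "(\<integral>\<^sup>+k. f x * indicator unit_cube (x - real_vec k) \<partial>count_space UNIV) = f x" .
  qed
  finally show ?thesis ..
qed

lemma nn_integral_count_space_has_sum:
  assumes "(f has_sum S) UNIV" "\<And>k. 0 \<le> f k"
  shows "(\<integral>\<^sup>+k. ennreal (f k) \<partial>count_space UNIV) = ennreal S"
proof -
  have "Infinite_Sum.abs_summable_on f UNIV"
    using assms by (simp add: has_sum_imp_summable)
  then have "Infinite_Set_Sum.abs_summable_on f UNIV" by (simp only: abs_summable_equivalent)
  then have "integrable (count_space UNIV) f" "infsetsum f UNIV = S"
    using infsetsum_infsum infsumI[OF assms(1)] by (auto simp: abs_summable_on_def)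
  then show ?thesis
    using assms(2) by (simp add: nn_integral_eq_integral infsetsum_def)
qed

text \<open>Extended-valued, so that inequalities and limits need no integrability conditions and a
  divergent integral of a measurable function is infinite instead of the default 0.\<close>

definition L2sq :: "('a::euclidean_space \<Rightarrow> complex) \<Rightarrow> ennreal"
  where "L2sq f = (\<integral>\<^sup>+x. ennreal ((norm (f x))\<^sup>2) \<partial>lebesgue)"

lemma L2sq_lborel: "L2sq f = (\<integral>\<^sup>+x. ennreal ((norm (f x))\<^sup>2) \<partial>lborel)"
  by (simp add: L2sq_def nn_integral_completion)

lemma borel_measurable_fourier [measurable]:
  assumes [measurable]: "f \<in> borel_measurable borel"
  shows "fourier f \<in> borel_measurable borel"
proof -
  have "(\<lambda>\<xi>. LINT x|lborel. f x * cis (- 2 * pi * (x \<bullet> \<xi>))) \<in> borel_measurable borel"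
    by measurable
  also have "(\<lambda>\<xi>. LINT x|lborel. f x * cis (- 2 * pi * (x \<bullet> \<xi>))) = fourier f"
    by (simp add: fun_eq_iff fourier_lborel modulate_def)
  finally show ?thesis .
qed

lemma L2sq_fourier_bounded_bsupp:
  fixes f :: "real ^ 'd \<Rightarrow> complex"
  assumes f: "bounded_bsupp f"
  shows "L2sq (fourier f) = L2sq f"
proof -
  have [measurable]: "f \<in> borel_measurable borel" using f by (rule bounded_bsupp_measurable)
  define S where "S \<xi> = (LINT x|cube_measure. (norm (periodize (modulate \<xi> f) x))\<^sup>2)" for \<xi>
  have S: "complex_of_real (S \<xi>) = (\<Sum>m\<in>corr_shifts f. autocorr f m * chr m \<xi>)" for \<xi>
    unfolding S_def using f by (rule periodize_modulate_L2)
  have S0: "0 \<le> S \<xi>" for \<xi> by (simp add: S_def)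
  have S_Re: "S = (\<lambda>\<xi>. Re (\<Sum>m\<in>corr_shifts f. autocorr f m * chr m \<xi>))"
    unfolding S[symmetric] by simp
  have Sm [measurable]: "S \<in> borel_measurable borel" unfolding S_Re by measurable
  have intS: "integrable cube_measure S"
  proof (rule integrable_cube_measure[OF Sm])
    fix \<xi>
    have "norm (S \<xi>) = norm (complex_of_real (S \<xi>))" by simp
    also have "\<dots> \<le> (\<Sum>m\<in>corr_shifts f. norm (autocorr f m))" unfolding S by (rule norm_chr_sum_le)
    finally show "norm (S \<xi>) \<le> (\<Sum>m\<in>corr_shifts f. norm (autocorr f m))" .
  qed
  have "complex_of_real (LINT \<xi>|cube_measure. S \<xi>) = (LINT \<xi>|cube_measure. complex_of_real (S \<xi>))"
    by (rule integral_complex_of_real[symmetric])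
  \<comment> \<open>Averaging over the cube leaves the constant term. If 0 is not among the shifts,
    the average is 0, and so is \<open>autocorr f 0\<close>.\<close>
  also have "\<dots> = autocorr f 0"
    using integral_cube_chr_sum[OF finite_corr_shifts[OF f], of "autocorr f" 0] autocorr_eq_0[of 0 f]
    by (simp add: S split: if_splits)
  also have "\<dots> = (LINT x|lborel. complex_of_real ((norm (f x))\<^sup>2))"
    unfolding autocorr_def by (simp only: complex_norm_square) simp
  also have "\<dots> = complex_of_real (LINT x|lborel. (norm (f x))\<^sup>2)" by (rule integral_complex_of_real)
  finally have eq: "(LINT \<xi>|cube_measure. S \<xi>) = (LINT x|lborel. (norm (f x))\<^sup>2)"
    by (simp only: of_real_eq_iff)
  have "bounded (range (\<lambda>x. cnj (f x)))" using bounded_bsupp_bound[OF f] by (auto simp: bounded_iff)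
  then have "integrable lborel (\<lambda>x. f x * cnj (f x))"
    using bounded_bsupp_integrable_mult[OF f, of "\<lambda>x. cnj (f x)"] by simp
  then have "integrable lborel (\<lambda>x. norm (f x * cnj (f x)))" by (rule integrable_norm)
  then have intf: "integrable lborel (\<lambda>x. (norm (f x))\<^sup>2)" by (simp add: norm_mult power2_eq_square)
  have "L2sq (fourier f) = (\<integral>\<^sup>+\<xi>. (\<integral>\<^sup>+j. ennreal ((norm (fourier f (\<xi> + real_vec j)))\<^sup>2) \<partial>count_space UNIV) \<partial>cube_measure)"
    unfolding L2sq_lborel by (rule nn_integral_unfold_cube) measurable
  also have "\<dots> = (\<integral>\<^sup>+\<xi>. ennreal (S \<xi>) \<partial>cube_measure)"
    unfolding S_def using nn_integral_count_space_has_sum[OF has_sum_fourier_shifts[OF f]] by simp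
  also have "\<dots> = ennreal (LINT \<xi>|cube_measure. S \<xi>)"
    using S0 by (intro nn_integral_eq_integral intS) auto
  also have "\<dots> = L2sq f"
    unfolding eq L2sq_lborel using intf by (intro nn_integral_eq_integral[symmetric]) auto
  finally show ?thesis .
qed

section \<open>Plancherel's inequality\<close>

lemma norm_add_power2_le: "(norm (a + b :: 'a::real_normed_vector))\<^sup>2 \<le> 2 * (norm a)\<^sup>2 + 2 * (norm b)\<^sup>2"
proof -
  have "(norm (a + b))\<^sup>2 \<le> (norm a + norm b)\<^sup>2"
    by (intro power_mono norm_triangle_ineq) simp
  also have "\<dots> \<le> 2 * (norm a)\<^sup>2 + 2 * (norm b)\<^sup>2"
    using sum_squares_bound[of "norm a" "norm b"] by (simp add: power2_sum)
  finally show ?thesis .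
qed

lemma borel_imp_lebesgue_measurable:
  "f \<in> borel_measurable borel \<Longrightarrow> f \<in> borel_measurable (lebesgue :: 'a::euclidean_space measure)"
  by (intro measurable_completion) simp

lemma L2sq_add_le:
  fixes f g :: "'a::euclidean_space \<Rightarrow> complex"
  assumes [measurable]: "f \<in> borel_measurable lebesgue" "g \<in> borel_measurable lebesgue"
  shows "L2sq (\<lambda>x. f x + g x) \<le> 2 * L2sq f + 2 * L2sq g"
proof -
  have "L2sq (\<lambda>x. f x + g x) \<le> (\<integral>\<^sup>+x. 2 * ennreal ((norm (f x))\<^sup>2) + 2 * ennreal ((norm (g x))\<^sup>2) \<partial>lebesgue)"
    unfolding L2sq_def
  proof (rule nn_integral_mono)
    fix x
    have "ennreal ((norm (f x + g x))\<^sup>2) \<le> ennreal (2 * (norm (f x))\<^sup>2 + 2 * (norm (g x))\<^sup>2)"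
      by (intro ennreal_leI norm_add_power2_le)
    then show "ennreal ((norm (f x + g x))\<^sup>2) \<le> 2 * ennreal ((norm (f x))\<^sup>2) + 2 * ennreal ((norm (g x))\<^sup>2)"
      by (simp add: ennreal_plus ennreal_mult)
  qed
  also have "\<dots> = 2 * L2sq f + 2 * L2sq g"
    unfolding L2sq_def by (subst nn_integral_add) (auto simp: nn_integral_cmult)
  finally show ?thesis .
qed

lemma L2sq_triangle:
  fixes f g h :: "'a::euclidean_space \<Rightarrow> complex"
  assumes "f \<in> borel_measurable lebesgue" "g \<in> borel_measurable lebesgue" "h \<in> borel_measurable lebesgue"
  shows "L2sq (\<lambda>x. f x - h x) \<le> 2 * L2sq (\<lambda>x. f x - g x) + 2 * L2sq (\<lambda>x. g x - h x)"
  using L2sq_add_le[of "\<lambda>x. f x - g x" "\<lambda>x. g x - h x"] assms by simp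

lemma L2sq_cong_AE: "AE x in lebesgue. f x = g x \<Longrightarrow> L2sq f = L2sq g"
  unfolding L2sq_def by (rule nn_integral_cong_AE) auto

lemma L2sq_minus_commute: "L2sq (\<lambda>x. f x - g x) = L2sq (\<lambda>x. g x - f x)"
  unfolding L2sq_def by (simp add: norm_minus_commute)

lemma fourier_diff:
  fixes f g :: "'a::euclidean_space \<Rightarrow> complex"
  assumes "integrable lebesgue f" "integrable lebesgue g"
  shows "fourier (\<lambda>x. f x - g x) \<xi> = fourier f \<xi> - fourier g \<xi>"
proof -
  have [measurable]: "(\<lambda>x. cis (- 2 * pi * (x \<bullet> \<xi>))) \<in> borel_measurable lebesgue"
    by (rule borel_imp_lebesgue_measurable) measurable
  have "integrable lebesgue (\<lambda>x. h x * cis (- 2 * pi * (x \<bullet> \<xi>)))" if h: "integrable lebesgue h" for h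
  proof (rule Bochner_Integration.integrable_bound[OF h])
    have [measurable]: "h \<in> borel_measurable lebesgue" using h by auto
    show "(\<lambda>x. h x * cis (- 2 * pi * (x \<bullet> \<xi>))) \<in> borel_measurable lebesgue" by measurable
  qed (simp add: norm_mult)
  from Bochner_Integration.integral_diff[OF this[OF assms(1)] this[OF assms(2)]]
  show ?thesis by (simp only: fourier_def left_diff_distrib)
qed

lemma bounded_bsupp_integrable_lebesgue: "bounded_bsupp f \<Longrightarrow> integrable lebesgue f"
  by (subst integrable_completion) (auto intro: bounded_bsupp_integrable dest: bounded_bsupp_measurable)

text \<open>Truncation reduces the inequality to the compactly supported case; the constant 4 is harmless
  for convergence arguments.\<close>

lemma L2sq_le_L2sq_fourier_borel:
  fixes w :: "real ^ 'd \<Rightarrow> complex"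
  assumes w: "integrable lborel w" and fin: "L2sq w < \<infinity>"
  shows "L2sq w \<le> 4 * L2sq (fourier w)"
proof -
  have [measurable]: "w \<in> borel_measurable borel" using w by auto
  define A where "A n = {x. norm x \<le> real n \<and> norm (w x) \<le> real n}" for n
  have [measurable]: "A n \<in> sets borel" for n unfolding A_def by measurable
  \<comment> \<open>Cutting off both in space and in size makes \<open>t n\<close> bounded with
    bounded support, so the exact Plancherel identity applies to it.\<close>
  define t where "t n x = w x * indicator (A n) x" for n x
  have [measurable]: "t n \<in> borel_measurable borel" for n unfolding t_def by measurable
  have bounded_bsupp_t: "bounded_bsupp (t n)" for n
    unfolding bounded_bsupp_def
  proof (intro conjI)
    have "norm (t n x) \<le> real n" for x by (auto simp: t_def A_def indicator_def)
    then show "bounded (range (t n))" by (auto simp: bounded_iff)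
    have "norm x \<le> real n" if "t n x \<noteq> 0" for x using that by (auto simp: t_def A_def indicator_def split: if_splits)
    then show "bounded {x. t n x \<noteq> 0}" by (auto simp: bounded_iff)
  qed measurable
  have mono: "A n \<subseteq> A m" if "n \<le> m" for n m using that by (auto simp: A_def)
  have ev: "eventually (\<lambda>n. t n x = w x) sequentially" for x
    using eventually_ge_at_top[of "nat \<lceil>max (norm x) (norm (w x))\<rceil>"]
    by eventually_elim (auto simp: t_def A_def indicator_def nat_le_iff ceiling_le_iff)
  have lim: "(\<lambda>n. t n x) \<longlonglongrightarrow> w x" for x using ev by (rule tendsto_eventually)
  \<comment> \<open>Integrability of \<open>w\<close> gives convergence of the transforms at each
    single frequency; finiteness of \<open>L2sq w\<close> gives the L2 convergence further
    below.\<close>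
  have four: "(\<lambda>n. fourier (t n) \<xi>) \<longlonglongrightarrow> fourier w \<xi>" for \<xi>
  proof -
    have "(\<lambda>n. LINT x|lborel. modulate \<xi> (t n) x) \<longlonglongrightarrow> (LINT x|lborel. modulate \<xi> w x)"
    proof (rule integral_dominated_convergence[where w = "\<lambda>x. norm (w x)"])
      show "AE x in lborel. (\<lambda>n. modulate \<xi> (t n) x) \<longlonglongrightarrow> modulate \<xi> w x"
        unfolding modulate_def by (intro AE_I2 tendsto_mult lim tendsto_const)
      show "AE x in lborel. norm (modulate \<xi> (t n) x) \<le> norm (w x)" for n
        by (intro AE_I2) (auto simp: modulate_def t_def norm_mult indicator_def)
    qed (use w in \<open>auto simp: modulate_def\<close>)
    then show ?thesis by (simp add: fourier_lborel)
  qed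
  have L2: "(\<lambda>n. L2sq (\<lambda>x. w x - t n x)) \<longlonglongrightarrow> 0"
  proof -
    have "(\<lambda>n. \<integral>\<^sup>+x. ennreal ((norm (w x - t n x))\<^sup>2) \<partial>lborel) \<longlonglongrightarrow> (\<integral>\<^sup>+x. 0 \<partial>(lborel :: (real ^ 'd) measure))"
    proof (rule nn_integral_dominated_convergence[where w = "\<lambda>x. ennreal ((norm (w x))\<^sup>2)"])
      show "AE x in lborel. ennreal ((norm (w x - t n x))\<^sup>2) \<le> ennreal ((norm (w x))\<^sup>2)" for n
        by (intro AE_I2 ennreal_leI) (auto simp: t_def indicator_def)
      show "(\<integral>\<^sup>+x. ennreal ((norm (w x))\<^sup>2) \<partial>lborel) < \<infinity>" using fin by (simp add: L2sq_lborel)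
      show "AE x in lborel. (\<lambda>n. ennreal ((norm (w x - t n x))\<^sup>2)) \<longlonglongrightarrow> 0"
      proof (rule AE_I2)
        fix x
        show "(\<lambda>n. ennreal ((norm (w x - t n x))\<^sup>2)) \<longlonglongrightarrow> 0"
          by (rule tendsto_eventually) (use ev[of x] in eventually_elim, simp)
      qed
    qed measurable
    then show ?thesis by (simp add: L2sq_lborel)
  qed
  \<comment> \<open>Fatou's lemma as \<open>m\<close> tends to infinity: for \<open>m\<close> at
    least \<open>n\<close> Plancherel holds exactly for \<open>t n - t m\<close>, and this
    difference is pointwise bounded by \<open>w - t n\<close>.\<close>
  have tail: "L2sq (\<lambda>\<xi>. fourier (t n) \<xi> - fourier w \<xi>) \<le> L2sq (\<lambda>x. w x - t n x)" for n
  proof -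
    have "L2sq (\<lambda>\<xi>. fourier (t n) \<xi> - fourier w \<xi>)
        = (\<integral>\<^sup>+\<xi>. liminf (\<lambda>m. ennreal ((norm (fourier (t n) \<xi> - fourier (t m) \<xi>))\<^sup>2)) \<partial>lborel)"
      unfolding L2sq_lborel
    proof (rule nn_integral_cong)
      fix \<xi>
      have "(\<lambda>m. ennreal ((norm (fourier (t n) \<xi> - fourier (t m) \<xi>))\<^sup>2)) \<longlonglongrightarrow> ennreal ((norm (fourier (t n) \<xi> - fourier w \<xi>))\<^sup>2)"
        by (intro tendsto_ennrealI tendsto_intros four)
      then show "ennreal ((norm (fourier (t n) \<xi> - fourier w \<xi>))\<^sup>2) =
          liminf (\<lambda>m. ennreal ((norm (fourier (t n) \<xi> - fourier (t m) \<xi>))\<^sup>2))"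
        by (metis lim_imp_Liminf trivial_limit_sequentially)
    qed
    also have "\<dots> \<le> liminf (\<lambda>m. \<integral>\<^sup>+\<xi>. ennreal ((norm (fourier (t n) \<xi> - fourier (t m) \<xi>))\<^sup>2) \<partial>lborel)"
      by (rule nn_integral_liminf) measurable
    also have "\<dots> \<le> limsup (\<lambda>m. \<integral>\<^sup>+\<xi>. ennreal ((norm (fourier (t n) \<xi> - fourier (t m) \<xi>))\<^sup>2) \<partial>lborel)"
      by (rule Liminf_le_Limsup) simp
    also have "\<dots> \<le> L2sq (\<lambda>x. w x - t n x)"
    proof (rule Limsup_bounded)
      show "eventually (\<lambda>m. (\<integral>\<^sup>+\<xi>. ennreal ((norm (fourier (t n) \<xi> - fourier (t m) \<xi>))\<^sup>2) \<partial>lborel)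
          \<le> L2sq (\<lambda>x. w x - t n x)) sequentially"
        using eventually_ge_at_top[of n]
      proof eventually_elim
        case (elim m)
        have "(\<integral>\<^sup>+\<xi>. ennreal ((norm (fourier (t n) \<xi> - fourier (t m) \<xi>))\<^sup>2) \<partial>lborel) = L2sq (fourier (\<lambda>x. t n x - t m x))"
          unfolding L2sq_lborel by (simp add: fourier_diff bounded_bsupp_integrable_lebesgue bounded_bsupp_t)
        also have "\<dots> = L2sq (\<lambda>x. t n x - t m x)" by (intro L2sq_fourier_bounded_bsupp bounded_bsupp_diff bounded_bsupp_t)
        also have "\<dots> \<le> L2sq (\<lambda>x. w x - t n x)"
          unfolding L2sq_def using mono[OF elim]
          by (intro nn_integral_mono ennreal_leI power_mono) (auto simp: t_def indicator_def)
        finally show ?case .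
      qed
    qed
    finally show ?thesis .
  qed
  \<comment> \<open>Two uses of \<open>L2sq_add_le\<close> nest, so the main term gets 2 * 2 = 4 and
    the vanishing error 2 + 2 * 2 = 6.\<close>
  have bnd: "L2sq w \<le> 4 * L2sq (fourier w) + 6 * L2sq (\<lambda>x. w x - t n x)" for n
  proof -
    have "L2sq w \<le> 2 * L2sq (\<lambda>x. w x - t n x) + 2 * L2sq (t n)"
      using L2sq_add_le[of "\<lambda>x. w x - t n x" "t n"] by (simp add: borel_imp_lebesgue_measurable)
    also have "L2sq (t n) = L2sq (fourier (t n))" by (intro L2sq_fourier_bounded_bsupp[symmetric] bounded_bsupp_t)
    also have "\<dots> \<le> 2 * L2sq (\<lambda>\<xi>. fourier (t n) \<xi> - fourier w \<xi>) + 2 * L2sq (fourier w)"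
      using L2sq_add_le[of "\<lambda>\<xi>. fourier (t n) \<xi> - fourier w \<xi>" "fourier w"] by (simp add: borel_imp_lebesgue_measurable)
    also have "\<dots> \<le> 2 * L2sq (\<lambda>x. w x - t n x) + 2 * L2sq (fourier w)"
      by (intro add_right_mono mult_left_mono tail) auto
    finally have "L2sq w \<le> 2 * L2sq (\<lambda>x. w x - t n x)
      + 2 * (2 * L2sq (\<lambda>x. w x - t n x) + 2 * L2sq (fourier w))"
      by (meson add_left_mono mult_left_mono order_trans zero_le)
    also have "\<dots> = 4 * L2sq (fourier w) + 6 * L2sq (\<lambda>x. w x - t n x)"
      by (simp add: distrib_left mult.assoc[symmetric] add_ac flip: distrib_right)
    finally show ?thesis .
  qed
  have "(\<lambda>n. 4 * L2sq (fourier w) + 6 * L2sq (\<lambda>x. w x - t n x)) \<longlonglongrightarrow> 4 * L2sq (fourier w) + 6 * 0"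
    by (intro tendsto_add tendsto_const ennreal_tendsto_cmult L2) auto
  then show ?thesis
    by (intro LIMSEQ_le_const[where x = "4 * L2sq (fourier w)"]) (use bnd in auto)
qed

lemma ex_borel_version:
  fixes f :: "'a::euclidean_space \<Rightarrow> complex"
  assumes f: "f \<in> borel_measurable lebesgue"
  obtains g where "g \<in> borel_measurable borel" "AE x in lebesgue. f x = g x"
proof -
  have "(\<lambda>x. Re (f x)) \<in> borel_measurable lebesgue" "(\<lambda>x. Im (f x)) \<in> borel_measurable lebesgue"
    using f by measurable
  from this[THEN completion_ex_borel_measurable_real] obtain a b
    where [measurable]: "a \<in> borel_measurable lborel" "b \<in> borel_measurable lborel"
      and ae: "AE x in lborel. Re (f x) = a x" "AE x in lborel. Im (f x) = b x" by blast
  show ?thesis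
  proof
    show "(\<lambda>x. Complex (a x) (b x)) \<in> borel_measurable borel"
      unfolding Complex_eq by measurable
    from ae have "AE x in lborel. f x = Complex (a x) (b x)"
      by eventually_elim (simp add: complex_eq_iff)
    then show "AE x in lebesgue. f x = Complex (a x) (b x)" by (rule AE_completion)
  qed
qed

text \<open>The approximating functions in \<open>L2_fourier\<close> are only Lebesgue measurable.
  Replacing one by a Borel version changes neither its norm nor any value of its Fourier
  transform.\<close>

lemma L2sq_le_L2sq_fourier:
  fixes w :: "real ^ 'd \<Rightarrow> complex"
  assumes w: "integrable lebesgue w" and fin: "L2sq w < \<infinity>"
  shows "L2sq w \<le> 4 * L2sq (fourier w)"
proof -
  obtain g where [measurable]: "g \<in> borel_measurable borel" and g: "AE x in lebesgue. w x = g x"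
    using w by (elim ex_borel_version[rotated]) auto
  have [measurable]: "w \<in> borel_measurable lebesgue" using w by auto
  have gl [measurable]: "g \<in> borel_measurable lebesgue" by (intro measurable_completion) measurable
  have "integrable lebesgue g" using w g by (subst integrable_cong_AE[symmetric]) auto
  then have gi: "integrable lborel g" by (subst (asm) integrable_completion) auto
  have four: "fourier w = fourier g"
  proof
    fix \<xi> :: "real ^ 'd"
    have [measurable]: "(\<lambda>x. cis (- 2 * pi * (x \<bullet> \<xi>))) \<in> borel_measurable lebesgue"
      by (intro measurable_completion) measurable
    show "fourier w \<xi> = fourier g \<xi>"
      unfolding fourier_def
    proof (rule integral_cong_AE)
      show "AE x in lebesgue. w x * cis (- 2 * pi * (x \<bullet> \<xi>)) = g x * cis (- 2 * pi * (x \<bullet> \<xi>))"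
        using g by eventually_elim simp
    qed measurable
  qed
  have "L2sq w = L2sq g" using g by (rule L2sq_cong_AE)
  with L2sq_le_L2sq_fourier_borel[OF gi] fin show ?thesis by (simp add: four)
qed

section \<open>Absolutely convergent Fourier series of an inverse square root\<close>

lemma abs_gbinomial_minus_half_le: "\<bar>(- 1 / 2 :: real) gchoose n\<bar> \<le> 1"
proof (induction n)
  case (Suc n)
  have "(- 1 / 2 :: real) gchoose Suc n = ((- 1 / 2) gchoose n) * ((- 1 / 2 - real n) / (real n + 1))"
    by (simp add: gbinomial_prod_rev field_simps)
  moreover have "\<bar>(- 1 / 2 - real n) / (real n + 1)\<bar> \<le> 1" by (simp add: abs_if field_simps)
  ultimately show ?case using Suc by (simp only: abs_mult) (rule mult_le_one, auto)
qed simp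

lemma inverse_sqrt_series:
  fixes q :: real
  assumes "\<bar>q\<bar> < 1"
  shows "(\<lambda>n. ((- 1 / 2 gchoose n) * (- 1) ^ n) * q ^ n) sums (1 / sqrt (1 - q))"
proof -
  have "(\<lambda>n. (- 1 / 2 gchoose n) * (- q) ^ n) sums (1 + - q) powr (- 1 / 2)"
    by (rule gen_binomial_real) (use assms in simp)
  moreover have "(1 + - q) powr (- 1 / 2) = 1 / sqrt (1 - q)"
  proof -
    have "(1 + - q) powr (- 1 / 2) = (1 - q) powr (- (1 / 2))" by simp
    also have "\<dots> = inverse ((1 - q) powr (1 / 2))" by (rule powr_minus)
    also have "(1 - q) powr (1 / 2) = sqrt (1 - q)" using assms by (intro powr_half_sqrt) simp
    finally show ?thesis by (simp only: divide_inverse mult_1)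
  qed
  moreover have "(- 1 / 2 gchoose n) * (- q) ^ n = ((- 1 / 2 gchoose n) * (- 1) ^ n) * q ^ n" for n
    using power_mult_distrib[of "- 1" q n] by (simp only: mult.assoc mult_minus1)
  ultimately show ?thesis by (simp only:)
qed

lemma summable_poly_times_geometric:
  fixes r :: real
  assumes "0 \<le> r" "r < 1"
  shows "summable (\<lambda>j. real ((2 * (j * N) + 1) ^ d) * r ^ j)"
proof (cases "r = 0")
  case True
  have "summable (\<lambda>j. real ((2 * (Suc j * N) + 1) ^ d) * r ^ Suc j)" using True by simp
  then show ?thesis by (subst (asm) summable_Suc_iff)
next
  case False
  \<comment> \<open>A ratio strictly between \<open>r\<close> and 1 leaves room to absorb the
    polynomial factor.\<close>
  define s where "s = (1 + r) / 2"
  have s: "0 < r" "r < s" "s < 1" using assms False by (auto simp: s_def)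
  have "summable (\<lambda>j. norm (s ^ j))" using s by (simp add: norm_power summable_geometric)
  moreover have "(\<lambda>j. real ((2 * (j * N) + 1) ^ d) * r ^ j) \<in> O(\<lambda>j. s ^ j)"
  proof (cases "N = 0")
    case True
    then show ?thesis using s by simp real_asymp
  next
    case False
    define c where "c = real N"
    have "c > 0" using False by (simp add: c_def)
    then have "(\<lambda>j. (2 * (real j * c) + 1) powr real d * r ^ j) \<in> O(\<lambda>j. s ^ j)"
      using s by real_asymp
    also have "(\<lambda>j. (2 * (real j * c) + 1) powr real d * r ^ j) = (\<lambda>j. real ((2 * (j * N) + 1) ^ d) * r ^ j)"
      using \<open>c > 0\<close> by (simp add: fun_eq_iff c_def powr_realpow add_pos_nonneg add_ac)
    finally show ?thesis .
  qed
  ultimately show ?thesis by (rule summable_comparison_test_bigo)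
qed

text \<open>Instead of Wiener's lemma: expand \<open>(1 - q) powr (- 1 / 2)\<close> in powers of \<open>q = 1 - P / A\<close>. The
  \<open>j\<close>-th power has polynomially many coefficients in \<open>j\<close>, each of them at most \<open>r ^ j\<close> with
  \<open>r = max q < 1\<close>.\<close>

lemma fourier_series_inverse_sqrt:
  fixes P :: "real ^ 'd \<Rightarrow> real"
  assumes tp: "trigpoly N (\<lambda>x. complex_of_real (P x))" and pos: "\<And>x. 0 < P x"
  shows "((\<lambda>k. (LINT y|cube_measure. complex_of_real (1 / sqrt (P y)) * chr (- k) y) * chr k x)
    has_sum complex_of_real (1 / sqrt (P x))) UNIV"
proof -
  obtain p where p: "\<And>x. complex_of_real (P x) = (\<Sum>k\<in>freq_box N. p k * chr k x)"
    using tp by (auto simp: trigpoly_def)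
  \<comment> \<open>The sum of the coefficient moduli dominates \<open>P\<close>, so
    \<open>q\<close> takes values in [0, 1) and the binomial series applies.\<close>
  define A where "A = (\<Sum>k\<in>freq_box N. norm (p k))"
  have PA: "P x \<le> A" for x
  proof -
    have "P x \<le> norm (complex_of_real (P x))" by simp
    also have "\<dots> \<le> A" unfolding p A_def by (rule norm_chr_sum_le)
    finally show ?thesis .
  qed
  have A0: "0 < A" using pos[of 0] PA[of 0] by linarith
  define q where "q x = 1 - P x / A" for x
  have q0: "0 \<le> q x" and q1: "q x < 1" for x using PA[of x] pos[of x] A0 by (auto simp: q_def field_simps)
  have P_Re: "P = (\<lambda>x. Re (\<Sum>k\<in>freq_box N. p k * chr k x))" unfolding p[symmetric] by simp
  have contP: "continuous_on S P" for S unfolding P_Re by (intro continuous_intros)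
  have contq: "continuous_on S q" for S unfolding q_def using contP A0 by (intro continuous_intros) auto
  have [measurable]: "P \<in> borel_measurable borel" "q \<in> borel_measurable borel"
    by (auto intro: borel_measurable_continuous_onI contP contq)
  have "(0 :: real ^ 'd) \<in> cbox 0 One" by (simp add: cbox_One_cart)
  then obtain x0 where x0: "\<And>x. x \<in> cbox 0 One \<Longrightarrow> q x \<le> q x0"
    using continuous_attains_sup[OF compact_cbox[of 0 One] _ contq] by blast
  \<comment> \<open>A maximum attained on the compact cube: that \<open>q\<close> stays below 1 at
    each point would not by itself give a uniform ratio.\<close>
  define r where "r = q x0"
  have r: "0 \<le> r" "r < 1" using q0 q1 by (auto simp: r_def)
  have qr: "q x \<le> r" if "x \<in> unit_cube" for x
    using that unfolding r_def by (intro x0) (auto simp: unit_cube_def cbox_One_cart less_imp_le)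
  define e where "e j = ((- 1 / 2 gchoose j) * (- 1) ^ j) / sqrt A" for j
  have eb: "\<bar>e j\<bar> \<le> 1 / sqrt A" for j
    using abs_gbinomial_minus_half_le[of j] A0 unfolding e_def
    by (simp add: abs_mult power_abs field_simps)
  have ser: "(\<lambda>j. e j * q x ^ j) sums (1 / sqrt (P x))" for x
  proof -
    have "(\<lambda>j. ((- 1 / 2 gchoose j) * (- 1) ^ j) * q x ^ j / sqrt A) sums (1 / sqrt (1 - q x) / sqrt A)"
      using q0[of x] q1[of x] by (intro sums_divide inverse_sqrt_series) auto
    moreover have "1 / sqrt (1 - q x) / sqrt A = 1 / sqrt (P x)"
      using A0 pos[of x] by (simp add: q_def real_sqrt_divide)
    ultimately show ?thesis by (simp add: e_def)
  qed
  define \<alpha> where "\<alpha> j k = (LINT x|cube_measure. complex_of_real (q x) ^ j * chr (- k) x)" for j k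
  have qtp: "trigpoly N (\<lambda>x. complex_of_real (q x))"
  proof -
    have "trigpoly (0 + N) (\<lambda>x. complex_of_real (- 1 / A) * complex_of_real (P x))"
      by (intro trigpoly_mult trigpoly_const tp)
    from trigpoly_add[OF trigpoly_const[of _ 1] this] show ?thesis by (simp add: q_def)
  qed
  have exp: "complex_of_real (q x) ^ j = (\<Sum>k\<in>freq_box (j * N). \<alpha> j k * chr k x)"
    and \<alpha>0: "k \<notin> freq_box (j * N) \<Longrightarrow> \<alpha> j k = 0" for x j k
  proof -
    obtain a where a: "\<And>x. complex_of_real (q x) ^ j = (\<Sum>k\<in>freq_box (j * N). a k * chr k x)"
      using trigpoly_pow[OF qtp, of j] by (auto simp: trigpoly_def)
    have "\<alpha> j k = (if k \<in> freq_box (j * N) then a k else 0)" for k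
      unfolding \<alpha>_def a by (rule integral_cube_chr_sum) simp
    then show "complex_of_real (q x) ^ j = (\<Sum>k\<in>freq_box (j * N). \<alpha> j k * chr k x)"
      "k \<notin> freq_box (j * N) \<Longrightarrow> \<alpha> j k = 0"
      unfolding a by simp_all
  qed
  have \<alpha>b: "norm (\<alpha> j k) \<le> r ^ j" for j k
  proof -
    have "norm (\<alpha> j k) \<le> (LINT x|cube_measure. norm (complex_of_real (q x) ^ j * chr (- k) x))"
      unfolding \<alpha>_def by (rule integral_norm_bound)
    also have "\<dots> \<le> (LINT x|(cube_measure :: (real ^ 'd) measure). r ^ j)"
    proof (rule integral_mono)
      show "integrable cube_measure (\<lambda>x. norm (complex_of_real (q x) ^ j * chr (- k) x))"
        by (rule integrable_cube_measure[where B = 1])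
          (use q0 q1 in \<open>auto simp: norm_mult norm_power less_imp_le intro!: power_le_one\<close>)
      fix x :: "real ^ 'd" assume "x \<in> space cube_measure"
      then show "norm (complex_of_real (q x) ^ j * chr (- k) x) \<le> r ^ j"
        using qr[of x] q0[of x] by (auto simp: norm_mult norm_power space_cube_measure intro!: power_mono)
    qed simp
    also have "\<dots> = r ^ j"
      by (simp add: measure_def emeasure_restrict_space emeasure_unit_cube space_restrict_space)
    finally show ?thesis .
  qed
  have sumr: "summable (\<lambda>j. r ^ j / sqrt A)" using r by (intro summable_divide summable_geometric) auto
  \<comment> \<open>Dominated by the geometric series, the binomial expansion may be integrated term
    by term against each character.\<close>
  have coeff: "(\<lambda>j. complex_of_real (e j) * \<alpha> j k) sums (LINT y|cube_measure. complex_of_real (1 / sqrt (P y)) * chr (- k) y)" for k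
  proof -
    let ?f = "\<lambda>j y. complex_of_real (e j * q y ^ j) * chr (- k) y"
    have nb: "norm (?f j y) \<le> r ^ j / sqrt A" if "y \<in> unit_cube" for j y
    proof -
      have "\<bar>e j\<bar> * q y ^ j \<le> (1 / sqrt A) * r ^ j"
        using eb[of j] qr[OF that] q0[of y] A0 by (intro mult_mono power_mono) auto
      then show ?thesis using q0[of y] by (simp add: norm_mult norm_power abs_mult)
    qed
    have int: "integrable cube_measure (?f j)" for j
    proof (rule cube.integrable_const_bound[where B = "r ^ j / sqrt A"])
      show "AE y in cube_measure. norm (?f j y) \<le> r ^ j / sqrt A"
        by (intro AE_I2 nb) (simp add: space_cube_measure)
    qed (rule borel_measurable_cube_measure, measurable)
    have "(\<lambda>j. LINT y|cube_measure. ?f j y) sums (LINT y|cube_measure. (\<Sum>j. ?f j y))"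
    proof (rule sums_integral[OF int])
      show "AE y in cube_measure. summable (\<lambda>j. norm (?f j y))"
        by (intro AE_I2 summable_comparison_test'[OF sumr]) (use nb in \<open>simp add: space_cube_measure\<close>)
      show "summable (\<lambda>j. LINT y|cube_measure. norm (?f j y))"
      proof (rule summable_comparison_test'[OF sumr])
        fix j
        have "(LINT y|cube_measure. norm (?f j y)) \<le> (LINT y|(cube_measure :: (real ^ 'd) measure). r ^ j / sqrt A)"
          by (intro integral_mono integrable_norm int) (use nb in \<open>auto simp: space_cube_measure\<close>)
        also have "\<dots> = r ^ j / sqrt A"
          by (simp add: measure_def emeasure_restrict_space emeasure_unit_cube space_restrict_space)
        finally show "norm (LINT y|cube_measure. norm (?f j y)) \<le> r ^ j / sqrt A" by simp
      qed
    qed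
    moreover have "(\<Sum>j. ?f j y) = complex_of_real (1 / sqrt (P y)) * chr (- k) y" for y
      by (intro sums_unique[symmetric] sums_mult2 sums_of_real ser)
    moreover have "(LINT y|cube_measure. ?f j y) = complex_of_real (e j) * \<alpha> j k" for j
      unfolding \<alpha>_def by (subst integral_mult_right_zero[symmetric]) (simp add: mult.assoc)
    ultimately show ?thesis by simp
  qed
  \<comment> \<open>For each \<open>j\<close> only the frequencies in
    \<open>freq_box (j * N)\<close> occur, so the inner sum is at most their number times
    \<open>r ^ j / sqrt A\<close>. Absolute summability of the double family then permits both
    orders of summation.\<close>
  have double: "(\<lambda>(j, k). norm (complex_of_real (e j) * \<alpha> j k * chr k x)) summable_on (UNIV \<times> UNIV)"
  proof (rule summable_on_SigmaI)
    fix j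
    show "((\<lambda>k. case (j, k) of (j, k) \<Rightarrow> norm (complex_of_real (e j) * \<alpha> j k * chr k x))
        has_sum (\<Sum>k\<in>freq_box (j * N). norm (complex_of_real (e j) * \<alpha> j k * chr k x))) UNIV"
      by (rule has_sum_finite_neutralI[of "freq_box (j * N)"]) (auto simp: \<alpha>0)
  next
    have "summable (\<lambda>j. real ((2 * (j * N) + 1) ^ CARD('d)) * r ^ j / sqrt A)"
      using r by (intro summable_divide summable_poly_times_geometric)
    then have "summable (\<lambda>j. \<Sum>k\<in>freq_box (j * N). norm (complex_of_real (e j) * \<alpha> j k * chr k x))"
    proof (rule summable_comparison_test')
      fix j
      have "(\<Sum>k\<in>freq_box (j * N). norm (complex_of_real (e j) * \<alpha> j k * chr k x)) \<le>
          (\<Sum>k\<in>(freq_box (j * N) :: (int ^ 'd) set). (1 / sqrt A) * r ^ j)"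
      proof (rule sum_mono)
        fix k
        have "\<bar>e j\<bar> * norm (\<alpha> j k) \<le> (1 / sqrt A) * r ^ j"
          using eb[of j] \<alpha>b[of j k] A0 by (intro mult_mono) auto
        then show "norm (complex_of_real (e j) * \<alpha> j k * chr k x) \<le> (1 / sqrt A) * r ^ j"
          by (simp add: norm_mult)
      qed
      also have "\<dots> = real ((2 * (j * N) + 1) ^ CARD('d)) * r ^ j / sqrt A"
        by (simp add: card_freq_box)
      finally show "norm (\<Sum>k\<in>freq_box (j * N). norm (complex_of_real (e j) * \<alpha> j k * chr k x))
          \<le> real ((2 * (j * N) + 1) ^ CARD('d)) * r ^ j / sqrt A"
        by (simp add: sum_nonneg)
    qed
    then show "(\<lambda>j. \<Sum>k\<in>freq_box (j * N). norm (complex_of_real (e j) * \<alpha> j k * chr k x)) summable_on UNIV"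
      by (subst summable_on_UNIV_nonneg_real_iff) (auto intro: sum_nonneg)
  qed auto
  define h where "h = (\<lambda>(j, k). complex_of_real (e j) * \<alpha> j k * chr k x)"
  have "(\<lambda>z. norm (h z)) summable_on (UNIV \<times> UNIV)"
    using double by (simp add: h_def case_prod_unfold)
  then have "h summable_on (UNIV \<times> UNIV)" by (rule abs_summable_summable)
  then obtain S where S: "(h has_sum S) (UNIV \<times> UNIV)" by (auto simp: summable_on_def)
  \<comment> \<open>Summing over \<open>k\<close> first identifies the total \<open>S\<close> as the
    function value; summing over \<open>j\<close> first, below, turns the same total into the
    Fourier series.\<close>
  have "((\<lambda>j. complex_of_real (e j * q x ^ j)) has_sum S) UNIV"
  proof (rule has_sum_SigmaD[OF S])
    fix j
    show "((\<lambda>k. h (j, k)) has_sum complex_of_real (e j * q x ^ j)) UNIV"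
    proof (rule has_sum_finite_neutralI[of "freq_box (j * N)"])
      show "complex_of_real (e j * q x ^ j) = (\<Sum>k\<in>freq_box (j * N). h (j, k))"
        by (simp add: h_def exp sum_distrib_left mult.assoc)
    qed (auto simp: h_def \<alpha>0)
  qed
  from has_sum_imp_sums[OF this] sums_of_real[OF ser[of x]]
  have Seq: "S = complex_of_real (1 / sqrt (P x))" by (rule sums_unique2)
  have S': "((\<lambda>(k, j). h (j, k)) has_sum S) (UNIV \<times> UNIV)"
    using S by (subst (asm) has_sum_swap)
  have "((\<lambda>k. (LINT y|cube_measure. complex_of_real (1 / sqrt (P y)) * chr (- k) y) * chr k x) has_sum S) UNIV"
  proof (rule has_sum_SigmaD[OF S'])
    fix k
    have "((\<lambda>j. complex_of_real (e j) * \<alpha> j k) has_sum (LINT y|cube_measure. complex_of_real (1 / sqrt (P y)) * chr (- k) y)) UNIV"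
    proof (rule norm_summable_imp_has_sum[OF _ coeff])
      show "summable (\<lambda>j. norm (complex_of_real (e j) * \<alpha> j k))"
      proof (rule summable_comparison_test'[OF sumr])
        fix j
        have "\<bar>e j\<bar> * norm (\<alpha> j k) \<le> (1 / sqrt A) * r ^ j"
          using eb[of j] \<alpha>b[of j k] A0 by (intro mult_mono) auto
        then show "norm (norm (complex_of_real (e j) * \<alpha> j k)) \<le> r ^ j / sqrt A" by (simp add: norm_mult)
      qed
    qed
    from has_sum_cmult_left[OF this, of "chr k x"]
    show "((\<lambda>j. case (k, j) of (k, j) \<Rightarrow> h (j, k)) has_sum
        (LINT y|cube_measure. complex_of_real (1 / sqrt (P y)) * chr (- k) y) * chr k x) UNIV"
      by (simp add: h_def)
  qed
  then show ?thesis unfolding Seq .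
qed

section \<open>Tiles and tile B-splines\<close>

lemma bounded_bsupp_indicator:
  fixes G :: "'a::euclidean_space set"
  assumes "compact G"
  shows "bounded_bsupp (indicator G)"
proof -
  have [measurable]: "G \<in> sets borel" using assms by (simp add: borel_compact)
  have "bounded (range (indicator G :: 'a \<Rightarrow> complex))"
    unfolding bounded_iff by (rule exI[of _ 1]) (auto simp: indicator_def)
  moreover have "{x. indicator G x \<noteq> (0 :: complex)} = G" by (auto simp: indicator_def)
  ultimately show ?thesis using assms by (simp add: bounded_bsupp_def compact_imp_bounded)
qed

text \<open>\<open>n x\<close> counts the translates covering \<open>x\<close>. It is at least 1 on
  the cube by the covering property, and unfolding shows that its mean is the measure of
  \<open>G\<close>, which is 1; so it is 1 almost everywhere and a single unimodular term is
  left.\<close>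

lemma AE_periodize_indicator:
  fixes G :: "(real ^ 'd) set"
  assumes G: "compact G" "emeasure lborel G = 1" and cover: "\<And>x. \<exists>k. x - real_vec k \<in> G"
  shows "AE x in cube_measure. norm (periodize (modulate \<xi> (indicator G)) x) = 1"
proof -
  let ?K = "supp_shifts (indicator G)"
  have [measurable]: "G \<in> sets borel" using G by (simp add: borel_compact)
  have K: "finite ?K" by (intro finite_supp_shifts bounded_bsupp_indicator G)
  define n where "n x = (\<Sum>k\<in>?K. indicat_real G (x + real_vec k))" for x
  have [measurable]: "n \<in> borel_measurable borel" unfolding n_def by measurable
  have in_K: "k \<in> ?K" if "x \<in> unit_cube" "x + real_vec k \<in> G" for x k
    using that by (auto simp: supp_shifts_def intro!: bexI[of _ x])
  have ge1: "1 \<le> n x" if x: "x \<in> unit_cube" for x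
  proof -
    obtain k where k: "x - real_vec k \<in> G" using cover by blast
    then have "- k \<in> ?K" by (intro in_K[OF x]) (simp add: real_vec_minus)
    then have "indicat_real G (x + real_vec (- k)) \<le> n x"
      unfolding n_def by (intro member_le_sum K) auto
    with k show ?thesis by (simp add: real_vec_minus)
  qed
  have "norm (n x) \<le> real (card ?K)" for x
    unfolding n_def by (rule order_trans[OF norm_sum]) (auto intro!: sum_bounded_above[where K = 1, simplified])
  then have intn: "integrable cube_measure n" by (rule integrable_cube_measure[rotated]) measurable
  have "(LINT x|cube_measure. n x) = (LINT x|lborel. indicat_real G x)"
    unfolding n_def
  proof (rule integral_unfold_cube[symmetric, OF _ K])
    show "integrable lborel (indicat_real G)" using G by (intro integrable_real_indicator) auto
  qed (auto simp: indicator_def intro: in_K)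
  also have "\<dots> = 1" using G by (simp add: measure_def)
  finally have "(LINT x|cube_measure. n x - 1) = 0"
    using intn by (simp add: measure_def emeasure_restrict_space emeasure_unit_cube space_restrict_space)
  then have "AE x in cube_measure. n x - 1 = 0"
    using intn ge1 by (subst (asm) integral_nonneg_eq_0_iff_AE) (auto simp: space_cube_measure)
  moreover have "norm (periodize (modulate \<xi> (indicator G)) x) = 1" if "n x - 1 = 0" for x
  proof -
    have "n x = (\<Sum>k\<in>?K. if x + real_vec k \<in> G then 1 else 0)"
      unfolding n_def by (intro sum.cong) (auto simp: indicator_def)
    also have "\<dots> = real (card {k \<in> ?K. x + real_vec k \<in> G})"
      using K by (simp add: sum.If_cases Int_def)
    finally have "card {k \<in> ?K. x + real_vec k \<in> G} = 1" using that by simp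
    then obtain k0 where k0: "{k \<in> ?K. x + real_vec k \<in> G} = {k0}" by (auto simp: card_1_singleton_iff)
    have "periodize (modulate \<xi> (indicator G)) x = (\<Sum>k\<in>{k \<in> ?K. x + real_vec k \<in> G}. modulate \<xi> (indicator G) (x + real_vec k))"
      unfolding periodize_def supp_shifts_modulate
      by (rule sum.mono_neutral_right) (auto simp: K modulate_def indicator_def)
    also have "\<dots> = modulate \<xi> (indicator G) (x + real_vec k0)" unfolding k0 by simp
    moreover have "x + real_vec k0 \<in> G" using k0 by blast
    ultimately show ?thesis by (simp add: modulate_def norm_mult)
  qed
  ultimately show ?thesis by (auto elim: eventually_mono)
qed

lemma tile_fourier_nonzero:
  fixes G :: "(real ^ 'd) set"
  assumes G: "compact G" "emeasure lborel G = 1" and cover: "\<And>x. \<exists>k. x - real_vec k \<in> G"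
  shows "\<exists>j. fourier (indicator G) (\<xi> + real_vec j) \<noteq> 0"
proof (rule ccontr)
  let ?p = "periodize (modulate \<xi> (indicator G))"
  assume "\<not> ?thesis"
  then have "((\<lambda>j. 0) has_sum (LINT x|cube_measure. (norm (?p x))\<^sup>2)) (UNIV :: (int ^ 'd) set)"
    using has_sum_fourier_shifts[OF bounded_bsupp_indicator[OF G(1)], of \<xi>] by simp
  then have "(LINT x|cube_measure. (norm (?p x))\<^sup>2) = 0"
    by (metis has_sum_0 has_sum_unique)
  moreover have "(LINT x|cube_measure. (norm (?p x))\<^sup>2) = (LINT x|(cube_measure :: (real ^ 'd) measure). 1)"
  proof (rule integral_cong_AE)
    have [measurable]: "?p \<in> borel_measurable cube_measure"
      by (intro borel_measurable_cube_measure borel_measurable_periodize bounded_bsupp_modulate bounded_bsupp_indicator G)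
    show "(\<lambda>x. (norm (?p x))\<^sup>2) \<in> borel_measurable cube_measure" by measurable
    show "AE x in cube_measure. (norm (?p x))\<^sup>2 = 1"
      using AE_periodize_indicator[OF assms, of \<xi>] by eventually_elim simp
  qed simp
  ultimately show False
    by (simp add: measure_def emeasure_restrict_space emeasure_unit_cube space_restrict_space)
qed

section \<open>Convolution and the Fourier transform of tile B-splines\<close>

lemma fun_conv_lborel:
  assumes [measurable]: "f \<in> borel_measurable borel" "g \<in> borel_measurable borel"
  shows "fun_conv f g x = (LINT y|lborel. f y * g (x - y))"
  unfolding fun_conv_def by (rule integral_completion) measurable

lemma bounded_bsupp_fun_conv:
  fixes f g :: "'a::euclidean_space \<Rightarrow> complex"
  assumes f: "bounded_bsupp f" and g: "bounded_bsupp g"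
  shows "bounded_bsupp (fun_conv f g)"
  unfolding bounded_bsupp_def
proof (intro conjI)
  have [measurable]: "f \<in> borel_measurable borel" "g \<in> borel_measurable borel"
    using f g by (auto dest: bounded_bsupp_measurable)
  note conv = fun_conv_lborel[OF this]
  have "(\<lambda>x. LINT y|lborel. f y * g (x - y)) \<in> borel_measurable borel" by measurable
  then show "fun_conv f g \<in> borel_measurable borel" by (simp add: conv[abs_def])
  obtain C where C: "0 \<le> C" "\<And>x. norm (g x) \<le> C" using bounded_bsupp_bound[OF g] by blast
  have "norm (fun_conv f g x) \<le> (LINT y|lborel. norm (f y) * C)" for x
  proof -
    have "integrable lborel (\<lambda>y. f y * g (x - y))"
      by (intro bounded_bsupp_integrable_mult[OF f]) (use C in \<open>auto simp: bounded_iff\<close>)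
    then have "(LINT y|lborel. norm (f y * g (x - y))) \<le> (LINT y|lborel. norm (f y) * C)"
      using bounded_bsupp_integrable[OF f] C
      by (intro integral_mono integrable_norm integrable_mult_left) (auto simp: norm_mult intro!: mult_left_mono)
    with integral_norm_bound show ?thesis unfolding conv by (rule order_trans)
  qed
  then show "bounded (range (fun_conv f g))" by (auto simp: bounded_iff)
  obtain a b where ab: "\<And>x. f x \<noteq> 0 \<Longrightarrow> norm x \<le> a" "\<And>x. g x \<noteq> 0 \<Longrightarrow> norm x \<le> b"
    using f g unfolding bounded_bsupp_def bounded_iff by auto
  have "norm x \<le> a + b" if nz: "fun_conv f g x \<noteq> 0" for x
  proof -
    have "\<exists>y. f y * g (x - y) \<noteq> 0"
    proof (rule ccontr)
      assume "\<not> ?thesis"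
      then have "(\<lambda>y. f y * g (x - y)) = (\<lambda>y. 0)" by auto
      then have "fun_conv f g x = 0" unfolding conv by (simp only: integral_zero)
      with nz show False by simp
    qed
    then obtain y where "f y \<noteq> 0" "g (x - y) \<noteq> 0" by auto
    then have "norm y \<le> a" "norm (x - y) \<le> b" using ab by auto
    then show ?thesis using norm_triangle_ineq[of y "x - y"] by simp
  qed
  then show "bounded {x. fun_conv f g x \<noteq> 0}" unfolding bounded_iff by blast
qed

text \<open>The phase at \<open>x\<close> is the product of the phases at \<open>y\<close> and at
  \<open>x - y\<close>, so modulation distributes over convolution and Fubini is applied to the
  modulated functions.\<close>

lemma fourier_fun_conv:
  fixes f g :: "'a::euclidean_space \<Rightarrow> complex"
  assumes f: "bounded_bsupp f" and g: "bounded_bsupp g"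
  shows "fourier (fun_conv f g) \<xi> = fourier f \<xi> * fourier g \<xi>"
proof -
  have fm: "f \<in> borel_measurable borel" and gm: "g \<in> borel_measurable borel"
    using f g by (auto dest: bounded_bsupp_measurable)
  define F where "F = modulate \<xi> f"
  define H where "H = modulate \<xi> g"
  have F: "bounded_bsupp F" and H: "bounded_bsupp H" using f g by (auto simp: F_def H_def bounded_bsupp_modulate)
  have [measurable]: "F \<in> borel_measurable borel" "H \<in> borel_measurable borel"
    using F H by (auto dest: bounded_bsupp_measurable)
  have H_shift: "(LINT x|lborel. k (x - y)) = (LINT x|lborel. k x)"
    if "k \<in> borel_measurable borel" for k :: "'a \<Rightarrow> 'b::{banach, second_countable_topology}" and y
    using integral_lborel_translate[OF that, of "- y"] by simp
  have intH: "integrable lborel (\<lambda>x. H (x - y))" for y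
    using integrable_lborel_translate[OF bounded_bsupp_integrable[OF H], of "- y"] by simp
  have int: "integrable (lborel \<Otimes>\<^sub>M lborel) (\<lambda>(y, x). F y * H (x - y))"
  proof (rule lborel_pair.Fubini_integrable)
    have "(LINT x|lborel. norm (F y * H (x - y))) = norm (F y) * (LINT x|lborel. norm (H x))" for y
      using H_shift[of "\<lambda>x. norm (H x)" y] by (simp add: norm_mult)
    then show "integrable lborel (\<lambda>y. LINT x|lborel. norm (case (y, x) of (y, x) \<Rightarrow> F y * H (x - y)))"
      using bounded_bsupp_integrable[OF F] by simp
    show "AE y in lborel. integrable lborel (\<lambda>x. case (y, x) of (y, x) \<Rightarrow> F y * H (x - y))"
      by (intro AE_I2) (simp add: intH)
  qed measurable
  have "modulate \<xi> (fun_conv f g) x = (LINT y|lborel. F y * H (x - y))" for x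
  proof -
    have "F y * H (x - y) = f y * g (x - y) * cis (- 2 * pi * (x \<bullet> \<xi>))" for y
    proof -
      have "cis (- 2 * pi * (y \<bullet> \<xi>)) * cis (- 2 * pi * ((x - y) \<bullet> \<xi>)) = cis (- 2 * pi * (x \<bullet> \<xi>))"
        unfolding cis_mult by (simp add: inner_diff_left algebra_simps)
      then show ?thesis by (simp add: F_def H_def modulate_def mult_ac)
    qed
    then show ?thesis by (simp add: modulate_def fun_conv_lborel[OF fm gm])
  qed
  then have "fourier (fun_conv f g) \<xi> = (LINT x|lborel. (LINT y|lborel. F y * H (x - y)))"
    using bounded_bsupp_fun_conv[OF f g] by (simp add: fourier_lborel bounded_bsupp_measurable)
  also have "\<dots> = (LINT y|lborel. (LINT x|lborel. F y * H (x - y)))"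
    using int by (rule lborel_pair.Fubini_integral)
  also have "\<dots> = (LINT y|lborel. F y * (LINT x|lborel. H x))"
    by (simp add: H_shift)
  also have "\<dots> = fourier f \<xi> * fourier g \<xi>"
    using fm gm by (simp add: fourier_lborel F_def H_def)
  finally show ?thesis .
qed

lemma bounded_bsupp_tile_bspline: "compact G \<Longrightarrow> bounded_bsupp (tile_bspline G n)"
  by (induction n) (auto intro: bounded_bsupp_indicator bounded_bsupp_fun_conv)

text \<open>Real values make the autocorrelations real, which reconciles the opposite signs of the
  exponents in \<open>\<Phi>\<close> and in \<open>periodize_modulate_L2\<close>.\<close>

lemma cnj_tile_bspline: "cnj (tile_bspline G n x) = tile_bspline G n x"
proof (induction n arbitrary: x)
  case (Suc n)
  then show ?case
    unfolding tile_bspline.simps fun_conv_def Bochner_Integration.integral_cnj[symmetric]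
    by (intro Bochner_Integration.integral_cong refl) (simp add: indicator_def)
qed (simp add: indicator_def)

lemma fourier_tile_bspline:
  "compact G \<Longrightarrow> fourier (tile_bspline G n) \<xi> = fourier (indicator G) \<xi> ^ Suc n"
  by (induction n) (auto simp: fourier_fun_conv bounded_bsupp_indicator bounded_bsupp_tile_bspline)

lemma is_tile_properties:
  fixes G :: "(real ^ 'd) set"
  assumes "is_tile G"
  shows "compact G" "emeasure lborel G = 1" "\<exists>k. x - real_vec k \<in> G"
proof -
  obtain M D where MD: "expanding M" "digit_set M D" and G: "G = attractor M D"
    and m: "emeasure lebesgue G = 1" using assms by (auto simp: is_tile_def)
  interpret digit_system M D by unfold_locales (use MD in auto)
  show "compact G" unfolding G by (rule compact_attractor)
  then have "G \<in> sets borel" by (simp add: borel_compact)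
  then show "emeasure lborel G = 1" using m by simp
  show "\<exists>k. x - real_vec k \<in> G" unfolding G by (rule attractor_translates_cover)
qed

section \<open>Convergence in L2\<close>

lemma in_L2_diff:
  assumes "in_L2 f" "in_L2 g"
  shows "in_L2 (\<lambda>x. f x - g x)"
  unfolding in_L2_def
proof
  have [measurable]: "f \<in> borel_measurable lebesgue" "g \<in> borel_measurable lebesgue"
    using assms by (auto simp: in_L2_def)
  show "(\<lambda>x. f x - g x) \<in> borel_measurable lebesgue" by measurable
  have "integrable lebesgue (\<lambda>x. 2 * (norm (f x))\<^sup>2 + 2 * (norm (g x))\<^sup>2)"
    using assms by (auto simp: in_L2_def)
  then show "integrable lebesgue (\<lambda>x. (norm (f x - g x))\<^sup>2)"
  proof (rule Bochner_Integration.integrable_bound)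
    have "(norm (f x - g x))\<^sup>2 \<le> 2 * (norm (f x))\<^sup>2 + 2 * (norm (g x))\<^sup>2" for x
      using norm_add_power2_le[of "f x" "- g x"] by simp
    then show "AE x in lebesgue. norm ((norm (f x - g x))\<^sup>2) \<le> norm (2 * (norm (f x))\<^sup>2 + 2 * (norm (g x))\<^sup>2)"
      by (intro AE_I2) simp
  qed measurable
qed

lemma L2sq_eq_L2_norm:
  assumes "in_L2 f"
  shows "L2sq f = ennreal ((L2_norm f)\<^sup>2)"
  using assms unfolding L2sq_def L2_norm_def in_L2_def
  by (subst nn_integral_eq_integral) (auto simp: real_sqrt_pow2)

lemma L2_norm_nonneg: "0 \<le> L2_norm f"
  by (simp add: L2_norm_def)

text \<open>Under the membership conditions \<open>L2sq\<close> of a difference is the square of its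
  genuine L2 norm, so the convergence can be estimated in \<open>ennreal\<close>.\<close>

lemma L2_tendsto_iff_L2sq:
  "L2_tendsto f g F \<longleftrightarrow>
    (\<forall>i. in_L2 (f i)) \<and> in_L2 g \<and> ((\<lambda>i. L2sq (\<lambda>x. f i x - g x)) \<longlongrightarrow> 0) F"
proof (cases "(\<forall>i. in_L2 (f i)) \<and> in_L2 g")
  case True
  define n where "n i = L2_norm (\<lambda>x. f i x - g x)" for i
  have n0: "0 \<le> n i" for i by (simp add: n_def L2_norm_nonneg)
  have eq: "L2sq (\<lambda>x. f i x - g x) = ennreal ((n i)\<^sup>2)" for i
    unfolding n_def using True by (intro L2sq_eq_L2_norm in_L2_diff) auto
  have "(n \<longlongrightarrow> 0) F \<longleftrightarrow> ((\<lambda>i. (n i)\<^sup>2) \<longlongrightarrow> 0) F"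
  proof
    assume "((\<lambda>i. (n i)\<^sup>2) \<longlongrightarrow> 0) F"
    from tendsto_real_sqrt[OF this] show "(n \<longlongrightarrow> 0) F" using n0 by simp
  next
    assume "(n \<longlongrightarrow> 0) F"
    from tendsto_power[OF this, of 2] show "((\<lambda>i. (n i)\<^sup>2) \<longlongrightarrow> 0) F" by simp
  qed
  also have "\<dots> \<longleftrightarrow> ((\<lambda>i. ennreal ((n i)\<^sup>2)) \<longlongrightarrow> ennreal 0) F"
    by (rule tendsto_ennreal_iff[symmetric]) auto
  finally show ?thesis using True by (simp add: L2_tendsto_def eq) (simp add: n_def[abs_def])
qed (auto simp: L2_tendsto_def)

lemma bounded_bsupp_in_L2: "bounded_bsupp f \<Longrightarrow> in_L2 f"
proof -
  assume f: "bounded_bsupp f"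
  have [measurable]: "f \<in> borel_measurable borel" using f by (rule bounded_bsupp_measurable)
  have "bounded (range (\<lambda>x. cnj (f x)))" using bounded_bsupp_bound[OF f] by (auto simp: bounded_iff)
  then have "integrable lborel (\<lambda>x. f x * cnj (f x))" by (intro bounded_bsupp_integrable_mult[OF f]) measurable
  then have "integrable lborel (\<lambda>x. norm (f x * cnj (f x)))" by (rule integrable_norm)
  then have "integrable lebesgue (\<lambda>x. (norm (f x))\<^sup>2)"
    by (subst integrable_completion) (auto simp: norm_mult power2_eq_square)
  then show ?thesis by (simp add: in_L2_def borel_imp_lebesgue_measurable)
qed

lemma bounded_bsupp_0: "bounded_bsupp (\<lambda>x. 0)"
  by (simp add: bounded_bsupp_def)

lemma bounded_bsupp_cmult: "bounded_bsupp f \<Longrightarrow> bounded_bsupp (\<lambda>x. c * f x)"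
  using bounded_bsupp_mult[of f "\<lambda>_. c"] by (simp add: mult.commute)

lemma bounded_bsupp_add:
  assumes "bounded_bsupp f" "bounded_bsupp g"
  shows "bounded_bsupp (\<lambda>x. f x + g x)"
  using bounded_bsupp_diff[OF assms(1) bounded_bsupp_cmult[OF assms(2), of "- 1"]] by simp

lemma bounded_bsupp_sum: "(\<And>k. k \<in> F \<Longrightarrow> bounded_bsupp (f k)) \<Longrightarrow> bounded_bsupp (\<lambda>x. \<Sum>k\<in>F. f k x)"
  by (induction F rule: infinite_finite_induct) (auto intro: bounded_bsupp_0 bounded_bsupp_add)

lemma fourier_sum_shifts:
  fixes \<phi> :: "real ^ 'd \<Rightarrow> complex"
  assumes \<phi>: "bounded_bsupp \<phi>"
  shows "fourier (\<lambda>x. \<Sum>k\<in>F. b k * \<phi> (x - real_vec k)) \<xi> = (\<Sum>k\<in>F. b k * chr (- k) \<xi>) * fourier \<phi> \<xi>"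
proof -
  have [measurable]: "\<phi> \<in> borel_measurable borel" using \<phi> by (rule bounded_bsupp_measurable)
  have eq: "modulate \<xi> (\<lambda>x. \<Sum>k\<in>F. b k * \<phi> (x - real_vec k)) x =
      (\<Sum>k\<in>F. (b k * chr (- k) \<xi>) * modulate \<xi> \<phi> (x - real_vec k))" for x
  proof -
    have "cis (- 2 * pi * (x \<bullet> \<xi>)) = chr (- k) \<xi> * cis (- 2 * pi * ((x - real_vec k) \<bullet> \<xi>))" for k
      unfolding chr_def cis_mult by (simp add: real_vec_minus inner_diff_left algebra_simps)
    then show ?thesis
      unfolding modulate_def sum_distrib_right by (intro sum.cong refl) (simp add: mult_ac)
  qed
  have m: "modulate \<xi> \<phi> \<in> borel_measurable borel" using \<phi> by (intro bounded_bsupp_measurable bounded_bsupp_modulate)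
  have int: "integrable lborel (\<lambda>x. modulate \<xi> \<phi> (x - real_vec k))" for k
    using integrable_lborel_translate[OF bounded_bsupp_integrable[OF bounded_bsupp_modulate[OF \<phi>]], of \<xi> "- real_vec k"] by simp
  have "fourier (\<lambda>x. \<Sum>k\<in>F. b k * \<phi> (x - real_vec k)) \<xi>
      = (LINT x|lborel. (\<Sum>k\<in>F. (b k * chr (- k) \<xi>) * modulate \<xi> \<phi> (x - real_vec k)))"
    by (subst fourier_lborel, measurable) (intro Bochner_Integration.integral_cong refl eq)
  also have "\<dots> = (\<Sum>k\<in>F. (b k * chr (- k) \<xi>) * (LINT x|lborel. modulate \<xi> \<phi> (x - real_vec k)))"
    using int by (subst Bochner_Integration.integral_sum) auto
  also have "\<dots> = (\<Sum>k\<in>F. b k * chr (- k) \<xi>) * fourier \<phi> \<xi>"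
    using integral_lborel_translate[OF m, of "- real_vec _"]
    by (simp add: fourier_lborel sum_distrib_right)
  finally show ?thesis .
qed

lemma fourier_coeff_eq_cube:
  fixes f :: "real ^ 'd \<Rightarrow> complex"
  assumes [measurable]: "f \<in> borel_measurable borel"
  shows "fourier_coeff f k = (LINT x|cube_measure. f x * chr k x)"
proof -
  obtain N :: "(real ^ 'd) set" where N: "N \<in> null_sets lborel" "cbox 0 One = unit_cube \<union> N" "unit_cube \<inter> N = {}"
    by (rule unit_cube_Un_null)
  have "fourier_coeff f k = (LINT x|lborel. indicator (cbox 0 One) x *\<^sub>R (f x * chr k x))"
    unfolding fourier_coeff_def set_lebesgue_integral_def chr_def[symmetric]
    by (rule integral_completion) measurable
  also have "\<dots> = (LINT x|lborel. indicator unit_cube x *\<^sub>R (f x * chr k x))"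
  proof (rule integral_cong_AE)
    show "AE x in lborel. indicator (cbox 0 One) x *\<^sub>R (f x * chr k x) = indicator unit_cube x *\<^sub>R (f x * chr k x)"
      using AE_not_in[OF N(1)] by eventually_elim (auto simp: N(2) indicator_def)
  qed measurable
  also have "\<dots> = (LINT x|cube_measure. f x * chr k x)" by (simp add: integral_restrict_space)
  finally show ?thesis .
qed

theorem theorem1:
  fixes G :: "(real ^ 'd) set" and n :: nat
    and \<phi> \<phi>\<^sub>1 \<Phi> :: "real ^ 'd \<Rightarrow> complex"
    and \<Phi>c b :: "int ^ 'd \<Rightarrow> complex"
  assumes tile: "is_tile G"
    and phi: "\<phi> = tile_bspline G n"
    and phi1: "orthogonalization \<phi> \<phi>\<^sub>1"
    and Phi_coeff: "\<And>k. \<Phi>c k = L2_inner \<phi> (\<lambda>x. \<phi> (x + real_vec k))"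
    and Phi: "\<And>\<xi>. \<Phi> \<xi> = (\<Sum>\<^sub>\<infinity>k\<in>UNIV. \<Phi>c k * cis (- 2 * pi * (real_vec k \<bullet> \<xi>)))"
    and b: "\<And>k. b k = fourier_coeff (\<lambda>\<xi>. 1 / csqrt (\<Phi> \<xi>)) k"
  shows "L2_tendsto (\<lambda>F x. \<Sum>k\<in>F. b k * \<phi> (x - real_vec k)) \<phi>\<^sub>1 (finite_subsets_at_top UNIV) \<and>
    (\<forall>\<xi>. ((\<lambda>k. b k * cis (- 2 * pi * (real_vec k \<bullet> \<xi>))) has_sum (1 / csqrt (\<Phi> \<xi>))) UNIV)"
proof -
  have G: "compact G" "emeasure lborel G = 1" and cover: "\<And>x. \<exists>k. x - real_vec k \<in> G"
    using is_tile_properties[OF tile] by auto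
  have \<phi>: "bounded_bsupp \<phi>" unfolding phi by (rule bounded_bsupp_tile_bspline[OF G(1)])
  have [measurable]: "\<phi> \<in> borel_measurable borel" using \<phi> by (rule bounded_bsupp_measurable)
  have real: "cnj (\<phi> x) = \<phi> x" for x unfolding phi by (rule cnj_tile_bspline)
  define S where "S \<xi> = (LINT x|cube_measure. (norm (periodize (modulate \<xi> \<phi>) x))\<^sup>2)" for \<xi>
  have S_sum: "((\<lambda>j. (norm (fourier \<phi> (\<xi> + real_vec j)))\<^sup>2) has_sum S \<xi>) UNIV" for \<xi>
    unfolding S_def using \<phi> by (rule has_sum_fourier_shifts)
  have S_exp: "complex_of_real (S \<xi>) = (\<Sum>m\<in>corr_shifts \<phi>. autocorr \<phi> m * chr m \<xi>)" for \<xi>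
    unfolding S_def using \<phi> by (rule periodize_modulate_L2)
  have S_pos: "0 < S \<xi>" for \<xi>
  proof -
    obtain j where "fourier (indicator G) (\<xi> + real_vec j) \<noteq> 0"
      using tile_fourier_nonzero[OF G cover] by blast
    then have "0 < (norm (fourier \<phi> (\<xi> + real_vec j)))\<^sup>2"
      by (simp add: phi fourier_tile_bspline[OF G(1)])
    also have "(norm (fourier \<phi> (\<xi> + real_vec j)))\<^sup>2 \<le> S \<xi>"
      using has_sum_mono_neutral[OF has_sum_finite[of "{j}" "\<lambda>j. (norm (fourier \<phi> (\<xi> + real_vec j)))\<^sup>2"] S_sum[of \<xi>]]
      by simp
    finally show ?thesis .
  qed
  have corr: "\<Phi>c k = autocorr \<phi> k" for k
    unfolding Phi_coeff L2_inner_def autocorr_def by (rule integral_completion) measurable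
  have cnj_corr: "cnj (autocorr \<phi> k) = autocorr \<phi> k" for k
    unfolding autocorr_def Bochner_Integration.integral_cnj[symmetric] by (simp add: real)
  have \<Phi>S: "\<Phi> \<xi> = complex_of_real (S \<xi>)" for \<xi>
  proof -
    have "((\<lambda>k. \<Phi>c k * cis (- 2 * pi * (real_vec k \<bullet> \<xi>))) has_sum (\<Sum>k\<in>corr_shifts \<phi>. autocorr \<phi> k * chr (- k) \<xi>)) UNIV"
      unfolding cis_minus_eq_chr corr
      by (rule has_sum_finite_neutralI[OF finite_corr_shifts[OF \<phi>]]) (auto simp: autocorr_eq_0)
    then have "\<Phi> \<xi> = (\<Sum>k\<in>corr_shifts \<phi>. autocorr \<phi> k * chr (- k) \<xi>)"
      unfolding Phi by (rule infsumI)
    \<comment> \<open>\<open>\<Phi>\<close> carries the characters of \<open>- k\<close> where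
      \<open>S\<close> carries those of \<open>k\<close>. With real coefficients the two sums are
      conjugate, and \<open>S\<close> is real.\<close>
    also have "\<dots> = cnj (complex_of_real (S \<xi>))"
      unfolding S_exp by (simp add: cnj_corr cnj_chr)
    finally show ?thesis by simp
  qed
  have sqrt: "1 / csqrt (\<Phi> \<xi>) = complex_of_real (1 / sqrt (S \<xi>))" for \<xi>
    unfolding \<Phi>S using S_pos[of \<xi>] by (simp add: csqrt_of_real_nonneg less_imp_le)
  have "is_trigpoly (\<lambda>\<xi>. complex_of_real (S \<xi>))"
    unfolding S_exp by (intro is_trigpoly_sum is_trigpoly_mult is_trigpoly_const is_trigpoly_chr)
  then obtain N where N: "trigpoly N (\<lambda>\<xi>. complex_of_real (S \<xi>))" by (auto simp: is_trigpoly_def)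
  have "S = (\<lambda>\<xi>. Re (\<Sum>m\<in>corr_shifts \<phi>. autocorr \<phi> m * chr m \<xi>))" unfolding S_exp[symmetric] by simp
  then have [measurable]: "S \<in> borel_measurable borel" by simp
  define c where "c k = (LINT y|cube_measure. complex_of_real (1 / sqrt (S y)) * chr (- k) y)" for k
  \<comment> \<open>\<open>fourier_coeff\<close> integrates against \<open>chr k\<close>, matching
    expansions in the inverse characters, whereas \<open>c\<close> refers to the characters
    themselves.\<close>
  have b_c: "b k = c (- k)" for k
    unfolding b sqrt c_def by (subst fourier_coeff_eq_cube) auto
  have c_sum: "((\<lambda>k. c k * chr k \<xi>) has_sum complex_of_real (1 / sqrt (S \<xi>))) UNIV" for \<xi>
    unfolding c_def using N S_pos by (rule fourier_series_inverse_sqrt)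
  have b_sum: "((\<lambda>k. b k * chr (- k) \<xi>) has_sum complex_of_real (1 / sqrt (S \<xi>))) UNIV" for \<xi>
    unfolding b_c
    using has_sum_reindex_bij_betw[of uminus "UNIV :: (int ^ 'd) set" UNIV "\<lambda>k. c k * chr k \<xi>"] c_sum[of \<xi>]
    by (simp add: bij_uminus)
  \<comment> \<open>At 0 all characters equal 1, and unordered summability of complex numbers is
    absolute.\<close>
  have b_abs: "(\<lambda>k. norm (b k)) summable_on UNIV"
    using has_sum_imp_summable[OF b_sum[of 0]] by (simp add: summable_on_iff_abs_summable_on_complex)
  \<comment> \<open>The tail of the absolutely convergent coefficient series bounds the error of a
    partial sum uniformly in \<open>\<xi>\<close>.\<close>
  define \<tau> where "\<tau> F = (\<Sum>\<^sub>\<infinity>k\<in>UNIV. norm (b k)) - (\<Sum>k\<in>F. norm (b k))" for F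
  have \<tau>_lim: "(\<tau> \<longlongrightarrow> 0) (finite_subsets_at_top UNIV)"
  proof -
    have "((\<lambda>F. \<Sum>k\<in>F. norm (b k)) \<longlongrightarrow> (\<Sum>\<^sub>\<infinity>k\<in>UNIV. norm (b k))) (finite_subsets_at_top UNIV)"
      using has_sum_infsum[OF b_abs] by (simp add: has_sum_def)
    from tendsto_diff[OF tendsto_const[of "\<Sum>\<^sub>\<infinity>k\<in>UNIV. norm (b k)"] this] show ?thesis unfolding \<tau>_def[abs_def] by simp
  qed
  have tail: "norm ((\<Sum>k\<in>F. b k * chr (- k) \<xi>) - complex_of_real (1 / sqrt (S \<xi>))) \<le> \<tau> F" if F: "finite F" for F \<xi>
  proof -
    have 1: "((\<lambda>k. b k * chr (- k) \<xi>) has_sum (complex_of_real (1 / sqrt (S \<xi>)) - (\<Sum>k\<in>F. b k * chr (- k) \<xi>))) (UNIV - F)"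
      by (rule has_sum_Diff[OF b_sum has_sum_finite[OF F]]) simp
    have 2: "((\<lambda>k. norm (b k)) has_sum \<tau> F) (UNIV - F)"
      unfolding \<tau>_def by (rule has_sum_Diff[OF has_sum_infsum[OF b_abs] has_sum_finite[OF F]]) simp
    have "norm (complex_of_real (1 / sqrt (S \<xi>)) - (\<Sum>k\<in>F. b k * chr (- k) \<xi>)) \<le> \<tau> F"
      by (rule norm_infsum_le[OF 1 2]) (simp add: norm_mult)
    then show ?thesis by (simp add: norm_minus_commute)
  qed
  define h where "h F x = (\<Sum>k\<in>F. b k * \<phi> (x - real_vec k))" for F x
  have bounded_bsupp_h: "bounded_bsupp (h F)" for F
    unfolding h_def using bounded_bsupp_translate[OF \<phi>, of "- real_vec _"] by (intro bounded_bsupp_sum bounded_bsupp_cmult) simp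
  define g where "g \<xi> = fourier \<phi> \<xi> * complex_of_real (1 / sqrt (S \<xi>))" for \<xi>
  \<comment> \<open>\<open>S_sum\<close> holds at every point, so the quotient in
    \<open>orthogonalization\<close> is literally the function \<open>g\<close>, not merely an
    almost everywhere version of it.\<close>
  have "L2_fourier \<phi>\<^sub>1 g"
    using phi1 unfolding orthogonalization_def infsumI[OF S_sum] g_def by (simp add: divide_inverse)
  then obtain u where u_int: "\<And>m. integrable lebesgue (u m)" and u_lim: "L2_tendsto u \<phi>\<^sub>1 sequentially"
    and fu_lim: "L2_tendsto (\<lambda>m. fourier (u m)) g sequentially"
    unfolding L2_fourier_def by blast
  have u_L2: "in_L2 (u m)" "in_L2 (fourier (u m))" "in_L2 \<phi>\<^sub>1" "in_L2 g" for m
    using u_lim fu_lim by (auto simp: L2_tendsto_def)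
  have meas [measurable]: "h F \<in> borel_measurable lebesgue" "fourier (h F) \<in> borel_measurable lebesgue" for F
    using bounded_bsupp_measurable[OF bounded_bsupp_h, of F] by (auto intro: borel_imp_lebesgue_measurable)
  have meas' [measurable]: "u m \<in> borel_measurable lebesgue" "fourier (u m) \<in> borel_measurable lebesgue"
    "\<phi>\<^sub>1 \<in> borel_measurable lebesgue" "g \<in> borel_measurable lebesgue" for m
    using u_L2 by (auto simp: in_L2_def)
  \<comment> \<open>The inequality for Fourier transforms applies to \<open>h F - u m\<close>, which
    is integrable, but not directly to \<open>h F - \<phi>\<^sub>1\<close>. Two triangle estimates
    and the constant 4 give 2 * 4 * 2 = 16; the terms in \<open>u m\<close> vanish in the
    limit.\<close>
  have dist: "L2sq (\<lambda>x. h F x - \<phi>\<^sub>1 x) \<le> 16 * L2sq (\<lambda>\<xi>. fourier (h F) \<xi> - g \<xi>)" for F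
  proof -
    have step: "L2sq (\<lambda>x. h F x - \<phi>\<^sub>1 x) \<le> 2 * (4 * (2 * L2sq (\<lambda>\<xi>. fourier (h F) \<xi> - g \<xi>)
        + 2 * L2sq (\<lambda>\<xi>. fourier (u m) \<xi> - g \<xi>))) + 2 * L2sq (\<lambda>x. u m x - \<phi>\<^sub>1 x)" for m
    proof -
      have L2: "in_L2 (\<lambda>x. h F x - u m x)" by (intro in_L2_diff bounded_bsupp_in_L2 bounded_bsupp_h u_L2)
      have "L2sq (\<lambda>x. h F x - u m x) \<le> 4 * L2sq (fourier (\<lambda>x. h F x - u m x))"
        using L2sq_eq_L2_norm[OF L2]
        by (intro L2sq_le_L2sq_fourier Bochner_Integration.integrable_diff bounded_bsupp_integrable_lebesgue bounded_bsupp_h u_int) simp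
      also have "L2sq (fourier (\<lambda>x. h F x - u m x)) = L2sq (\<lambda>\<xi>. fourier (h F) \<xi> - fourier (u m) \<xi>)"
        by (simp add: fourier_diff bounded_bsupp_integrable_lebesgue bounded_bsupp_h u_int L2sq_def)
      also have "\<dots> \<le> 2 * L2sq (\<lambda>\<xi>. fourier (h F) \<xi> - g \<xi>) + 2 * L2sq (\<lambda>\<xi>. g \<xi> - fourier (u m) \<xi>)"
        by (intro L2sq_triangle meas meas')
      also have "L2sq (\<lambda>\<xi>. g \<xi> - fourier (u m) \<xi>) = L2sq (\<lambda>\<xi>. fourier (u m) \<xi> - g \<xi>)"
        by (rule L2sq_minus_commute)
      finally have 1: "L2sq (\<lambda>x. h F x - u m x) \<le> 4 * (2 * L2sq (\<lambda>\<xi>. fourier (h F) \<xi> - g \<xi>)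
          + 2 * L2sq (\<lambda>\<xi>. fourier (u m) \<xi> - g \<xi>))"
        by (meson mult_left_mono order_trans zero_le)
      have "L2sq (\<lambda>x. h F x - \<phi>\<^sub>1 x) \<le> 2 * L2sq (\<lambda>x. h F x - u m x) + 2 * L2sq (\<lambda>x. u m x - \<phi>\<^sub>1 x)"
        by (intro L2sq_triangle meas meas')
      also have "\<dots> \<le> 2 * (4 * (2 * L2sq (\<lambda>\<xi>. fourier (h F) \<xi> - g \<xi>)
          + 2 * L2sq (\<lambda>\<xi>. fourier (u m) \<xi> - g \<xi>))) + 2 * L2sq (\<lambda>x. u m x - \<phi>\<^sub>1 x)"
        by (intro add_right_mono mult_left_mono 1) simp
      finally show ?thesis .
    qed
    have "(\<lambda>m. 2 * (4 * (2 * L2sq (\<lambda>\<xi>. fourier (h F) \<xi> - g \<xi>)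
        + 2 * L2sq (\<lambda>\<xi>. fourier (u m) \<xi> - g \<xi>))) + 2 * L2sq (\<lambda>x. u m x - \<phi>\<^sub>1 x))
      \<longlonglongrightarrow> 2 * (4 * (2 * L2sq (\<lambda>\<xi>. fourier (h F) \<xi> - g \<xi>) + 2 * 0)) + 2 * 0"
      using u_lim fu_lim unfolding L2_tendsto_iff_L2sq
      by (intro tendsto_add tendsto_const ennreal_tendsto_cmult) auto
    then have "L2sq (\<lambda>x. h F x - \<phi>\<^sub>1 x) \<le> 2 * (4 * (2 * L2sq (\<lambda>\<xi>. fourier (h F) \<xi> - g \<xi>) + 2 * 0)) + 2 * 0"
      by (rule LIMSEQ_le_const) (use step in auto)
    then show ?thesis by (simp add: mult.assoc[symmetric])
  qed
  \<comment> \<open>Both transforms are multiples of the transform of \<open>\<phi>\<close>, so the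
    uniform bound on the multipliers factors out of the L2 norm.\<close>
  have conv: "L2sq (\<lambda>\<xi>. fourier (h F) \<xi> - g \<xi>) \<le> ennreal ((\<tau> F)\<^sup>2) * L2sq \<phi>" if F: "finite F" for F
  proof -
    have "L2sq (\<lambda>\<xi>. fourier (h F) \<xi> - g \<xi>) \<le> (\<integral>\<^sup>+\<xi>. ennreal ((\<tau> F)\<^sup>2) * ennreal ((norm (fourier \<phi> \<xi>))\<^sup>2) \<partial>lborel)"
      unfolding L2sq_lborel
    proof (rule nn_integral_mono)
      fix \<xi>
      have "fourier (h F) \<xi> - g \<xi> = ((\<Sum>k\<in>F. b k * chr (- k) \<xi>) - complex_of_real (1 / sqrt (S \<xi>))) * fourier \<phi> \<xi>"
        unfolding h_def g_def fourier_sum_shifts[OF \<phi>] by (simp add: algebra_simps)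
      then have "(norm (fourier (h F) \<xi> - g \<xi>))\<^sup>2 \<le> (\<tau> F)\<^sup>2 * (norm (fourier \<phi> \<xi>))\<^sup>2"
        unfolding power_mult_distrib[symmetric]
        using tail[OF F, of \<xi>] by (intro power_mono) (auto simp: norm_mult intro!: mult_right_mono)
      then show "ennreal ((norm (fourier (h F) \<xi> - g \<xi>))\<^sup>2) \<le> ennreal ((\<tau> F)\<^sup>2) * ennreal ((norm (fourier \<phi> \<xi>))\<^sup>2)"
        by (simp add: ennreal_leI flip: ennreal_mult)
    qed
    also have "\<dots> = ennreal ((\<tau> F)\<^sup>2) * L2sq (fourier \<phi>)"
      unfolding L2sq_lborel by (rule nn_integral_cmult) measurable
    also have "L2sq (fourier \<phi>) = L2sq \<phi>" using \<phi> by (rule L2sq_fourier_bounded_bsupp)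
    finally show ?thesis .
  qed
  have "L2_tendsto h \<phi>\<^sub>1 (finite_subsets_at_top UNIV)"
    unfolding L2_tendsto_iff_L2sq
  proof (intro conjI allI)
    have fin: "16 * L2sq \<phi> < top"
      using L2sq_eq_L2_norm[OF bounded_bsupp_in_L2[OF \<phi>]] by (simp add: ennreal_mult_less_top)
    have "((\<lambda>F. ennreal ((\<tau> F)\<^sup>2)) \<longlongrightarrow> ennreal (0\<^sup>2)) (finite_subsets_at_top UNIV)"
      by (intro tendsto_ennrealI tendsto_power \<tau>_lim)
    then have "((\<lambda>F. (16 * L2sq \<phi>) * ennreal ((\<tau> F)\<^sup>2)) \<longlongrightarrow> (16 * L2sq \<phi>) * 0) (finite_subsets_at_top UNIV)"
      using fin by (intro ennreal_tendsto_cmult) auto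
    then have lim: "((\<lambda>F. (16 * L2sq \<phi>) * ennreal ((\<tau> F)\<^sup>2)) \<longlongrightarrow> 0) (finite_subsets_at_top UNIV)" by simp
    show "((\<lambda>F. L2sq (\<lambda>x. h F x - \<phi>\<^sub>1 x)) \<longlongrightarrow> 0) (finite_subsets_at_top UNIV)"
    proof (rule tendsto_sandwich[OF _ _ tendsto_const lim])
      show "eventually (\<lambda>F. L2sq (\<lambda>x. h F x - \<phi>\<^sub>1 x) \<le> (16 * L2sq \<phi>) * ennreal ((\<tau> F)\<^sup>2)) (finite_subsets_at_top UNIV)"
      proof (rule eventually_finite_subsets_at_top_weakI)
        fix F :: "(int ^ 'd) set" assume "finite F"
        then have "L2sq (\<lambda>x. h F x - \<phi>\<^sub>1 x) \<le> 16 * (ennreal ((\<tau> F)\<^sup>2) * L2sq \<phi>)"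
          using order_trans[OF dist mult_left_mono[OF conv]] by simp
        then show "L2sq (\<lambda>x. h F x - \<phi>\<^sub>1 x) \<le> (16 * L2sq \<phi>) * ennreal ((\<tau> F)\<^sup>2)"
          by (simp add: mult_ac)
      qed
    qed simp
  qed (use u_L2 bounded_bsupp_in_L2[OF bounded_bsupp_h] in auto)
  moreover have "((\<lambda>k. b k * cis (- 2 * pi * (real_vec k \<bullet> \<xi>))) has_sum (1 / csqrt (\<Phi> \<xi>))) UNIV" for \<xi>
    unfolding sqrt cis_minus_eq_chr by (rule b_sum)
  ultimately show ?thesis unfolding h_def[abs_def] by blast
qed

end
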